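(* Let $(E,\|\cdot\|)$ be a $\mathcal{T}_{\varepsilon,\lambda}$-complete random normed module over $\mathbb{K}$ with base $(\Omega,\mathcal{F},P)$ and let $G$ be an $L^0$-convexly compact subset of $E$. Then $G$ has random complete normal structure if and only if $G$ has random normal structure.
   Context: $(\Omega,\mathcal{F},P)$ is a probability space and $\mathbb{K}\in\{\mathbb{R},\mathbb{C}\}$. $L^0(\mathcal{F},\mathbb{K})$ is the algebra of a.s.-equivalence classes of $\mathbb{K}$-valued $\mathcal{F}$-measurable random variables, $L^0(\mathcal{F})=L^0(\mathcal{F},\mathbb{R})$, ordered by $\xi\le\eta$ iff $\xi\leq\eta$ a.s. (a Dedekind complete lattice), and $L^0_+(\mathcal{F})=\{\xi\in L^0(\mathcal{F}):\xi\ge 0\}$. $\bar L^0(\mathcal{F})$ is the complete lattice of classes of extended real-valued random variables; $\bigvee,\bigwedge$ denote supremum and infimum there. $\xi>\eta$ means $\xi\ge\eta$ and $\xi\ne\eta$; "$\xi>\eta$ on $A$" (for $A\in\mathcal F$) means $\xi(\omega)>\eta(\omega)$ for almost all $\omega\in A$; $(\xi>\eta)=\{\omega:\xi(\omega)>\eta(\omega)\}$ (up to null sets). $\tilde I_A$ is the class of the indicator of $A\in\mathcal{F}$. $\Pi_{\mathcal F}$ is the set of countable partitions $\{A_n,n\in\mathbb{N}\}$ of $\Omega$ into members of $\mathcal F$. A random normed module (RN module) over $\mathbb{K}$ with base $(\Omega,\mathcal{F},P)$ is an $L^0(\mathcal{F},\mathbb{K})$-module $E$ with a map $\|\cdot\|:E\to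 L^0_+(\mathcal{F})$ such that $\|\xi x\|=|\xi|\|x\|$, $\|x+y\|\le\|x\|+\|y\|$, and $\|x\|=0$ implies $x=\theta$ (the null element). The $(\varepsilon,\lambda)$-topology $\mathcal{T}_{\varepsilon,\lambda}$ is the metrizable linear topology with local base at $\theta$ the sets $\{x: P\{\|x\|<\varepsilon\}>1-\lambda\}$, $\varepsilon>0$, $0<\lambda<1$ ($x_n\to x$ iff $\|x_n-x\|\to0$ in probability). $G^-_{\varepsilon,\lambda}$ is the $\mathcal{T}_{\varepsilon,\lambda}$-closure of $G$. $G\subset E$ is a.s. bounded if $\bigvee\{\|g\|:g\in G\}\in L^0_+(\mathcal F)$, and $L^0$-convex if $\xi x+(1-\xi)y\in G$ for all $x,y\in G$ and $\xi\in L^0_+(\mathcal F)$ with $0\le\xi\le1$. A nonempty $\mathcal{T}_{\varepsilon,\lambda}$-closed $L^0$-convex subset $G$ of $E$ is $L^0$-convexly compact if every family of $\mathcal{T}_{\varepsilon,\lambda}$-closed $L^0$-convex subsets of $G$ with the finite intersection property has nonempty intersection (such $G$ is automatically a.s. bounded). Random Chebyshev notions: for $H\subset E$ nonempty a.s. bounded and $G\subset E$ nonempty, $R(H,x)=\bigvee\{\|x-y\|:y\in H\}$ for $x\in E$, $R(H,G)=\bigwedge\{R(H,x):x\in G\}$, $C(H,G)=\{x\in G:R(H,x)=R(H,G)\}$. The random diameter is $D(H)=\bigvee\{\|x-y\|:x,y\in H\}$. Random normal structure: a nonempty $\mathcal{T}_{\varepsilon,\lambda}$-closed $L^0$-convex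 $G\subset E$ has random normal structure if for each a.s. bounded $\mathcal{T}_{\varepsilon,\lambda}$-closed $L^0$-convex $H\subset G$ with $D(H)>0$ there is $z\in H$ with $R(H,z)<D(H)$ on $(D(H)>0)$. Stability: a nonempty $G\subset E$ is $\sigma$-stable if for every sequence $\{x_n\}$ in $G$ and $\{A_n\}\in\Pi_{\mathcal F}$ there is $x\in G$ with $\tilde I_{A_n}x=\tilde I_{A_n}x_n$ for all $n$; this unique $x$ is written $\sum_n\tilde I_{A_n}x_n$. For nonempty subsets $G_n$ of a $\sigma$-stable set, $\sum_n\tilde I_{A_n}G_n=\{\sum_n\tilde I_{A_n}x_n:x_n\in G_n\}$. Let $B_{\mathcal F}$ be the measure algebra of classes $a=[A]$, $A\in\mathcal F$, modulo null sets (lower-case $a_n$ is the class of $A_n$), with $1=[\Omega]$, $0=[\emptyset]$; a sequence $\{a_n\}$ is a partition of unity if $\bigvee_n a_n=1$ and $a_i\wedge a_j=0$ for $i\ne j$. For a nonempty set $X$, an equivalence relation on $X\times B_{\mathcal F}$ (class of $(x,a)$ denoted $x|a$) is regular if: $x|a=y|b$ implies $a=b$; $x|a=y|a$ implies $x|b=y|b$ for all $b\le a$; $\{a:x|a=y|a\}$ has a greatest element for all $x,y$; $x|1=y|1$ implies $x=y$. $X$ is $B_{\mathcal F}$-stable if, with respect to a given regular equivalence relation, for every sequence $\{x_n\}$ in $X$ and partition of unity $\{a_n\}$ there is a (necessarily unique) $x\in X$, written $\sum_n x_n|a_n$, with $x|a_n=x_n|a_n$ for all $n$. A consistent net of $\sigma$-stable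 subsets of a $\sigma$-stable set is a family $\{G_\alpha,\alpha\in\Lambda\}$ of $\sigma$-stable subsets of it, indexed by a $B_{\mathcal F}$-stable directed set $\Lambda$, such that $G_{\sum_n\alpha_n|a_n}=\sum_n\tilde I_{A_n}G_{\alpha_n}$ for all sequences $\{\alpha_n\}$ in $\Lambda$ and partitions of unity $\{a_n\}$, $a_n=[A_n]$. It is decreasing if $G_\alpha\subset G_\beta$ whenever $\alpha\ge\beta$. Random complete normal structure: an a.s. bounded $\mathcal{T}_{\varepsilon,\lambda}$-closed $L^0$-convex $G\subset E$ has random complete normal structure if every $\mathcal{T}_{\varepsilon,\lambda}$-closed $L^0$-convex $W\subset G$ containing more than one point satisfies: for every decreasing consistent net $\{W_\alpha,\alpha\in\Lambda\}$ of $\sigma$-stable subsets of $W$ with $R(W_\alpha,W)=R(W,W)$ for all $\alpha\in\Lambda$, one has $[\bigcup_{\alpha\in\Lambda}C(W_\alpha,W)]^-_{\varepsilon,\lambda}\ne\emptyset$ and for any $B\in\mathcal F$, $B\subset(D(W)>0)$ with $P(B)>0$ there is $y_B\in W$ with $\tilde I_By_B\notin\tilde I_B[\bigcup_{\alpha\in\Lambda}C(W_\alpha,W)]^-_{\varepsilon,\lambda}$. *)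

theory Defs
  imports "HOL-Probability.Probability" "HOL-Algebra.Module" "HOL-Algebra.Complete_Lattice"
begin

section \<open>Equivalence classes of random variables\<close>

text \<open>
  An element of \<open>L\<^sup>0\<close> is a genuine equivalence class, i.e. a set of Borel measurable functions.
  The scalar field is a type of class
  \<^class>\<open>real_normed_field\<close>: since the norm of such a field is multiplicative, the
  Gelfand--Mazur theorem says that, up to isometric isomorphism, it is exactly
  the real or the complex numbers.  Second countability (automatic for both) is what makes sums and
  products of Borel functions measurable.
\<close>

definition as_eq_rel :: "'w measure \<Rightarrow> ('w \<Rightarrow> 'b::topological_space) rel" where
  "as_eq_rel M = {(f, g). f \<in> borel_measurable M \<and> g \<in> borel_measurable M \<and> (AE w in M. f w = g w)}"

definition L0 :: "'w measure \<Rightarrow> ('w \<Rightarrow> 'b::topological_space) set set" where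
  "L0 M = borel_measurable M // as_eq_rel M"

definition L0_class :: "'w measure \<Rightarrow> ('w \<Rightarrow> 'b::topological_space) \<Rightarrow> ('w \<Rightarrow> 'b) set" where
  "L0_class M f = as_eq_rel M `` {f}"

definition L0_map :: "'w measure \<Rightarrow> ('b::topological_space \<Rightarrow> 'c::topological_space)
    \<Rightarrow> ('w \<Rightarrow> 'b) set \<Rightarrow> ('w \<Rightarrow> 'c) set" where
  "L0_map M \<phi> X = {h \<in> borel_measurable M. \<exists>f\<in>X. AE w in M. h w = \<phi> (f w)}"

definition L0_map2 :: "'w measure \<Rightarrow> ('b::topological_space \<Rightarrow> 'c::topological_space \<Rightarrow> 'd::topological_space)
    \<Rightarrow> ('w \<Rightarrow> 'b) set \<Rightarrow> ('w \<Rightarrow> 'c) set \<Rightarrow> ('w \<Rightarrow> 'd) set" where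
  "L0_map2 M \<phi> X Y = {h \<in> borel_measurable M. \<exists>f\<in>X. \<exists>g\<in>Y. AE w in M. h w = \<phi> (f w) (g w)}"

definition L0_ring :: "'w measure \<Rightarrow> ('w \<Rightarrow> 'k::{real_normed_field, second_countable_topology}) set ring" where
  "L0_ring M = \<lparr>carrier = L0 M,
     monoid.mult = L0_map2 M (*), one = L0_class M (\<lambda>_. 1),
     zero = L0_class M (\<lambda>_. 0), add = L0_map2 M (+)\<rparr>"

definition L0_le :: "'w measure \<Rightarrow> ('w \<Rightarrow> 'b::{topological_space, order}) set \<Rightarrow> ('w \<Rightarrow> 'b) set \<Rightarrow> bool" where
  "L0_le M X Y \<longleftrightarrow> (\<exists>f\<in>X. \<exists>g\<in>Y. AE w in M. f w \<le> g w)"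

text \<open>\<open>Y > X\<close> means \<open>Y \<ge> X\<close> and \<open>Y \<noteq> X\<close>; it is not almost sure strict inequality.\<close>

definition L0_less :: "'w measure \<Rightarrow> ('w \<Rightarrow> 'b::{topological_space, order}) set \<Rightarrow> ('w \<Rightarrow> 'b) set \<Rightarrow> bool" where
  "L0_less M X Y \<longleftrightarrow> L0_le M X Y \<and> X \<noteq> Y"

definition L0_less_on :: "'w measure \<Rightarrow> 'w set \<Rightarrow> ('w \<Rightarrow> 'b::{topological_space, order}) set \<Rightarrow> ('w \<Rightarrow> 'b) set \<Rightarrow> bool" where
  "L0_less_on M A X Y \<longleftrightarrow> (\<exists>f\<in>X. \<exists>g\<in>Y. AE w in M. w \<in> A \<longrightarrow> f w < g w)"

text \<open>The event \<open>(X < Y)\<close>, for an arbitrary choice of representatives; it is only meaningful up to a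
  null set and is only used in that way below.\<close>

definition L0_less_event :: "'w measure \<Rightarrow> ('w \<Rightarrow> 'b::{topological_space, order}) set \<Rightarrow> ('w \<Rightarrow> 'b) set \<Rightarrow> 'w set" where
  "L0_less_event M X Y = {w \<in> space M. (SOME f. f \<in> X) w < (SOME g. g \<in> Y) w}"

definition L0_plus :: "'w measure \<Rightarrow> ('w \<Rightarrow> real) set set" where
  "L0_plus M = {X \<in> L0 M. L0_le M (L0_class M (\<lambda>_. 0)) X}"

text \<open>The complete lattice of classes of extended real valued random variables.  Suprema and infima
  are those of the order; in particular the supremum of the empty set is the class of \<open>-\<infinity>\<close>.\<close>

definition L0_bar :: "'w measure \<Rightarrow> ('w \<Rightarrow> ereal) set gorder" where
  "L0_bar M = \<lparr>carrier = L0 M, eq = (=), le = L0_le M\<rparr>"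

definition L0_ind :: "'w measure \<Rightarrow> 'w set \<Rightarrow> ('w \<Rightarrow> 'k::{real_normed_field, second_countable_topology}) set" where
  "L0_ind M A = L0_class M (indicator A)"


section \<open>Random normed modules and the \<open>(\<epsilon>, \<lambda>)\<close>-topology\<close>

record ('w, 'k, 'e) rn_module = "(('w \<Rightarrow> 'k) set, 'e) module" +
  rnorm :: "'e \<Rightarrow> ('w \<Rightarrow> real) set"

locale rn_module = prob_space M + Module.module "L0_ring M" E
  for M :: "'w measure"
    and E :: "('w, 'k::{real_normed_field, second_countable_topology}, 'e) rn_module" (structure) +
  assumes rnorm_in_L0_plus: "x \<in> carrier E \<Longrightarrow> rnorm E x \<in> L0_plus M"
    and rnorm_smult: "\<lbrakk>\<xi> \<in> L0 M; x \<in> carrier E\<rbrakk> \<Longrightarrow>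
      rnorm E (\<xi> \<odot> x) = L0_map2 M (*) (L0_map M norm \<xi>) (rnorm E x)"
    and rnorm_triangle: "\<lbrakk>x \<in> carrier E; y \<in> carrier E\<rbrakk> \<Longrightarrow>
      L0_le M (rnorm E (x \<oplus>\<^bsub>E\<^esub> y)) (L0_map2 M (+) (rnorm E x) (rnorm E y))"
    and rnorm_eq_zero: "\<lbrakk>x \<in> carrier E; rnorm E x = L0_class M (\<lambda>_. 0)\<rbrakk> \<Longrightarrow> x = \<zero>\<^bsub>E\<^esub>"

definition eps_lam_nhd :: "'w measure \<Rightarrow> ('w, 'k::{real_normed_field, second_countable_topology}, 'e) rn_module
    \<Rightarrow> real \<Rightarrow> real \<Rightarrow> 'e set" where
  "eps_lam_nhd M E \<epsilon> l =
     {x \<in> carrier E. \<exists>f\<in>rnorm E x. measure M {w \<in> space M. f w < \<epsilon>} > 1 - l}"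

definition eps_lam_open :: "'w measure \<Rightarrow> ('w, 'k::{real_normed_field, second_countable_topology}, 'e) rn_module
    \<Rightarrow> 'e set \<Rightarrow> bool" where
  "eps_lam_open M E U \<longleftrightarrow> U \<subseteq> carrier E \<and>
     (\<forall>x\<in>U. \<exists>\<epsilon>>0. \<exists>l. 0 < l \<and> l < 1 \<and>
        (\<forall>y\<in>carrier E. y \<ominus>\<^bsub>E\<^esub> x \<in> eps_lam_nhd M E \<epsilon> l \<longrightarrow> y \<in> U))"

definition eps_lam_topology :: "'w measure \<Rightarrow> ('w, 'k::{real_normed_field, second_countable_topology}, 'e) rn_module
    \<Rightarrow> 'e topology" where
  "eps_lam_topology M E = topology (eps_lam_open M E)"

text \<open>The topology is metrizable and linear, so completeness may be tested on sequences.\<close>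

definition eps_lam_complete :: "'w measure \<Rightarrow> ('w, 'k::{real_normed_field, second_countable_topology}, 'e) rn_module \<Rightarrow> bool" where
  "eps_lam_complete M E \<longleftrightarrow>
     (\<forall>x :: nat \<Rightarrow> 'e. range x \<subseteq> carrier E \<and>
        (\<forall>\<epsilon>>0. \<forall>l. 0 < l \<and> l < 1 \<longrightarrow> (\<exists>N. \<forall>m\<ge>N. \<forall>n\<ge>N. x m \<ominus>\<^bsub>E\<^esub> x n \<in> eps_lam_nhd M E \<epsilon> l))
        \<longrightarrow> (\<exists>y\<in>carrier E. limitin (eps_lam_topology M E) x y sequentially))"

abbreviation eps_lam_closed :: "'w measure \<Rightarrow> ('w, 'k::{real_normed_field, second_countable_topology}, 'e) rn_module
    \<Rightarrow> 'e set \<Rightarrow> bool" where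
  "eps_lam_closed M E G \<equiv> closedin (eps_lam_topology M E) G"

definition L0_convex :: "'w measure \<Rightarrow> ('w, 'k::{real_normed_field, second_countable_topology}, 'e) rn_module
    \<Rightarrow> 'e set \<Rightarrow> bool" where
  "L0_convex M E G \<longleftrightarrow>
     (\<forall>x\<in>G. \<forall>y\<in>G. \<forall>\<xi>\<in>L0_plus M. L0_le M \<xi> (L0_class M (\<lambda>_. 1)) \<longrightarrow>
        (let \<zeta> = L0_map M of_real \<xi>
         in \<zeta> \<odot>\<^bsub>E\<^esub> x \<oplus>\<^bsub>E\<^esub> (\<one>\<^bsub>L0_ring M\<^esub> \<ominus>\<^bsub>L0_ring M\<^esub> \<zeta>) \<odot>\<^bsub>E\<^esub> y \<in> G))"

text \<open>The empty set is not almost surely bounded, its supremum being \<open>-\<infinity>\<close>.\<close>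

definition as_bounded :: "'w measure \<Rightarrow> ('w, 'k::{real_normed_field, second_countable_topology}, 'e) rn_module
    \<Rightarrow> 'e set \<Rightarrow> bool" where
  "as_bounded M E G \<longleftrightarrow> G \<subseteq> carrier E \<and>
     \<Squnion>\<^bsub>L0_bar M\<^esub>{L0_map M ereal (rnorm E g) | g. g \<in> G} \<in> L0_map M ereal ` L0_plus M"

definition L0_convexly_compact :: "'w measure \<Rightarrow> ('w, 'k::{real_normed_field, second_countable_topology}, 'e) rn_module
    \<Rightarrow> 'e set \<Rightarrow> bool" where
  "L0_convexly_compact M E G \<longleftrightarrow>
     G \<noteq> {} \<and> eps_lam_closed M E G \<and> L0_convex M E G \<and>
     (\<forall>\<H>. \<H> \<noteq> {} \<and> (\<forall>H\<in>\<H>. H \<subseteq> G \<and> eps_lam_closed M E H \<and> L0_convex M E H) \<and>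
          (\<forall>\<F>\<subseteq>\<H>. finite \<F> \<and> \<F> \<noteq> {} \<longrightarrow> \<Inter>\<F> \<noteq> {})
        \<longrightarrow> \<Inter>\<H> \<noteq> {})"


section \<open>Random Chebyshev radii and centres, random normal structure\<close>

definition rdist :: "'w measure \<Rightarrow> ('w, 'k::{real_normed_field, second_countable_topology}, 'e) rn_module
    \<Rightarrow> 'e \<Rightarrow> 'e \<Rightarrow> ('w \<Rightarrow> ereal) set" where
  "rdist M E x y = L0_map M ereal (rnorm E (x \<ominus>\<^bsub>E\<^esub> y))"

definition cheb_rad_at :: "'w measure \<Rightarrow> ('w, 'k::{real_normed_field, second_countable_topology}, 'e) rn_module
    \<Rightarrow> 'e set \<Rightarrow> 'e \<Rightarrow> ('w \<Rightarrow> ereal) set" where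
  "cheb_rad_at M E H x = \<Squnion>\<^bsub>L0_bar M\<^esub>{rdist M E x y | y. y \<in> H}"

definition cheb_rad :: "'w measure \<Rightarrow> ('w, 'k::{real_normed_field, second_countable_topology}, 'e) rn_module
    \<Rightarrow> 'e set \<Rightarrow> 'e set \<Rightarrow> ('w \<Rightarrow> ereal) set" where
  "cheb_rad M E H G = \<Sqinter>\<^bsub>L0_bar M\<^esub>{cheb_rad_at M E H x | x. x \<in> G}"

definition cheb_centre :: "'w measure \<Rightarrow> ('w, 'k::{real_normed_field, second_countable_topology}, 'e) rn_module
    \<Rightarrow> 'e set \<Rightarrow> 'e set \<Rightarrow> 'e set" where
  "cheb_centre M E H G = {x \<in> G. cheb_rad_at M E H x = cheb_rad M E H G}"

definition rdiam :: "'w measure \<Rightarrow> ('w, 'k::{real_normed_field, second_countable_topology}, 'e) rn_module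
    \<Rightarrow> 'e set \<Rightarrow> ('w \<Rightarrow> ereal) set" where
  "rdiam M E H = \<Squnion>\<^bsub>L0_bar M\<^esub>{rdist M E x y | x y. x \<in> H \<and> y \<in> H}"

definition random_normal_structure :: "'w measure \<Rightarrow> ('w, 'k::{real_normed_field, second_countable_topology}, 'e) rn_module
    \<Rightarrow> 'e set \<Rightarrow> bool" where
  "random_normal_structure M E G \<longleftrightarrow>
     G \<noteq> {} \<and> eps_lam_closed M E G \<and> L0_convex M E G \<and>
     (\<forall>H. H \<subseteq> G \<and> as_bounded M E H \<and> eps_lam_closed M E H \<and> L0_convex M E H \<and>
          L0_less M (L0_class M (\<lambda>_. 0)) (rdiam M E H)
        \<longrightarrow> (\<exists>z\<in>H. L0_less_on M (L0_less_event M (L0_class M (\<lambda>_. 0)) (rdiam M E H))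
                      (cheb_rad_at M E H z) (rdiam M E H)))"


section \<open>Stability and consistent nets\<close>

definition meas_partition :: "'w measure \<Rightarrow> (nat \<Rightarrow> 'w set) \<Rightarrow> bool" where
  "meas_partition M A \<longleftrightarrow> range A \<subseteq> sets M \<and> disjoint_family A \<and> (\<Union>n. A n) = space M"

definition sigma_stable :: "'w measure \<Rightarrow> ('w, 'k::{real_normed_field, second_countable_topology}, 'e) rn_module
    \<Rightarrow> 'e set \<Rightarrow> bool" where
  "sigma_stable M E G \<longleftrightarrow> G \<noteq> {} \<and> G \<subseteq> carrier E \<and>
     (\<forall>x A. range x \<subseteq> G \<and> meas_partition M A \<longrightarrow>
        (\<exists>y\<in>G. \<forall>n. L0_ind M (A n) \<odot>\<^bsub>E\<^esub> y = L0_ind M (A n) \<odot>\<^bsub>E\<^esub> x n))"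

text \<open>\<open>\<Sum>n. I\<^bsub>A n\<^esub> x n\<close> and \<open>\<Sum>n. I\<^bsub>A n\<^esub> G n\<close>; an element with the defining property is unique in
  the whole module, so no ambient stable set has to be mentioned.\<close>

definition stable_sum :: "'w measure \<Rightarrow> ('w, 'k::{real_normed_field, second_countable_topology}, 'e) rn_module
    \<Rightarrow> (nat \<Rightarrow> 'w set) \<Rightarrow> (nat \<Rightarrow> 'e) \<Rightarrow> 'e" where
  "stable_sum M E A x =
     (THE y. y \<in> carrier E \<and> (\<forall>n. L0_ind M (A n) \<odot>\<^bsub>E\<^esub> y = L0_ind M (A n) \<odot>\<^bsub>E\<^esub> x n))"

definition stable_sum_sets :: "'w measure \<Rightarrow> ('w, 'k::{real_normed_field, second_countable_topology}, 'e) rn_module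
    \<Rightarrow> (nat \<Rightarrow> 'w set) \<Rightarrow> (nat \<Rightarrow> 'e set) \<Rightarrow> 'e set" where
  "stable_sum_sets M E A G = {stable_sum M E A x | x. \<forall>n. x n \<in> G n}"

definition event_class :: "'w measure \<Rightarrow> 'w set \<Rightarrow> 'w set set" where
  "event_class M A = {B \<in> sets M. AE w in M. w \<in> B \<longleftrightarrow> w \<in> A}"

definition meas_alg :: "'w measure \<Rightarrow> 'w set set gorder" where
  "meas_alg M = \<lparr>carrier = event_class M ` sets M, eq = (=),
     le = (\<lambda>a b. \<exists>A\<in>a. \<exists>B\<in>b. AE w in M. w \<in> A \<longrightarrow> w \<in> B)\<rparr>"

definition partition_of_unity :: "'w measure \<Rightarrow> (nat \<Rightarrow> 'w set set) \<Rightarrow> bool" where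
  "partition_of_unity M a \<longleftrightarrow> range a \<subseteq> carrier (meas_alg M) \<and>
     \<Squnion>\<^bsub>meas_alg M\<^esub>(range a) = event_class M (space M) \<and>
     (\<forall>i j. i \<noteq> j \<longrightarrow> a i \<sqinter>\<^bsub>meas_alg M\<^esub> a j = event_class M {})"

text \<open>\<open>((x, a), (y, b)) \<in> r\<close> renders \<open>x|a = y|b\<close>.\<close>

definition regular_equiv :: "'w measure \<Rightarrow> 'i set \<Rightarrow> ('i \<times> 'w set set) rel \<Rightarrow> bool" where
  "regular_equiv M X r \<longleftrightarrow>
     equiv (X \<times> carrier (meas_alg M)) r \<and>
     (\<forall>x y a b. ((x, a), (y, b)) \<in> r \<longrightarrow> a = b) \<and>
     (\<forall>x y a. ((x, a), (y, a)) \<in> r \<longrightarrow>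
        (\<forall>b\<in>carrier (meas_alg M). b \<sqsubseteq>\<^bsub>meas_alg M\<^esub> a \<longrightarrow> ((x, b), (y, b)) \<in> r)) \<and>
     (\<forall>x\<in>X. \<forall>y\<in>X. \<exists>m. greatest (meas_alg M) m {a \<in> carrier (meas_alg M). ((x, a), (y, a)) \<in> r}) \<and>
     (\<forall>x y. ((x, event_class M (space M)), (y, event_class M (space M))) \<in> r \<longrightarrow> x = y)"

definition B_stable :: "'w measure \<Rightarrow> 'i set \<Rightarrow> ('i \<times> 'w set set) rel \<Rightarrow> bool" where
  "B_stable M X r \<longleftrightarrow> X \<noteq> {} \<and> regular_equiv M X r \<and>
     (\<forall>x a. range x \<subseteq> X \<and> partition_of_unity M a \<longrightarrow>
        (\<exists>y\<in>X. \<forall>n. ((y, a n), (x n, a n)) \<in> r))"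

definition B_sum :: "'i set \<Rightarrow> ('i \<times> 'w set set) rel \<Rightarrow> (nat \<Rightarrow> 'i) \<Rightarrow> (nat \<Rightarrow> 'w set set) \<Rightarrow> 'i" where
  "B_sum X r x a = (THE y. y \<in> X \<and> (\<forall>n. ((y, a n), (x n, a n)) \<in> r))"

text \<open>\<open>(\<alpha>, \<beta>) \<in> leq\<close> renders \<open>\<alpha> \<le> \<beta>\<close>.\<close>

definition directed_set :: "'i set \<Rightarrow> 'i rel \<Rightarrow> bool" where
  "directed_set \<Lambda> leq \<longleftrightarrow> \<Lambda> \<noteq> {} \<and> preorder_on \<Lambda> leq \<and>
     (\<forall>\<alpha>\<in>\<Lambda>. \<forall>\<beta>\<in>\<Lambda>. \<exists>\<gamma>\<in>\<Lambda>. (\<alpha>, \<gamma>) \<in> leq \<and> (\<beta>, \<gamma>) \<in> leq)"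

definition consistent_net :: "'w measure \<Rightarrow> ('w, 'k::{real_normed_field, second_countable_topology}, 'e) rn_module
    \<Rightarrow> 'e set \<Rightarrow> 'i set \<Rightarrow> 'i rel \<Rightarrow> ('i \<times> 'w set set) rel \<Rightarrow> ('i \<Rightarrow> 'e set) \<Rightarrow> bool" where
  "consistent_net M E S \<Lambda> leq r G \<longleftrightarrow>
     sigma_stable M E S \<and> directed_set \<Lambda> leq \<and> B_stable M \<Lambda> r \<and>
     (\<forall>\<alpha>\<in>\<Lambda>. G \<alpha> \<subseteq> S \<and> sigma_stable M E (G \<alpha>)) \<and>
     (\<forall>\<alpha> a A. range \<alpha> \<subseteq> \<Lambda> \<and> partition_of_unity M a \<and>
          (\<forall>n. A n \<in> sets M \<and> a n = event_class M (A n))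
        \<longrightarrow> G (B_sum \<Lambda> r \<alpha> a) = stable_sum_sets M E A (\<lambda>n. G (\<alpha> n)))"

definition decreasing_net :: "'i set \<Rightarrow> 'i rel \<Rightarrow> ('i \<Rightarrow> 'e set) \<Rightarrow> bool" where
  "decreasing_net \<Lambda> leq G \<longleftrightarrow> (\<forall>\<alpha>\<in>\<Lambda>. \<forall>\<beta>\<in>\<Lambda>. (\<beta>, \<alpha>) \<in> leq \<longrightarrow> G \<alpha> \<subseteq> G \<beta>)"

text \<open>
  HOL cannot quantify over all index types inside a definition, so the type of the indices is a
  parameter; \<open>\<Lambda>\<close> ranges over all subsets of it.  A decreasing consistent net can always be
  reindexed by the sets \<open>W \<alpha>\<close> themselves, ordered by reverse inclusion, with \<open>V|a = V'|a\<close> iff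
  \<open>I\<^bsub>A\<^esub> V = I\<^bsub>A\<^esub> V'\<close>; hence index types at least as large as \<^typ>\<open>'e set\<close> all give the same notion.
\<close>

definition random_complete_normal_structure :: "'i itself \<Rightarrow> 'w measure
    \<Rightarrow> ('w, 'k::{real_normed_field, second_countable_topology}, 'e) rn_module \<Rightarrow> 'e set \<Rightarrow> bool" where
  "random_complete_normal_structure (_ :: 'i itself) M E G \<longleftrightarrow>
     as_bounded M E G \<and> eps_lam_closed M E G \<and> L0_convex M E G \<and>
     (\<forall>W. W \<subseteq> G \<and> eps_lam_closed M E W \<and> L0_convex M E W \<and> (\<exists>x\<in>W. \<exists>y\<in>W. x \<noteq> y) \<longrightarrow>
        (\<forall>(\<Lambda> :: 'i set) leq r V.
           consistent_net M E W \<Lambda> leq r V \<and> decreasing_net \<Lambda> leq V \<and>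
           (\<forall>\<alpha>\<in>\<Lambda>. cheb_rad M E (V \<alpha>) W = cheb_rad M E W W) \<longrightarrow>
           (let C = eps_lam_topology M E closure_of (\<Union>\<alpha>\<in>\<Lambda>. cheb_centre M E (V \<alpha>) W)
            in C \<noteq> {} \<and>
               (\<forall>B\<in>sets M.
                  (AE w in M. w \<in> B \<longrightarrow> w \<in> L0_less_event M (L0_class M (\<lambda>_. 0)) (rdiam M E W)) \<and>
                  measure M B > 0 \<longrightarrow>
                  (\<exists>y\<in>W. L0_ind M B \<odot>\<^bsub>E\<^esub> y \<notin> (\<lambda>z. L0_ind M B \<odot>\<^bsub>E\<^esub> z) ` C)))))"

end

theory Submission
  imports Defs
begin

text \<open>
  \<^emph>\<open>Complete normal structure implies normal structure.\<close>  Apply the hypothesis on nets to the constant net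
  \<open>H\<close>.  It yields a Chebyshev centre \<open>z\<close> of \<open>H\<close> in itself.  If \<open>R(H, z) < D(H)\<close> failed on a non-null part \<open>B\<close>
  of \<open>(D(H) > 0)\<close>, then every \<open>y \<in> H\<close> could be glued on \<open>B\<close> with \<open>z\<close> off \<open>B\<close>, giving again a centre; so on \<open>B\<close>
  the centres would fill \<open>H\<close>, which the hypothesis excludes (\<open>complete_imp_normal\<close>).

  \<^emph>\<open>Normal structure implies complete normal structure.\<close>  This is a random form of an argument of Lim.  Let
  \<open>r = R(W, W)\<close>.  Compactness provides \<open>p \<in> C(W, W)\<close> (\<open>cheb_centre_nonempty\<close>), and \<open>p\<close> lies in every
  \<open>C(W\<^sub>\<alpha>, W)\<close>.  Suppose that on some \<open>B\<close> the closure of the union of the centres is all of \<open>W\<close>.  Then for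
  every \<open>y \<in> W\<close> and \<open>\<epsilon> > 0\<close> some \<open>W\<^sub>\<alpha>\<close> lies within \<open>r + \<epsilon>\<close> of \<open>y\<close>, off a small event, while the distances from \<open>y\<close>
  to \<open>W\<^sub>\<alpha>\<close> still have supremum at least \<open>r\<close>.  Given \<open>y\<^sub>0, \<dots>, y\<^sub>n\<close> with weighted mean \<open>c\<^sub>n\<close>, choose such a \<open>W\<^sub>\<alpha>\<close> for
  \<open>y\<^sub>0, \<dots>, y\<^sub>n\<close> together and \<open>x \<in> W\<^sub>\<alpha>\<close> at distance almost \<open>r\<close> from \<open>c\<^sub>n\<close>.  Pulling \<open>x\<close> slightly towards \<open>p\<close> gives
  \<open>y\<^sub>n\<^sub>+\<^sub>1\<close> at distance at most \<open>r\<close>, exactly, from all earlier points and still almost \<open>r\<close> from \<open>c\<^sub>n\<close>.  A point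
  within \<open>r\<close> of every \<open>y\<^sub>i\<close> and almost \<open>r\<close> away from their mean is almost \<open>r\<close> away from each of their convex
  combinations.  So on an event of positive probability the closed convex hull of the \<open>y\<^sub>n\<close> has diameter \<open>r\<close>
  and every one of its points is diametral (\<open>diametral\<close>), which normal structure forbids
  (\<open>no_diametral_subset\<close>, \<open>net_not_dense\<close>).

  \<^emph>\<open>Boundedness\<close> of \<open>G\<close> is part of complete normal structure (\<open>nested_compact_bounded\<close>).  Let \<open>\<theta> \<in> G\<close> and suppose
  that \<open>G\<close> is unbounded on an event.  Nested sets \<open>y\<^sub>n + L\<^sub>n G\<close> are chosen that leave every ball: move \<open>y\<close> to
  \<open>y + (L/2) x\<close> with \<open>x \<in> G\<close> huge, then shrink \<open>L\<close> until \<open>y + L G\<close> essentially avoids the ball of radius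
  \<open>\<parallel>y\<parallel>/2\<close> about \<open>\<theta>\<close>.  The shrinking succeeds (\<open>escape\<close>) because otherwise compactness would put a whole ray into \<open>G\<close>,
  and nested pieces of that ray have no common point (\<open>no_ray\<close>).

  Compactness is used only through decreasing sequences of closed convex sets.  It makes every closed convex
  subset \<open>\<sigma>\<close>-stable (\<open>nested_compact_sigma_stable\<close>), and in a \<open>\<sigma>\<close>-stable set countably many points can be glued into one
  that realises a given local property on the largest possible event (\<open>maximal_event\<close>); this replaces the choice
  of a point that nearly attains a supremum.  Throughout, norms and distances are represented by honest
  functions \<open>nrm x\<close> and \<open>dst x y\<close>, so that statements in \<open>L\<^sup>0\<close> become almost sure statements.
\<close>

section \<open>Classes of random variables\<close>

lemma as_eq_rel_equiv: "equiv (borel_measurable M) (as_eq_rel M)"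
proof (rule equivI)
  show "as_eq_rel M \<subseteq> borel_measurable M \<times> borel_measurable M"
    by (auto simp: as_eq_rel_def)
  show "refl_on (borel_measurable M) (as_eq_rel M)"
    by (auto simp: refl_on_def as_eq_rel_def)
  show "sym (as_eq_rel M)"
    by (auto simp: sym_def as_eq_rel_def elim: AE_mp)
  show "trans (as_eq_rel M)"
    unfolding trans_def as_eq_rel_def
    by (auto elim: AE_mp)
qed

text \<open>
  Every operation on classes is reduced below to the pointwise operation on representatives; this description
  of membership is what makes the result independent of the representative.
\<close>

lemma L0_class_mem:
  assumes "f \<in> borel_measurable M"
  shows "h \<in> L0_class M f \<longleftrightarrow> h \<in> borel_measurable M \<and> (AE w in M. h w = f w)"
  using assms by (auto simp: L0_class_def as_eq_rel_def elim: AE_mp)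

lemma L0_class_self: "f \<in> borel_measurable M \<Longrightarrow> f \<in> L0_class M f"
  by (simp add: L0_class_mem)

lemma L0_class_eq_iff:
  assumes "f \<in> borel_measurable M" "g \<in> borel_measurable M"
  shows "L0_class M f = L0_class M g \<longleftrightarrow> (AE w in M. f w = g w)"
  using eq_equiv_class_iff[OF as_eq_rel_equiv, of f M g] assms
  unfolding L0_class_def by (simp add: as_eq_rel_def)

lemma L0_class_in_L0: "f \<in> borel_measurable M \<Longrightarrow> L0_class M f \<in> L0 M"
  unfolding L0_def L0_class_def by (rule quotientI)

lemma L0_E:
  assumes "X \<in> L0 M"
  obtains f where "f \<in> borel_measurable M" "X = L0_class M f"
  using assms unfolding L0_def L0_class_def by (auto elim!: quotientE)

lemma L0_map_class:
  assumes "f \<in> borel_measurable M" "(\<lambda>w. \<phi> (f w)) \<in> borel_measurable M"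
  shows "L0_map M \<phi> (L0_class M f) = L0_class M (\<lambda>w. \<phi> (f w))"
proof (intro Set.set_eqI iffI)
  fix h assume "h \<in> L0_map M \<phi> (L0_class M f)"
  then obtain f' where h: "h \<in> borel_measurable M" "AE w in M. h w = \<phi> (f' w)" "AE w in M. f' w = f w"
    using assms by (auto simp: L0_map_def L0_class_mem)
  from h(2,3) have "AE w in M. h w = \<phi> (f w)" by eventually_elim simp
  with h(1) show "h \<in> L0_class M (\<lambda>w. \<phi> (f w))" using assms by (simp add: L0_class_mem)
next
  fix h assume "h \<in> L0_class M (\<lambda>w. \<phi> (f w))"
  then show "h \<in> L0_map M \<phi> (L0_class M f)"
    using assms L0_class_self[OF assms(1)] by (auto simp: L0_map_def L0_class_mem)
qed

lemma L0_map2_class: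
  assumes "f \<in> borel_measurable M" "g \<in> borel_measurable M" "(\<lambda>w. \<phi> (f w) (g w)) \<in> borel_measurable M"
  shows "L0_map2 M \<phi> (L0_class M f) (L0_class M g) = L0_class M (\<lambda>w. \<phi> (f w) (g w))"
proof (intro Set.set_eqI iffI)
  fix h assume "h \<in> L0_map2 M \<phi> (L0_class M f) (L0_class M g)"
  then obtain f' g' where h: "h \<in> borel_measurable M" "AE w in M. h w = \<phi> (f' w) (g' w)"
    "AE w in M. f' w = f w" "AE w in M. g' w = g w"
    using assms by (auto simp: L0_map2_def L0_class_mem)
  from h(2-4) have "AE w in M. h w = \<phi> (f w) (g w)" by eventually_elim simp
  with h(1) show "h \<in> L0_class M (\<lambda>w. \<phi> (f w) (g w))" using assms by (simp add: L0_class_mem)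
next
  fix h assume "h \<in> L0_class M (\<lambda>w. \<phi> (f w) (g w))"
  then show "h \<in> L0_map2 M \<phi> (L0_class M f) (L0_class M g)"
    using assms L0_class_self[OF assms(1)] L0_class_self[OF assms(2)]
    by (auto simp: L0_map2_def L0_class_mem intro!: bexI[of _ f] bexI[of _ g])
qed

lemma L0_le_class:
  assumes "f \<in> borel_measurable M" "g \<in> borel_measurable M"
  shows "L0_le M (L0_class M f) (L0_class M g) \<longleftrightarrow> (AE w in M. f w \<le> g w)"
proof
  assume "L0_le M (L0_class M f) (L0_class M g)"
  then obtain f' g' where h: "AE w in M. f' w \<le> g' w" "AE w in M. f' w = f w" "AE w in M. g' w = g w"
    using assms by (auto simp: L0_le_def L0_class_mem)
  from h show "AE w in M. f w \<le> g w" by eventually_elim simp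
next
  assume "AE w in M. f w \<le> g w"
  then show "L0_le M (L0_class M f) (L0_class M g)"
    using L0_class_self[OF assms(1)] L0_class_self[OF assms(2)] by (auto simp: L0_le_def)
qed

lemma L0_less_on_class:
  assumes "f \<in> borel_measurable M" "g \<in> borel_measurable M"
  shows "L0_less_on M A (L0_class M f) (L0_class M g) \<longleftrightarrow> (AE w\<in>A in M. f w < g w)"
proof
  assume "L0_less_on M A (L0_class M f) (L0_class M g)"
  then obtain f' g' where h: "AE w\<in>A in M. f' w < g' w" "AE w in M. f' w = f w" "AE w in M. g' w = g w"
    using assms by (auto simp: L0_less_on_def L0_class_mem)
  from h show "AE w\<in>A in M. f w < g w" by eventually_elim simp
next
  assume "AE w\<in>A in M. f w < g w"
  then show "L0_less_on M A (L0_class M f) (L0_class M g)"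
    using L0_class_self[OF assms(1)] L0_class_self[OF assms(2)] by (auto simp: L0_less_on_def)
qed

lemma L0_less_event_class:
  assumes "f \<in> borel_measurable M" "g \<in> borel_measurable M"
  shows "AE w in M. w \<in> L0_less_event M (L0_class M f) (L0_class M g) \<longleftrightarrow> f w < g w"
proof -
  have 1: "(SOME f'. f' \<in> L0_class M f) \<in> L0_class M f" by (rule someI[of "\<lambda>h. h \<in> L0_class M f"]) (rule L0_class_self[OF assms(1)])
  have 2: "(SOME f'. f' \<in> L0_class M g) \<in> L0_class M g" by (rule someI[of "\<lambda>h. h \<in> L0_class M g"]) (rule L0_class_self[OF assms(2)])
  from 1 have 3: "AE w in M. (SOME f'. f' \<in> L0_class M f) w = f w" using assms by (simp add: L0_class_mem)
  from 2 have 4: "AE w in M. (SOME f'. f' \<in> L0_class M g) w = g w" using assms by (simp add: L0_class_mem)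
  show ?thesis
    using 3 4 AE_space by eventually_elim (simp add: L0_less_event_def)
qed

lemma L0_plus_class:
  assumes "f \<in> borel_measurable M"
  shows "L0_class M f \<in> L0_plus M \<longleftrightarrow> (AE w in M. 0 \<le> f w)"
  using assms by (simp add: L0_plus_def L0_class_in_L0 L0_le_class)

section \<open>Essential unions, suprema and infima\<close>

text \<open>
  Choose countable subfamilies whose unions have probabilities tending to the supremum and merge them.  A member
  of the family that exceeded the merged union by a non-null event could be added, exceeding the supremum.
\<close>

lemma (in prob_space) ess_union:
  assumes "\<A> \<subseteq> events" "\<A> \<noteq> {}"
  obtains A :: "nat \<Rightarrow> 'a set" where "range A \<subseteq> \<A>" "\<And>B. B \<in> \<A> \<Longrightarrow> AE w\<in>B in M. w \<in> (\<Union>n. A n)"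
proof -
  define P where "P = {prob (\<Union>(range A)) | A :: nat \<Rightarrow> 'a set. range A \<subseteq> \<A>}"
  have ne: "P \<noteq> {}" using assms(2) unfolding P_def by (auto intro!: exI[of _ "\<lambda>_. SOME x. x \<in> \<A>"] some_in_eq[THEN iffD2])
  have bd: "bdd_above P" unfolding P_def by (intro bdd_aboveI[of _ 1]) auto
  have "\<exists>A::nat \<Rightarrow> 'a set. range A \<subseteq> \<A> \<and> Sup P - 1 / (k + 1) < prob (\<Union>(range A))" for k :: nat
  proof -
    have "Sup P - 1 / (k + 1) < Sup P" by simp
    then obtain q where "q \<in> P" "Sup P - 1 / (k+1) < q" using less_cSup_iff[OF ne bd] by blast
    then show ?thesis unfolding P_def by blast
  qed
  then have "\<forall>k. \<exists>A::nat \<Rightarrow> 'a set. range A \<subseteq> \<A> \<and> Sup P - 1 / (real k + 1) < prob (\<Union>(range A))" by (simp add: add.commute)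
  from choice[OF this] obtain A :: "nat \<Rightarrow> nat \<Rightarrow> 'a set" where
    A0: "\<forall>k. range (A k) \<subseteq> \<A> \<and> Sup P - 1 / (real k + 1) < prob (\<Union>(range (A k)))"
    by (elim exE)
  have A: "range (A k) \<subseteq> \<A>" "Sup P - 1 / (real k + 1) < prob (\<Union>(range (A k)))" for k
    using spec[OF A0, of k] by simp_all
  define A' where "A' n = (case prod_decode n of (k, j) \<Rightarrow> A k j)" for n
  have rA': "range A' \<subseteq> \<A>" using A(1) by (force simp: A'_def split: prod.splits)
  have eA': "A' n \<in> events" for n using rA' assms(1) by auto
  have eU: "\<Union>(range A') \<in> events" using eA' by auto
  have sub: "\<Union>(range (A k)) \<subseteq> \<Union>(range A')" for k
  proof
    fix x assume "x \<in> \<Union>(range (A k))"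
    then obtain j where "x \<in> A k j" by auto
    then have "x \<in> A' (prod_encode (k, j))" by (simp add: A'_def)
    then show "x \<in> \<Union>(range A')" by blast
  qed
  have "Sup P \<le> prob (\<Union>(range A'))"
  proof (rule field_le_epsilon)
    fix e :: real assume "e > 0"
    then obtain k :: nat where k: "1 / (real k + 1) < e" using nat_approx_posE[of e] by (auto simp: add.commute)
    have "Sup P < prob (\<Union>(range (A k))) + 1 / (real k + 1)" using A(2)[of k] by linarith
    also have "\<dots> \<le> prob (\<Union>(range A')) + e" using finite_measure_mono[OF sub eU] k by (intro add_mono) auto
    finally show "Sup P \<le> prob (\<Union>(range A')) + e" by simp
  qed
  moreover have "AE w\<in>B in M. w \<in> (\<Union>n. A' n)" if B: "B \<in> \<A>" and le: "Sup P \<le> prob (\<Union>(range A'))" for B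
  proof -
    define A'' where "A'' n = (case n of 0 \<Rightarrow> B | Suc m \<Rightarrow> A' m)" for n
    have "range A'' \<subseteq> \<A>" using B rA' by (auto simp: A''_def image_subset_iff split: nat.splits)
    then have "prob (\<Union>(range A'')) \<le> Sup P" by (intro cSup_upper bd) (auto simp: P_def)
    moreover have U: "\<Union>(range A'') = \<Union>(range A') \<union> (B - \<Union>(range A'))"
    proof (intro Set.set_eqI iffI)
      fix x assume "x \<in> \<Union>(range A'')"
      then obtain n where "x \<in> A'' n" by blast
      then show "x \<in> \<Union>(range A') \<union> (B - \<Union>(range A'))" by (cases n) (auto simp: A''_def)
    next
      fix x assume x: "x \<in> \<Union>(range A') \<union> (B - \<Union>(range A'))"
      show "x \<in> \<Union>(range A'')"
      proof (cases "x \<in> B")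
        case True then have "x \<in> A'' 0" by (simp add: A''_def) then show ?thesis by blast
      next
        case False then obtain n where "x \<in> A' n" using x by auto
        then have "x \<in> A'' (Suc n)" by (simp add: A''_def) then show ?thesis by blast
      qed
    qed
    have eB: "B \<in> events" using B assms(1) by auto
    have "prob (\<Union>(range A'')) = prob (\<Union>(range A')) + prob (B - \<Union>(range A'))"
      unfolding U by (rule finite_measure_Union) (use eU eB in auto)
    ultimately have "prob (B - \<Union>(range A')) = 0" using le measure_nonneg[of M "B - \<Union>(range A')"] by linarith
    then have "AE w in M. w \<notin> B - \<Union>(range A')" using eU eB prob_eq_0[of "B - \<Union>(range A')"] by auto
    then show ?thesis by eventually_elim auto
  qed
  ultimately show thesis using rA' that[of A'] by blast
qed

definition is_ess_sup :: "'w measure \<Rightarrow> ('w \<Rightarrow> ereal) set \<Rightarrow> ('w \<Rightarrow> ereal) \<Rightarrow> bool" where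
  "is_ess_sup M F s \<longleftrightarrow> s \<in> borel_measurable M \<and> (\<forall>f\<in>F. AE w in M. f w \<le> s w) \<and>
     (\<forall>h\<in>borel_measurable M. (\<forall>f\<in>F. AE w in M. f w \<le> h w) \<longrightarrow> (AE w in M. s w \<le> h w))"

definition is_ess_inf :: "'w measure \<Rightarrow> ('w \<Rightarrow> ereal) set \<Rightarrow> ('w \<Rightarrow> ereal) \<Rightarrow> bool" where
  "is_ess_inf M F s \<longleftrightarrow> s \<in> borel_measurable M \<and> (\<forall>f\<in>F. AE w in M. s w \<le> f w) \<and>
     (\<forall>h\<in>borel_measurable M. (\<forall>f\<in>F. AE w in M. h w \<le> f w) \<longrightarrow> (AE w in M. h w \<le> s w))"

text \<open>
  For each rational \<open>q\<close> an essential union of the events \<open>(f > q)\<close> selects countably many members; the pointwise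
  supremum of everything selected dominates each \<open>f\<close> almost surely, since \<open>f > s\<close> would be witnessed by a rational.
\<close>

lemma (in prob_space) ex_ess_sup:
  assumes F: "F \<subseteq> borel_measurable M" "F \<noteq> {}"
  shows "\<exists>s. is_ess_sup M F s"
proof -
  define \<A> where "\<A> q = (\<lambda>f. {w \<in> space M. ereal (real_of_rat q) < f w}) ` F" for q
  have "\<exists>g. range g \<subseteq> F \<and> (\<forall>f\<in>F. AE w in M. ereal (real_of_rat q) < f w \<longrightarrow> (\<exists>n::nat. ereal (real_of_rat q) < g n w))" for q
  proof -
    have sub: "\<A> q \<subseteq> events" using F unfolding \<A>_def by auto
    obtain A :: "nat \<Rightarrow> 'a set" where A: "range A \<subseteq> \<A> q" "\<And>B. B \<in> \<A> q \<Longrightarrow> AE w\<in>B in M. w \<in> (\<Union>n. A n)"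
      using ess_union[OF sub] F(2) unfolding \<A>_def by blast
    have "\<forall>n. \<exists>f\<in>F. A n = {w \<in> space M. ereal (real_of_rat q) < f w}" using A(1) unfolding \<A>_def by blast
    then obtain g where g: "\<And>n. g n \<in> F" "\<And>n. A n = {w \<in> space M. ereal (real_of_rat q) < g n w}" by metis
    have "AE w in M. ereal (real_of_rat q) < f w \<longrightarrow> (\<exists>n::nat. ereal (real_of_rat q) < g n w)" if "f \<in> F" for f
    proof -
      have "AE w in M. w \<in> {w \<in> space M. ereal (real_of_rat q) < f w} \<longrightarrow> w \<in> (\<Union>n. A n)"
        using that by (intro A(2)) (auto simp: \<A>_def)
      then show ?thesis using AE_space by eventually_elim (auto simp: g(2))
    qed
    then show ?thesis using g(1) by blast
  qed
  then obtain g where g: "\<And>q. range (g q) \<subseteq> F"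
    "\<And>q f. f \<in> F \<Longrightarrow> AE w in M. ereal (real_of_rat q) < f w \<longrightarrow> (\<exists>n::nat. ereal (real_of_rat q) < g q n w)"
    by metis
  define s where "s w = (SUP q. SUP n. g q n w)" for w
  have gm: "g q n \<in> borel_measurable M" for q n using g(1)[of q] F(1) by auto
  have "s \<in> borel_measurable M" unfolding s_def using gm by (intro borel_measurable_SUP) auto
  moreover have "AE w in M. f w \<le> s w" if f: "f \<in> F" for f
  proof -
    have "AE w in M. \<forall>q. ereal (real_of_rat q) < f w \<longrightarrow> (\<exists>n::nat. ereal (real_of_rat q) < g q n w)"
      using g(2)[OF f] by (simp add: AE_all_countable)
    then show ?thesis
    proof eventually_elim
      case (elim w)
      show ?case
      proof (rule ccontr)
        assume "\<not> f w \<le> s w"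
        then have "s w < f w" by simp
        then obtain q where q: "s w < ereal (real_of_rat q)" "ereal (real_of_rat q) < f w"
          using ereal_dense3 by blast
        then obtain n where n: "ereal (real_of_rat q) < g q n w" using elim by blast
        have "g q n w \<le> s w" unfolding s_def by (intro SUP_upper2[of q] SUP_upper) auto
        with n q show False by simp
      qed
    qed
  qed
  moreover have "AE w in M. s w \<le> h w" if h: "\<forall>f\<in>F. AE w in M. f w \<le> h w" for h
  proof -
    have "AE w in M. g q n w \<le> h w" for q n using h g(1)[of q] by auto
    then have "AE w in M. \<forall>q. \<forall>n. g q n w \<le> h w" by (simp add: AE_all_countable)
    then show ?thesis by eventually_elim (auto simp: s_def intro!: SUP_least)
  qed
  ultimately show ?thesis unfolding is_ess_sup_def by blast
qed

lemma (in prob_space) ex_ess_inf: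
  assumes F: "F \<subseteq> borel_measurable M" "F \<noteq> {}"
  shows "\<exists>s. is_ess_inf M F s"
proof -
  have m: "(\<lambda>f w. - f w) ` F \<subseteq> borel_measurable M" using F(1) by auto
  obtain s where s0: "is_ess_sup M ((\<lambda>f w. - f w) ` F) s" using ex_ess_sup[OF m] F(2) by blast
  note s = s0[unfolded is_ess_sup_def, THEN conjunct1]
    s0[unfolded is_ess_sup_def, THEN conjunct2, THEN conjunct1]
    s0[unfolded is_ess_sup_def, THEN conjunct2, THEN conjunct2]
  have "is_ess_inf M F (\<lambda>w. - s w)"
    unfolding is_ess_inf_def
  proof (intro conjI ballI impI)
    show "(\<lambda>w. - s w) \<in> borel_measurable M" using s(1) by simp
    fix f assume f: "f \<in> F"
    have "AE w in M. - f w \<le> s w" using bspec[OF s(2) imageI[OF f]] .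
    then show "AE w in M. - s w \<le> f w" by eventually_elim (metis ereal_minus_le_minus ereal_uminus_uminus)
  next
    fix h assume h: "h \<in> borel_measurable M" "\<forall>f\<in>F. AE w in M. h w \<le> f w"
    have "\<forall>g\<in>(\<lambda>f w. - f w) ` F. AE w in M. g w \<le> - h w"
    proof
      fix g assume "g \<in> (\<lambda>f w. - f w) ` F"
      then obtain f where f: "f \<in> F" and g: "g = (\<lambda>w. - f w)" by (rule imageE)
      from bspec[OF h(2) f] show "AE w in M. g w \<le> - h w"
        unfolding g by eventually_elim (simp only: ereal_minus_le_minus)
    qed
    moreover have "(\<lambda>w. - h w) \<in> borel_measurable M" using h(1) by simp
    ultimately have "AE w in M. s w \<le> - h w" by (rule s(3)[THEN bspec, THEN mp, rotated])
    then show "AE w in M. h w \<le> - s w" by eventually_elim (metis ereal_minus_le_minus ereal_uminus_uminus)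
  qed
  then show ?thesis by blast
qed

text \<open>
  Suprema in the order library are chosen by description; antisymmetry alone makes the choice unambiguous.
\<close>

lemma lub_eqI:
  assumes "\<And>x y. x \<in> carrier L \<Longrightarrow> y \<in> carrier L \<Longrightarrow> x \<sqsubseteq>\<^bsub>L\<^esub> y \<Longrightarrow> y \<sqsubseteq>\<^bsub>L\<^esub> x \<Longrightarrow> x = y"
    and s: "least L s (Upper L A)"
  shows "\<Squnion>\<^bsub>L\<^esub>A = s"
  unfolding sup_def
proof (rule some_equality[of "\<lambda>x. least L x (Upper L A)", OF s])
  fix t assume t: "least L t (Upper L A)"
  show "t = s"
    by (rule assms(1)[OF least_closed[OF t] least_closed[OF s] least_le[OF t least_mem[OF s]] least_le[OF s least_mem[OF t]]])
qed

lemma glb_eqI: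
  assumes "\<And>x y. x \<in> carrier L \<Longrightarrow> y \<in> carrier L \<Longrightarrow> x \<sqsubseteq>\<^bsub>L\<^esub> y \<Longrightarrow> y \<sqsubseteq>\<^bsub>L\<^esub> x \<Longrightarrow> x = y"
    and s: "greatest L s (Lower L A)"
  shows "\<Sqinter>\<^bsub>L\<^esub>A = s"
  unfolding inf_def
proof (rule some_equality[of "\<lambda>x. greatest L x (Lower L A)", OF s])
  fix t assume t: "greatest L t (Lower L A)"
  show "t = s"
    by (rule assms(1)[OF greatest_closed[OF t] greatest_closed[OF s] greatest_le[OF s greatest_mem[OF t]] greatest_le[OF t greatest_mem[OF s]]])
qed

lemma L0_le_antisym:
  fixes X Y :: "('w \<Rightarrow> 'b::{topological_space, order}) set"
  assumes "X \<in> L0 M" "Y \<in> L0 M" "L0_le M X Y" "L0_le M Y X"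
  shows "X = Y"
proof -
  obtain f where f: "f \<in> borel_measurable M" "X = L0_class M f" using assms(1) by (rule L0_E)
  obtain g where g: "g \<in> borel_measurable M" "Y = L0_class M g" using assms(2) by (rule L0_E)
  have "AE w in M. f w \<le> g w" "AE w in M. g w \<le> f w" using assms(3,4) f g by (simp_all add: L0_le_class)
  then have "AE w in M. f w = g w" by eventually_elim simp
  then show ?thesis using f g by (simp add: L0_class_eq_iff)
qed

lemma L0_bar_sup:
  assumes F: "F \<subseteq> borel_measurable M" and s: "is_ess_sup M F s"
  shows "\<Squnion>\<^bsub>L0_bar M\<^esub>(L0_class M ` F) = L0_class M s"
proof -
  have sm: "s \<in> borel_measurable M" using s by (simp add: is_ess_sup_def)
  have Up: "Upper (L0_bar M) (L0_class M ` F) = {L0_class M h | h. h \<in> borel_measurable M \<and> (\<forall>f\<in>F. AE w in M. f w \<le> h w)}"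
    (is "_ = ?U")
  proof (intro Set.set_eqI iffI)
    fix X assume "X \<in> Upper (L0_bar M) (L0_class M ` F)"
    then have X: "X \<in> L0 M" "\<And>f. f \<in> F \<Longrightarrow> L0_le M (L0_class M f) X"
      using F by (auto simp: Upper_def L0_bar_def L0_class_in_L0 subset_iff)
    obtain h where h: "h \<in> borel_measurable M" "X = L0_class M h" using X(1) by (rule L0_E)
    have "\<forall>f\<in>F. AE w in M. f w \<le> h w"
    proof
      fix f assume "f \<in> F"
      then show "AE w in M. f w \<le> h w" using X(2)[of f] h F L0_le_class[of f M h] by auto
    qed
    then show "X \<in> ?U" using h by blast
  next
    fix X assume "X \<in> ?U"
    then show "X \<in> Upper (L0_bar M) (L0_class M ` F)"
      using F by (auto simp: Upper_def L0_bar_def L0_class_in_L0 L0_le_class subset_iff)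
  qed
  have least: "least (L0_bar M) (L0_class M s) ?U"
    using s by (auto simp: least_def L0_bar_def L0_class_in_L0 is_ess_sup_def L0_le_class)
  show ?thesis
    by (rule lub_eqI[OF _ least[folded Up]]) (simp add: L0_bar_def, erule (3) L0_le_antisym)
qed

lemma L0_bar_inf:
  assumes F: "F \<subseteq> borel_measurable M" and s: "is_ess_inf M F s"
  shows "\<Sqinter>\<^bsub>L0_bar M\<^esub>(L0_class M ` F) = L0_class M s"
proof -
  have sm: "s \<in> borel_measurable M" using s by (simp add: is_ess_inf_def)
  have Up: "Lower (L0_bar M) (L0_class M ` F) = {L0_class M h | h. h \<in> borel_measurable M \<and> (\<forall>f\<in>F. AE w in M. h w \<le> f w)}"
    (is "_ = ?U")
  proof (intro Set.set_eqI iffI)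
    fix X assume "X \<in> Lower (L0_bar M) (L0_class M ` F)"
    then have X: "X \<in> L0 M" "\<And>f. f \<in> F \<Longrightarrow> L0_le M X (L0_class M f)"
      using F by (auto simp: Lower_def L0_bar_def L0_class_in_L0 subset_iff)
    obtain h where h: "h \<in> borel_measurable M" "X = L0_class M h" using X(1) by (rule L0_E)
    have "\<forall>f\<in>F. AE w in M. h w \<le> f w"
    proof
      fix f assume "f \<in> F"
      then show "AE w in M. h w \<le> f w" using X(2)[of f] h F L0_le_class[of h M f] by auto
    qed
    then show "X \<in> ?U" using h by blast
  next
    fix X assume "X \<in> ?U"
    then show "X \<in> Lower (L0_bar M) (L0_class M ` F)"
      using F by (auto simp: Lower_def L0_bar_def L0_class_in_L0 L0_le_class subset_iff)
  qed
  have greatest: "greatest (L0_bar M) (L0_class M s) ?U"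
    using s by (auto simp: greatest_def L0_bar_def L0_class_in_L0 is_ess_inf_def L0_le_class)
  show ?thesis
    by (rule glb_eqI[OF _ greatest[folded Up]]) (simp add: L0_bar_def, erule (3) L0_le_antisym)
qed

lemma is_ess_sup_upper: "is_ess_sup M F s \<Longrightarrow> f \<in> F \<Longrightarrow> AE w in M. f w \<le> s w"
  by (simp add: is_ess_sup_def)

lemma is_ess_sup_least:
  "is_ess_sup M F s \<Longrightarrow> h \<in> borel_measurable M \<Longrightarrow> (\<And>f. f \<in> F \<Longrightarrow> AE w in M. f w \<le> h w) \<Longrightarrow>
    AE w in M. s w \<le> h w"
  by (simp add: is_ess_sup_def)

lemma is_ess_inf_lower: "is_ess_inf M F s \<Longrightarrow> f \<in> F \<Longrightarrow> AE w in M. s w \<le> f w"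
  by (simp add: is_ess_inf_def)

lemma is_ess_inf_greatest:
  "is_ess_inf M F s \<Longrightarrow> h \<in> borel_measurable M \<Longrightarrow> (\<And>f. f \<in> F \<Longrightarrow> AE w in M. h w \<le> f w) \<Longrightarrow>
    AE w in M. h w \<le> s w"
  by (simp add: is_ess_inf_def)

section \<open>The measure algebra\<close>

lemma event_class_eq_iff:
  assumes "A \<in> sets M" "B \<in> sets M"
  shows "event_class M A = event_class M B \<longleftrightarrow> (AE w in M. w \<in> A \<longleftrightarrow> w \<in> B)"
proof
  assume "event_class M A = event_class M B"
  moreover have "A \<in> event_class M A" using assms by (simp add: event_class_def)
  ultimately show "AE w in M. w \<in> A \<longleftrightarrow> w \<in> B" by (simp add: event_class_def)
next
  assume ae: "AE w in M. w \<in> A \<longleftrightarrow> w \<in> B"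
  have "(AE w in M. w \<in> C \<longleftrightarrow> w \<in> A) \<longleftrightarrow> (AE w in M. w \<in> C \<longleftrightarrow> w \<in> B)" for C
  proof
    assume "AE w in M. w \<in> C \<longleftrightarrow> w \<in> A"
    with ae show "AE w in M. w \<in> C \<longleftrightarrow> w \<in> B" by eventually_elim simp
  next
    assume "AE w in M. w \<in> C \<longleftrightarrow> w \<in> B"
    with ae show "AE w in M. w \<in> C \<longleftrightarrow> w \<in> A" by eventually_elim simp
  qed
  then show "event_class M A = event_class M B" by (simp add: event_class_def)
qed

lemma meas_alg_le:
  assumes "A \<in> sets M" "B \<in> sets M"
  shows "event_class M A \<sqsubseteq>\<^bsub>meas_alg M\<^esub> event_class M B \<longleftrightarrow> (AE w\<in>A in M. w \<in> B)"
proof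
  assume "event_class M A \<sqsubseteq>\<^bsub>meas_alg M\<^esub> event_class M B"
  then obtain A' B' where ab: "AE w in M. w \<in> A' \<longleftrightarrow> w \<in> A" "AE w in M. w \<in> B' \<longleftrightarrow> w \<in> B"
    "AE w\<in>A' in M. w \<in> B'"
    by (auto simp: meas_alg_def event_class_def)
  then show "AE w\<in>A in M. w \<in> B" by eventually_elim simp
next
  assume "AE w\<in>A in M. w \<in> B"
  then show "event_class M A \<sqsubseteq>\<^bsub>meas_alg M\<^esub> event_class M B"
    using assms by (auto simp: meas_alg_def event_class_def)
qed

lemma meas_alg_carrier: "carrier (meas_alg M) = event_class M ` sets M"
  by (simp add: meas_alg_def)

lemma meas_alg_antisym:
  assumes "a \<in> carrier (meas_alg M)" "b \<in> carrier (meas_alg M)"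
    "a \<sqsubseteq>\<^bsub>meas_alg M\<^esub> b" "b \<sqsubseteq>\<^bsub>meas_alg M\<^esub> a"
  shows "a = b"
proof -
  obtain A B where A: "A \<in> sets M" "a = event_class M A" and B: "B \<in> sets M" "b = event_class M B"
    using assms(1,2) by (auto simp: meas_alg_carrier)
  have "AE w\<in>A in M. w \<in> B" "AE w\<in>B in M. w \<in> A"
    using assms(3,4) A B by (simp_all add: meas_alg_le)
  then have "AE w in M. w \<in> A \<longleftrightarrow> w \<in> B" by eventually_elim blast
  then show ?thesis using A B by (simp add: event_class_eq_iff)
qed

lemma meas_alg_sup:
  assumes "\<And>n::nat. A n \<in> sets M"
  shows "\<Squnion>\<^bsub>meas_alg M\<^esub>(range (\<lambda>n. event_class M (A n))) = event_class M (\<Union>n. A n)"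
proof -
  let ?L = "meas_alg M" and ?R = "range (\<lambda>n. event_class M (A n))"
  have U: "(\<Union>n. A n) \<in> sets M" using assms by blast
  have least: "least ?L (event_class M (\<Union>n. A n)) (Upper ?L ?R)"
    unfolding least_def
  proof (intro conjI ballI)
    show "Upper ?L ?R \<subseteq> carrier ?L" by (auto simp: Upper_def)
    have "event_class M (A n) \<sqsubseteq>\<^bsub>?L\<^esub> event_class M (\<Union>n. A n)" for n
      using meas_alg_le[OF assms U, of n] by auto
    then show "event_class M (\<Union>n. A n) \<in> Upper ?L ?R" using U by (auto simp: Upper_def meas_alg_carrier)
    fix b assume b: "b \<in> Upper ?L ?R"
    then obtain B where B: "B \<in> sets M" "b = event_class M B" by (auto simp: Upper_def meas_alg_carrier)
    have "AE w\<in>A n in M. w \<in> B" for n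
    proof -
      have "event_class M (A n) \<sqsubseteq>\<^bsub>?L\<^esub> b" using b assms[of n] by (auto simp: Upper_def meas_alg_carrier)
      then show ?thesis using assms[of n] B by (simp add: meas_alg_le)
    qed
    then have "AE w in M. \<forall>n. w \<in> A n \<longrightarrow> w \<in> B" unfolding AE_all_countable by blast
    then have "AE w in M. w \<in> (\<Union>n. A n) \<longrightarrow> w \<in> B" by eventually_elim blast
    then show "event_class M (\<Union>n. A n) \<sqsubseteq>\<^bsub>?L\<^esub> b" using B U by (simp add: meas_alg_le)
  qed
  show ?thesis by (rule lub_eqI[OF meas_alg_antisym least])
qed

lemma meas_alg_meet:
  assumes A: "A \<in> sets M" and B: "B \<in> sets M"
  shows "event_class M A \<sqinter>\<^bsub>meas_alg M\<^esub> event_class M B = event_class M (A \<inter> B)"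
proof -
  let ?L = "meas_alg M" and ?R = "{event_class M A, event_class M B}"
  have I: "A \<inter> B \<in> sets M" using assms by blast
  have greatest: "greatest ?L (event_class M (A \<inter> B)) (Lower ?L ?R)"
    unfolding greatest_def
  proof (intro conjI ballI)
    show "Lower ?L ?R \<subseteq> carrier ?L" by (auto simp: Lower_def)
    show "event_class M (A \<inter> B) \<in> Lower ?L ?R"
      using meas_alg_le[OF I A] meas_alg_le[OF I B] I by (auto simp: Lower_def meas_alg_carrier)
    fix c assume c: "c \<in> Lower ?L ?R"
    then obtain C where C: "C \<in> sets M" "c = event_class M C" by (auto simp: Lower_def meas_alg_carrier)
    have "AE w\<in>C in M. w \<in> A" "AE w\<in>C in M. w \<in> B"
      using c C A B by (auto simp: Lower_def meas_alg_carrier meas_alg_le)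
    then have "AE w\<in>C in M. w \<in> A \<inter> B" by eventually_elim blast
    then show "c \<sqsubseteq>\<^bsub>?L\<^esub> event_class M (A \<inter> B)" using C I by (simp add: meas_alg_le)
  qed
  show ?thesis unfolding meet_def by (rule glb_eqI[OF meas_alg_antisym greatest])
qed

text \<open>
  A partition of unity constrains only classes of events, so representatives cover the space and are disjoint
  merely almost surely.
\<close>

lemma partition_of_unity_AE:
  assumes a: "partition_of_unity M a" and A: "\<And>n. A n \<in> sets M" "\<And>n. a n = event_class M (A n)"
  shows "AE w in M. (\<exists>n. w \<in> A n) \<and> (\<forall>i j. w \<in> A i \<and> w \<in> A j \<longrightarrow> i = j)"
proof -
  have "a = (\<lambda>n. event_class M (A n))" using A(2) by blast
  then have "event_class M (\<Union>n. A n) = event_class M (space M)"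
    using a meas_alg_sup[OF A(1)] by (simp add: partition_of_unity_def)
  then have cov: "AE w in M. w \<in> (\<Union>n. A n) \<longleftrightarrow> w \<in> space M" using A(1) by (subst (asm) event_class_eq_iff) auto
  have "AE w in M. i \<noteq> j \<longrightarrow> \<not> (w \<in> A i \<and> w \<in> A j)" for i j
  proof (cases "i = j")
    case False
    then have "event_class M (A i \<inter> A j) = event_class M {}"
      using a A meas_alg_meet[OF A(1) A(1), of i j] by (simp add: partition_of_unity_def)
    then have "AE w in M. w \<in> A i \<inter> A j \<longleftrightarrow> w \<in> {}" using A(1) by (subst (asm) event_class_eq_iff) auto
    then show ?thesis by eventually_elim blast
  qed simp
  then have "AE w in M. \<forall>i j. i \<noteq> j \<longrightarrow> \<not> (w \<in> A i \<and> w \<in> A j)" by (simp add: AE_all_countable)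
  with cov show ?thesis using AE_space by eventually_elim blast
qed

section \<open>Random scalars and norms\<close>

context rn_module
begin

text \<open>
  Convexity and indicators need only real scalars; these embed into the \<open>K\<close>-valued random variables.
\<close>

definition of_rv :: "('w \<Rightarrow> real) \<Rightarrow> ('w \<Rightarrow> 'k) set" where
  "of_rv f = L0_class M (\<lambda>w. of_real (f w))"

definition rsm :: "('w \<Rightarrow> real) \<Rightarrow> 'e \<Rightarrow> 'e" where
  "rsm f x = of_rv f \<odot> x"

text \<open>
  A representative of the norm that is non-negative everywhere, not just almost surely.
\<close>

definition nrm :: "'e \<Rightarrow> 'w \<Rightarrow> real" where
  "nrm x w = max 0 ((SOME f. f \<in> rnorm E x) w)"

definition dst :: "'e \<Rightarrow> 'e \<Rightarrow> 'w \<Rightarrow> real" where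
  "dst x y = nrm (x \<ominus> y)"

definition conv :: "('w \<Rightarrow> real) \<Rightarrow> 'e \<Rightarrow> 'e \<Rightarrow> 'e" where
  "conv f x y = rsm f x \<oplus> rsm (\<lambda>w. 1 - f w) y"

text \<open>
  Equal to \<open>x\<close> on \<open>A\<close> and to \<open>y\<close> off \<open>A\<close>: gluing two points is a convex combination.
\<close>

definition patch :: "'w set \<Rightarrow> 'e \<Rightarrow> 'e \<Rightarrow> 'e" where
  "patch A = conv (indicator A)"

lemma of_real_measurable [measurable]:
  "f \<in> borel_measurable M \<Longrightarrow> (\<lambda>w. of_real (f w) :: 'k) \<in> borel_measurable M"
  by (rule measurable_compose[where N = borel])
     (auto intro!: borel_measurable_continuous_onI continuous_intros)

lemma of_rv_closed [simp]: "f \<in> borel_measurable M \<Longrightarrow> of_rv f \<in> carrier (L0_ring M)"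
  by (simp add: of_rv_def L0_ring_def L0_class_in_L0)

lemma of_rv_add:
  assumes "f \<in> borel_measurable M" "g \<in> borel_measurable M"
  shows "of_rv f \<oplus>\<^bsub>L0_ring M\<^esub> of_rv g = of_rv (\<lambda>w. f w + g w)"
  using assms by (simp add: of_rv_def L0_ring_def L0_map2_class)

lemma of_rv_mult:
  assumes "f \<in> borel_measurable M" "g \<in> borel_measurable M"
  shows "of_rv f \<otimes>\<^bsub>L0_ring M\<^esub> of_rv g = of_rv (\<lambda>w. f w * g w)"
  using assms by (simp add: of_rv_def L0_ring_def L0_map2_class)

lemma of_rv_one: "of_rv (\<lambda>_. 1) = \<one>\<^bsub>L0_ring M\<^esub>"
  by (simp add: of_rv_def L0_ring_def)

lemma of_rv_zero: "of_rv (\<lambda>_. 0) = \<zero>\<^bsub>L0_ring M\<^esub>"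
  by (simp add: of_rv_def L0_ring_def)

lemma of_rv_cong:
  assumes "f \<in> borel_measurable M" "g \<in> borel_measurable M" "AE w in M. f w = g w"
  shows "of_rv f = of_rv g"
  unfolding of_rv_def using assms by (subst L0_class_eq_iff) auto

lemma of_rv_one_minus:
  assumes "f \<in> borel_measurable M"
  shows "\<one>\<^bsub>L0_ring M\<^esub> \<ominus>\<^bsub>L0_ring M\<^esub> of_rv f = of_rv (\<lambda>w. 1 - f w)"
proof -
  have "of_rv (\<lambda>w. - f w) \<oplus>\<^bsub>L0_ring M\<^esub> of_rv f = \<zero>\<^bsub>L0_ring M\<^esub>"
    using assms by (simp add: of_rv_add of_rv_zero)
  then have "\<ominus>\<^bsub>L0_ring M\<^esub> of_rv f = of_rv (\<lambda>w. - f w)"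
    using assms by (intro R.minus_equality) simp_all
  then show ?thesis
    using assms of_rv_add[of "\<lambda>_. 1" "\<lambda>w. - f w"] by (simp add: a_minus_def of_rv_one)
qed

lemma rsm_closed [simp, intro]:
  "f \<in> borel_measurable M \<Longrightarrow> x \<in> carrier E \<Longrightarrow> rsm f x \<in> carrier E"
  by (simp add: rsm_def)

lemma rsm_add:
  "f \<in> borel_measurable M \<Longrightarrow> x \<in> carrier E \<Longrightarrow> y \<in> carrier E \<Longrightarrow> rsm f (x \<oplus> y) = rsm f x \<oplus> rsm f y"
  by (simp add: rsm_def smult_r_distr)

lemma rsm_plus:
  "f \<in> borel_measurable M \<Longrightarrow> g \<in> borel_measurable M \<Longrightarrow> x \<in> carrier E \<Longrightarrow>
    rsm (\<lambda>w. f w + g w) x = rsm f x \<oplus> rsm g x"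
  by (simp add: rsm_def smult_l_distr flip: of_rv_add)

lemma rsm_rsm:
  "f \<in> borel_measurable M \<Longrightarrow> g \<in> borel_measurable M \<Longrightarrow> x \<in> carrier E \<Longrightarrow>
    rsm f (rsm g x) = rsm (\<lambda>w. f w * g w) x"
  by (simp add: rsm_def smult_assoc1 flip: of_rv_mult)

lemma rsm_1: "x \<in> carrier E \<Longrightarrow> rsm (\<lambda>_. 1) x = x"
  by (simp add: rsm_def of_rv_one)

lemma rsm_cong:
  assumes "f \<in> borel_measurable M" "g \<in> borel_measurable M" "AE w in M. f w = g w"
  shows "rsm f x = rsm g x"
  using of_rv_cong[OF assms] by (simp add: rsm_def)

lemma rsm_0: "x \<in> carrier E \<Longrightarrow> rsm (\<lambda>_. 0) x = \<zero>"
  by (simp add: rsm_def of_rv_zero smult_l_null)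

lemma minus_eq_rsm:
  assumes "x \<in> carrier E" "y \<in> carrier E"
  shows "x \<ominus> y = x \<oplus> rsm (\<lambda>_. - 1) y"
proof -
  have "rsm (\<lambda>_. - 1) y \<oplus> y = \<zero>"
    using assms rsm_plus[of "\<lambda>_. -1" "\<lambda>_. 1" y] by (simp add: rsm_1 rsm_0)
  then have "\<ominus> y = rsm (\<lambda>_. - 1) y" using assms by (intro M.minus_equality) simp_all
  then show ?thesis using assms by (simp add: a_minus_def)
qed

text \<open>
  Identities between linear combinations with random coefficients are proved by normalisation: both sides are
  expanded over the same (at most four, possibly repeated) vectors, and the coefficients are compared almost surely.
  The rules \<open>is_lc_intros\<close> compute the expansion, \<open>is_lc_eq\<close> concludes.
\<close>

definition is_lc where
  "is_lc x y z u a b c d e \<longleftrightarrow> {x, y, z, u} \<subseteq> carrier E \<and> {a, b, c, d} \<subseteq> borel_measurable M \<and>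
     e = rsm a x \<oplus> (rsm b y \<oplus> (rsm c z \<oplus> rsm d u))"

lemma is_lc_closed: "is_lc x y z u a b c d e \<Longrightarrow> e \<in> carrier E"
  by (auto simp: is_lc_def)

lemma is_lc_base:
  assumes "{x, y, z, u} \<subseteq> carrier E"
  shows "is_lc x y z u (\<lambda>_. 1) (\<lambda>_. 0) (\<lambda>_. 0) (\<lambda>_. 0) x"
    "is_lc x y z u (\<lambda>_. 0) (\<lambda>_. 1) (\<lambda>_. 0) (\<lambda>_. 0) y"
    "is_lc x y z u (\<lambda>_. 0) (\<lambda>_. 0) (\<lambda>_. 1) (\<lambda>_. 0) z"
    "is_lc x y z u (\<lambda>_. 0) (\<lambda>_. 0) (\<lambda>_. 0) (\<lambda>_. 1) u"
    "is_lc x y z u (\<lambda>_. 0) (\<lambda>_. 0) (\<lambda>_. 0) (\<lambda>_. 0) \<zero>"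
  using assms by (auto simp: is_lc_def rsm_0 rsm_1)

lemma is_lc_add:
  assumes "is_lc x y z u a b c d e" "is_lc x y z u a' b' c' d' e'"
  shows "is_lc x y z u (\<lambda>w. a w + a' w) (\<lambda>w. b w + b' w) (\<lambda>w. c w + c' w) (\<lambda>w. d w + d' w) (e \<oplus> e')"
  using assms by (auto simp: is_lc_def rsm_plus M.a_ac)

lemma is_lc_rsm:
  assumes "f \<in> borel_measurable M" "is_lc x y z u a b c d e"
  shows "is_lc x y z u (\<lambda>w. f w * a w) (\<lambda>w. f w * b w) (\<lambda>w. f w * c w) (\<lambda>w. f w * d w) (rsm f e)"
  using assms by (auto simp: is_lc_def rsm_add rsm_rsm)

lemma is_lc_minus:
  assumes "is_lc x y z u a b c d e" "is_lc x y z u a' b' c' d' e'"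
  shows "is_lc x y z u (\<lambda>w. a w - a' w) (\<lambda>w. b w - b' w) (\<lambda>w. c w - c' w) (\<lambda>w. d w - d' w) (e \<ominus> e')"
  using is_lc_add[OF assms(1) is_lc_rsm[OF _ assms(2), of "\<lambda>_. - 1"]]
  by (simp add: minus_eq_rsm[OF is_lc_closed[OF assms(1)] is_lc_closed[OF assms(2)]])

lemma is_lc_conv:
  assumes "f \<in> borel_measurable M" "is_lc x y z u a b c d e" "is_lc x y z u a' b' c' d' e'"
  shows "is_lc x y z u (\<lambda>w. f w * a w + (1 - f w) * a' w) (\<lambda>w. f w * b w + (1 - f w) * b' w)
    (\<lambda>w. f w * c w + (1 - f w) * c' w) (\<lambda>w. f w * d w + (1 - f w) * d' w) (conv f e e')"
  using is_lc_add[OF is_lc_rsm[OF assms(1,2)] is_lc_rsm[of "\<lambda>w. 1 - f w", OF _ assms(3)]] assms(1)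
  by (simp add: conv_def)

lemmas is_lc_intros = is_lc_rsm is_lc_conv is_lc_minus is_lc_add is_lc_base

lemma is_lc_eq:
  assumes "is_lc x y z u a b c d e" "is_lc x y z u a' b' c' d' e'"
    "AE w in M. a w = a' w \<and> b w = b' w \<and> c w = c' w \<and> d w = d' w"
  shows "e = e'"
proof -
  have ae: "AE w in M. a w = a' w" "AE w in M. b w = b' w" "AE w in M. c w = c' w" "AE w in M. d w = d' w"
    using assms(3) by auto
  show ?thesis
    using assms(1,2) rsm_cong[OF _ _ ae(1), of x] rsm_cong[OF _ _ ae(2), of y]
      rsm_cong[OF _ _ ae(3), of z] rsm_cong[OF _ _ ae(4), of u]
    by (auto simp: is_lc_def)
qed

lemma conv_closed [simp, intro]:
  "f \<in> borel_measurable M \<Longrightarrow> x \<in> carrier E \<Longrightarrow> y \<in> carrier E \<Longrightarrow> conv f x y \<in> carrier E"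
  by (simp add: conv_def)

lemma patch_closed [simp, intro]:
  "A \<in> sets M \<Longrightarrow> x \<in> carrier E \<Longrightarrow> y \<in> carrier E \<Longrightarrow> patch A x y \<in> carrier E"
  by (simp add: patch_def)

lemma conv_same: "f \<in> borel_measurable M \<Longrightarrow> x \<in> carrier E \<Longrightarrow> conv f x x = x"
  by (rule_tac is_lc_eq[of x x x x], (rule is_lc_intros | (simp add: algebra_simps; fail))+)

lemma rnorm_nrm:
  assumes "x \<in> carrier E"
  shows "nrm x \<in> borel_measurable M" "rnorm E x = L0_class M (nrm x)"
proof -
  have "rnorm E x \<in> L0 M" using rnorm_in_L0_plus[OF assms] by (simp add: L0_plus_def)
  then obtain f where f: "f \<in> borel_measurable M" "rnorm E x = L0_class M f" by (rule L0_E)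
  define g where "g = (SOME f. f \<in> rnorm E x)"
  have "g \<in> rnorm E x" unfolding g_def
    by (rule someI[of "\<lambda>h. h \<in> rnorm E x"]) (use f L0_class_self in auto)
  then have g: "g \<in> borel_measurable M" "AE w in M. g w = f w" using f by (auto simp: L0_class_mem)
  have eq: "nrm x = (\<lambda>w. max 0 (g w))" by (simp add: nrm_def g_def fun_eq_iff)
  show m: "nrm x \<in> borel_measurable M" unfolding eq using g by simp
  have "AE w in M. 0 \<le> f w" using rnorm_in_L0_plus[OF assms] f by (simp add: L0_plus_class)
  with g(2) have "AE w in M. nrm x w = f w" unfolding eq by eventually_elim simp
  then show "rnorm E x = L0_class M (nrm x)" using m f by (simp add: L0_class_eq_iff) (auto elim: AE_mp)
qed

lemma nrm_measurable [measurable, simp]: "x \<in> carrier E \<Longrightarrow> nrm x \<in> borel_measurable M"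
  by (rule rnorm_nrm)

lemma dst_measurable [measurable, simp]: "x \<in> carrier E \<Longrightarrow> y \<in> carrier E \<Longrightarrow> dst x y \<in> borel_measurable M"
  by (simp add: dst_def)

lemma nrm_nonneg [simp]: "0 \<le> nrm x w" by (simp add: nrm_def)
lemma dst_nonneg [simp]: "0 \<le> dst x y w" by (simp add: dst_def)

lemma nrm_rsm:
  assumes "f \<in> borel_measurable M" "x \<in> carrier E"
  shows "AE w in M. nrm (rsm f x) w = \<bar>f w\<bar> * nrm x w"
proof -
  have "rnorm E (rsm f x) = L0_map2 M (*) (L0_map M norm (of_rv f)) (rnorm E x)"
    using rnorm_smult[of "of_rv f" x] assms
    by (simp add: rsm_def of_rv_def L0_class_in_L0)
  then have "L0_class M (nrm (rsm f x)) = L0_map2 M (*) (L0_map M norm (of_rv f)) (L0_class M (nrm x))"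
    using assms by (simp add: rnorm_nrm(2))
  also have "\<dots> = L0_class M (\<lambda>w. \<bar>f w\<bar> * nrm x w)"
    using assms by (simp add: of_rv_def L0_map_class L0_map2_class)
  finally show ?thesis using assms by (simp add: L0_class_eq_iff)
qed

lemma nrm_triangle:
  assumes "x \<in> carrier E" "y \<in> carrier E"
  shows "AE w in M. nrm (x \<oplus> y) w \<le> nrm x w + nrm y w"
  using rnorm_triangle[OF assms] assms by (simp add: rnorm_nrm(2) L0_map2_class L0_le_class)

lemma nrm_eq_0:
  assumes "x \<in> carrier E" "AE w in M. nrm x w = 0"
  shows "x = \<zero>"
  using assms by (intro rnorm_eq_zero) (simp_all add: rnorm_nrm(2) L0_class_eq_iff)

lemma nrm_zero: "AE w in M. nrm \<zero> w = 0"
  using nrm_rsm[of "\<lambda>_. 0" \<zero>] by (simp add: rsm_0)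

lemma dst_zero: assumes "x \<in> carrier E" shows "dst x \<zero> = nrm x"
proof -
  have "x \<ominus> \<zero> = x" by (insert assms, rule_tac is_lc_eq[of x x x x], (rule is_lc_intros | (simp add: algebra_simps; fail))+)
  then show ?thesis by (simp add: dst_def)
qed

lemma dst_self:
  assumes "x \<in> carrier E" shows "AE w in M. dst x x w = 0"
proof -
  have "x \<ominus> x = \<zero>" by (insert assms, rule_tac is_lc_eq[of x x x x], (rule is_lc_intros | (simp add: algebra_simps; fail))+)
  then show ?thesis using nrm_zero by (simp add: dst_def)
qed

lemma dst_sym:
  assumes "x \<in> carrier E" "y \<in> carrier E"
  shows "AE w in M. dst x y w = dst y x w"
proof -
  have "x \<ominus> y = rsm (\<lambda>_. - 1) (y \<ominus> x)"
    by (insert assms, rule_tac is_lc_eq[of x y x y], (rule is_lc_intros | (simp add: algebra_simps; fail))+)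
  then show ?thesis using nrm_rsm[of "\<lambda>_. - 1" "y \<ominus> x"] assms by (simp add: dst_def)
qed

lemma dst_triangle:
  assumes "x \<in> carrier E" "y \<in> carrier E" "z \<in> carrier E"
  shows "AE w in M. dst x z w \<le> dst x y w + dst y z w"
proof -
  have "x \<ominus> z = (x \<ominus> y) \<oplus> (y \<ominus> z)"
    by (insert assms, rule_tac is_lc_eq[of x y z z], (rule is_lc_intros | (simp add: algebra_simps; fail))+)
  then show ?thesis using nrm_triangle[of "x \<ominus> y" "y \<ominus> z"] assms by (simp add: dst_def)
qed

lemma dst_eq_0:
  assumes "x \<in> carrier E" "y \<in> carrier E" "AE w in M. dst x y w = 0"
  shows "x = y"
proof -
  have "x \<ominus> y = \<zero>" using nrm_eq_0[of "x \<ominus> y"] assms by (simp add: dst_def)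
  moreover have "x = (x \<ominus> y) \<oplus> y"
    by (insert assms, rule_tac is_lc_eq[of x y x y], (rule is_lc_intros | (simp add: algebra_simps; fail))+)
  ultimately show ?thesis using assms by simp
qed

text \<open>
  The source of all distance estimates for convex combinations and patches below.
\<close>

lemma dst_conv_conv:
  assumes "f \<in> borel_measurable M" "x \<in> carrier E" "y \<in> carrier E" "x' \<in> carrier E" "y' \<in> carrier E"
  shows "AE w in M. dst (conv f x y) (conv f x' y') w \<le> \<bar>f w\<bar> * dst x x' w + \<bar>1 - f w\<bar> * dst y y' w"
proof -
  have eq: "conv f x y \<ominus> conv f x' y' = rsm f (x \<ominus> x') \<oplus> rsm (\<lambda>w. 1 - f w) (y \<ominus> y')"
    by (insert assms, rule_tac is_lc_eq[of x y x' y'], (rule is_lc_intros | (simp add: algebra_simps; fail))+)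
  have "AE w in M. nrm (conv f x y \<ominus> conv f x' y') w \<le> nrm (rsm f (x \<ominus> x')) w + nrm (rsm (\<lambda>w. 1 - f w) (y \<ominus> y')) w"
    unfolding eq using assms by (intro nrm_triangle) auto
  moreover have "AE w in M. nrm (rsm f (x \<ominus> x')) w = \<bar>f w\<bar> * nrm (x \<ominus> x') w" using assms by (intro nrm_rsm) auto
  moreover have "AE w in M. nrm (rsm (\<lambda>w. 1 - f w) (y \<ominus> y')) w = \<bar>1 - f w\<bar> * nrm (y \<ominus> y') w" using assms by (intro nrm_rsm) auto
  ultimately show ?thesis unfolding dst_def by eventually_elim simp
qed

lemma dst_conv:
  assumes "f \<in> borel_measurable M" "x \<in> carrier E" "y \<in> carrier E" "z \<in> carrier E"
  shows "AE w in M. dst (conv f x y) z w \<le> \<bar>f w\<bar> * dst x z w + \<bar>1 - f w\<bar> * dst y z w"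
  using dst_conv_conv[OF assms(1-3) assms(4,4)] assms by (simp add: conv_same)

lemma dst_conv_left:
  assumes "f \<in> borel_measurable M" "x \<in> carrier E" "y \<in> carrier E"
  shows "AE w in M. dst (conv f x y) x w \<le> \<bar>1 - f w\<bar> * dst x y w"
  using dst_conv[OF assms assms(2)] dst_self[OF assms(2)] dst_sym[OF assms(2,3)]
  by eventually_elim simp

lemma dst_conv_right:
  assumes "f \<in> borel_measurable M" "x \<in> carrier E" "y \<in> carrier E"
  shows "AE w in M. dst (conv f x y) y w \<le> \<bar>f w\<bar> * dst x y w"
  using dst_conv[OF assms assms(3)] dst_self[OF assms(3)]
  by eventually_elim simp

lemma patch_dst:
  assumes "A \<in> sets M" "x \<in> carrier E" "y \<in> carrier E"
  shows "AE w in M. (w \<in> A \<longrightarrow> dst (patch A x y) x w = 0) \<and> (w \<notin> A \<longrightarrow> dst (patch A x y) y w = 0)"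
proof -
  have "AE w in M. dst (patch A x y) x w \<le> \<bar>1 - indicator A w\<bar> * dst x y w"
    "AE w in M. dst (patch A x y) y w \<le> \<bar>indicator A w\<bar> * dst x y w"
    unfolding patch_def using assms by (intro dst_conv_left dst_conv_right; simp)+
  then show ?thesis
  proof eventually_elim
    case (elim w)
    then show ?case using dst_nonneg[of "patch A x y" x w] dst_nonneg[of "patch A x y" y w]
      by (auto simp del: dst_nonneg)
  qed
qed

text \<open>
  Locality in the module is locality of the distance; from here on \<open>I\<^bsub>A\<^esub> x = I\<^bsub>A\<^esub> y\<close> is always read as
  \<open>dst x y = 0\<close> on \<open>A\<close>.
\<close>

lemma ind_smult_eq_iff:
  assumes "A \<in> sets M" "x \<in> carrier E" "y \<in> carrier E"
  shows "L0_ind M A \<odot> x = L0_ind M A \<odot> y \<longleftrightarrow> (AE w\<in>A in M. dst x y w = 0)"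
proof -
  have "(indicator A :: 'w \<Rightarrow> 'k) = (\<lambda>w. of_real (indicator A w))" by (auto simp: indicator_def)
  then have ind: "L0_ind M A \<odot> x = rsm (indicator A) x" for x
    by (simp add: L0_ind_def rsm_def of_rv_def)
  have eq: "rsm (indicator A) x \<ominus> rsm (indicator A) y = rsm (indicator A) (x \<ominus> y)"
    by (insert assms, rule_tac is_lc_eq[of x y x y], (rule is_lc_intros | (simp add: algebra_simps; fail))+)
  have *: "AE w in M. nrm (rsm (indicator A) x \<ominus> rsm (indicator A) y) w = indicator A w * dst x y w"
    unfolding eq dst_def using nrm_rsm[of "indicator A" "x \<ominus> y"] assms by simp
  show ?thesis unfolding ind
  proof
    assume "rsm (indicator A) x = rsm (indicator A) y"
    then have "AE w in M. dst (rsm (indicator A) x) (rsm (indicator A) y) w = 0"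
      using assms by (simp add: dst_self)
    with * show "AE w\<in>A in M. dst x y w = 0" by eventually_elim (auto simp: dst_def)
  next
    assume "AE w\<in>A in M. dst x y w = 0"
    with * have "AE w in M. dst (rsm (indicator A) x) (rsm (indicator A) y) w = 0"
      by eventually_elim (auto simp: dst_def indicator_def)
    then show "rsm (indicator A) x = rsm (indicator A) y" using assms by (intro dst_eq_0) auto
  qed
qed

lemma L0_convex_iff:
  assumes "X \<subseteq> carrier E"
  shows "L0_convex M E X \<longleftrightarrow> (\<forall>x\<in>X. \<forall>y\<in>X. \<forall>f\<in>borel_measurable M.
    (AE w in M. 0 \<le> f w \<and> f w \<le> 1) \<longrightarrow> conv f x y \<in> X)"
proof -
  have eq: "(let \<zeta> = L0_map M of_real (L0_class M f)
         in \<zeta> \<odot>\<^bsub>E\<^esub> x \<oplus>\<^bsub>E\<^esub> (\<one>\<^bsub>L0_ring M\<^esub> \<ominus>\<^bsub>L0_ring M\<^esub> \<zeta>) \<odot>\<^bsub>E\<^esub> y) = conv f x y"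
    if "f \<in> borel_measurable M" for f x y
    using that by (simp add: L0_map_class conv_def rsm_def flip: of_rv_def) (simp add: of_rv_one_minus)
  show ?thesis
  proof
    assume L: "L0_convex M E X"
    show "\<forall>x\<in>X. \<forall>y\<in>X. \<forall>f\<in>borel_measurable M. (AE w in M. 0 \<le> f w \<and> f w \<le> 1) \<longrightarrow> conv f x y \<in> X"
    proof (intro ballI impI)
      fix x y and f :: "'w \<Rightarrow> real" assume x: "x \<in> X" and y: "y \<in> X" and f: "f \<in> borel_measurable M" "AE w in M. 0 \<le> f w \<and> f w \<le> 1"
      have xi: "L0_class M f \<in> L0_plus M" "L0_le M (L0_class M f) (L0_class M (\<lambda>_. 1))"
        using f by (auto simp: L0_plus_class L0_le_class)
      show "conv f x y \<in> X"
        using L[unfolded L0_convex_def, THEN bspec, OF x, THEN bspec, OF y, THEN bspec, OF xi(1), THEN mp, OF xi(2)]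
        unfolding Let_def using eq[OF f(1), of x y] by (simp add: Let_def)
    qed
  next
    assume R: "\<forall>x\<in>X. \<forall>y\<in>X. \<forall>f\<in>borel_measurable M. (AE w in M. 0 \<le> f w \<and> f w \<le> 1) \<longrightarrow> conv f x y \<in> X"
    show "L0_convex M E X" unfolding L0_convex_def
    proof (intro ballI impI)
      fix x y \<xi> assume xy: "x \<in> X" "y \<in> X" and xi: "\<xi> \<in> L0_plus M" "L0_le M \<xi> (L0_class M (\<lambda>_. 1))"
      obtain f where f: "f \<in> borel_measurable M" "\<xi> = L0_class M f"
        using xi(1) unfolding L0_plus_def by (auto elim: L0_E)
      have "AE w in M. 0 \<le> f w" "AE w in M. f w \<le> 1" using xi f by (simp_all add: L0_plus_class L0_le_class)
      then have "conv f x y \<in> X" using R xy f(1) by simp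
      then show "let \<zeta> = L0_map M of_real \<xi>
         in \<zeta> \<odot>\<^bsub>E\<^esub> x \<oplus>\<^bsub>E\<^esub> (\<one>\<^bsub>L0_ring M\<^esub> \<ominus>\<^bsub>L0_ring M\<^esub> \<zeta>) \<odot>\<^bsub>E\<^esub> y \<in> X"
        using eq[OF f(1), of x y] f(2) by (simp add: Let_def)
    qed
  qed
qed

section \<open>Chebyshev radii, diameters and boundedness\<close>

text \<open>
  A representative of the random radius; extended real, because \<open>H\<close> need not be bounded.
\<close>

definition rad :: "'e set \<Rightarrow> 'e \<Rightarrow> 'w \<Rightarrow> ereal" where
  "rad H x = (SOME s. is_ess_sup M {\<lambda>w. ereal (dst x y w) | y. y \<in> H} s)"

lemma rdist_eq:
  assumes "x \<in> carrier E" "y \<in> carrier E"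
  shows "rdist M E x y = L0_class M (\<lambda>w. ereal (dst x y w))"
  using assms by (simp add: rdist_def rnorm_nrm(2) L0_map_class dst_def)

lemma rad_ess_sup:
  assumes "H \<subseteq> carrier E" "H \<noteq> {}" "x \<in> carrier E"
  shows "is_ess_sup M {\<lambda>w. ereal (dst x y w) | y. y \<in> H} (rad H x)"
proof -
  have "\<exists>s. is_ess_sup M {\<lambda>w. ereal (dst x y w) | y. y \<in> H} s"
    using assms by (intro ex_ess_sup) (auto simp: subset_iff)
  then show ?thesis unfolding rad_def by (rule someI_ex)
qed

lemma cheb_rad_at_eq:
  assumes "H \<subseteq> carrier E" "H \<noteq> {}" "x \<in> carrier E"
  shows "cheb_rad_at M E H x = L0_class M (rad H x)"
proof -
  let ?F = "{\<lambda>w. ereal (dst x y w) | y. y \<in> H}"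
  have m: "?F \<subseteq> borel_measurable M" using assms by (auto simp: subset_iff)
  have "{rdist M E x y | y. y \<in> H} = (\<lambda>y. L0_class M (\<lambda>w. ereal (dst x y w))) ` H"
    unfolding Setcompr_eq_image by (rule image_cong) (use assms rdist_eq in auto)
  also have "\<dots> = L0_class M ` ?F" by (simp add: Setcompr_eq_image image_image)
  finally show ?thesis unfolding cheb_rad_at_def
    using L0_bar_sup[OF m rad_ess_sup[OF assms]] by simp
qed

lemma rad_measurable [measurable]:
  assumes "H \<subseteq> carrier E" "H \<noteq> {}" "x \<in> carrier E"
  shows "rad H x \<in> borel_measurable M"
  using rad_ess_sup[OF assms] by (simp add: is_ess_sup_def)

lemma rad_upper:
  assumes "H \<subseteq> carrier E" "x \<in> carrier E" "y \<in> H"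
  shows "AE w in M. ereal (dst x y w) \<le> rad H x w"
  by (rule is_ess_sup_upper[OF rad_ess_sup]) (use assms in auto)

lemma rad_least:
  assumes "H \<subseteq> carrier E" "H \<noteq> {}" "x \<in> carrier E" "h \<in> borel_measurable M"
    "\<And>y. y \<in> H \<Longrightarrow> AE w in M. ereal (dst x y w) \<le> h w"
  shows "AE w in M. rad H x w \<le> h w"
  by (rule is_ess_sup_least[OF rad_ess_sup]) (use assms in auto)

lemma ex_cheb_rad:
  assumes "H \<subseteq> carrier E" "H \<noteq> {}" "W \<subseteq> carrier E" "W \<noteq> {}"
  obtains s where "is_ess_inf M (rad H ` W) s" "cheb_rad M E H W = L0_class M s"
proof -
  have m: "rad H ` W \<subseteq> borel_measurable M" using assms rad_measurable[of H] by blast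
  obtain s where s: "is_ess_inf M (rad H ` W) s" using ex_ess_inf[OF m] assms by auto
  have "{cheb_rad_at M E H x | x. x \<in> W} = (\<lambda>x. L0_class M (rad H x)) ` W"
    unfolding Setcompr_eq_image using assms by (intro image_cong cheb_rad_at_eq) auto
  then have "{cheb_rad_at M E H x | x. x \<in> W} = L0_class M ` (rad H ` W)" by (simp add: image_image)
  then have "cheb_rad M E H W = L0_class M s" unfolding cheb_rad_def using L0_bar_inf[OF m s] by simp
  then show thesis using s that by blast
qed

definition diam :: "'e set \<Rightarrow> 'w \<Rightarrow> ereal" where
  "diam H = (SOME s. is_ess_sup M {\<lambda>w. ereal (dst x y w) | x y. x \<in> H \<and> y \<in> H} s)"

lemma diam_ess_sup:
  assumes "H \<subseteq> carrier E" "H \<noteq> {}"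
  shows "is_ess_sup M {\<lambda>w. ereal (dst x y w) | x y. x \<in> H \<and> y \<in> H} (diam H)"
proof -
  have "\<exists>s. is_ess_sup M {\<lambda>w. ereal (dst x y w) | x y. x \<in> H \<and> y \<in> H} s"
    using assms by (intro ex_ess_sup) (auto simp: subset_iff)
  then show ?thesis unfolding diam_def by (rule someI_ex)
qed

lemma rdiam_eq:
  assumes "H \<subseteq> carrier E" "H \<noteq> {}"
  shows "rdiam M E H = L0_class M (diam H)"
proof -
  let ?F = "{\<lambda>w. ereal (dst x y w) | x y. x \<in> H \<and> y \<in> H}"
  have m: "?F \<subseteq> borel_measurable M" using assms by (auto simp: subset_iff)
  have rd: "rdist M E x y = L0_class M (\<lambda>w. ereal (dst x y w))" if "x \<in> H" "y \<in> H" for x y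
    using that assms(1) rdist_eq by auto
  have "{rdist M E x y | x y. x \<in> H \<and> y \<in> H} = L0_class M ` ?F"
  proof (intro equalityI subsetI)
    fix X assume "X \<in> {rdist M E x y | x y. x \<in> H \<and> y \<in> H}"
    then obtain x y where "X = rdist M E x y" "x \<in> H" "y \<in> H" by blast
    then show "X \<in> L0_class M ` ?F" using rd by (intro image_eqI[of _ _ "\<lambda>w. ereal (dst x y w)"]) auto
  next
    fix X assume "X \<in> L0_class M ` ?F"
    then obtain x y where "X = L0_class M (\<lambda>w. ereal (dst x y w))" "x \<in> H" "y \<in> H" by blast
    then show "X \<in> {rdist M E x y | x y. x \<in> H \<and> y \<in> H}" using rd[symmetric] by auto
  qed
  then show ?thesis unfolding rdiam_def using L0_bar_sup[OF m diam_ess_sup[OF assms]] by simp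
qed

lemma diam_measurable:
  assumes "H \<subseteq> carrier E" "H \<noteq> {}"
  shows "diam H \<in> borel_measurable M"
  using diam_ess_sup[OF assms] by (simp add: is_ess_sup_def)

lemma diam_upper:
  assumes "H \<subseteq> carrier E" "x \<in> H" "y \<in> H"
  shows "AE w in M. ereal (dst x y w) \<le> diam H w"
  by (rule is_ess_sup_upper[OF diam_ess_sup]) (use assms in auto)

lemma diam_least:
  assumes "H \<subseteq> carrier E" "H \<noteq> {}" "h \<in> borel_measurable M"
    "\<And>x y. x \<in> H \<Longrightarrow> y \<in> H \<Longrightarrow> AE w in M. ereal (dst x y w) \<le> h w"
  shows "AE w in M. diam H w \<le> h w"
  by (rule is_ess_sup_least[OF diam_ess_sup]) (use assms in auto)

lemma diam_event:
  assumes "H \<subseteq> carrier E" "H \<noteq> {}"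
  shows "AE w in M. w \<in> L0_less_event M (L0_class M (\<lambda>_. 0)) (rdiam M E H) \<longleftrightarrow> 0 < diam H w"
  unfolding rdiam_eq[OF assms] using diam_measurable[OF assms] by (intro L0_less_event_class) auto

lemma as_bounded_iff:
  "as_bounded M E G \<longleftrightarrow> G \<subseteq> carrier E \<and> G \<noteq> {} \<and>
     (\<exists>b\<in>borel_measurable M. \<forall>g\<in>G. AE w in M. nrm g w \<le> b w)"
proof (cases "G \<subseteq> carrier E")
  case sub: True
  let ?F = "{\<lambda>w. ereal (nrm g w) | g. g \<in> G}"
  have m: "?F \<subseteq> borel_measurable M" using sub by (auto simp: subset_iff)
  have cls: "L0_map M ereal (rnorm E g) = L0_class M (\<lambda>w. ereal (nrm g w))" if "g \<in> G" for g
    using that sub by (auto simp: rnorm_nrm(2) L0_map_class subset_iff)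
  have "{L0_map M ereal (rnorm E g) | g. g \<in> G} = (\<lambda>g. L0_class M (\<lambda>w. ereal (nrm g w))) ` G"
    unfolding Setcompr_eq_image by (rule image_cong) (use cls in auto)
  then have F: "{L0_map M ereal (rnorm E g) | g. g \<in> G} = L0_class M ` ?F"
    by (simp add: Setcompr_eq_image image_image)
  show ?thesis
  proof (cases "G = {}")
    case True
    have "is_ess_sup M {} (\<lambda>_. - \<infinity>)" by (auto simp: is_ess_sup_def)
    then have s: "\<Squnion>\<^bsub>L0_bar M\<^esub>{L0_map M ereal (rnorm E g) | g. g \<in> G} = L0_class M (\<lambda>_. - \<infinity>)"
      using L0_bar_sup[of "{}" M] True by simp
    have "L0_class M (\<lambda>_. - \<infinity>) \<notin> L0_map M ereal ` L0_plus M"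
    proof
      assume "L0_class M (\<lambda>_. - \<infinity>) \<in> L0_map M ereal ` L0_plus M"
      then obtain X where X: "X \<in> L0_plus M" "L0_class M (\<lambda>_. - \<infinity>) = L0_map M ereal X" by auto
      obtain f where f: "f \<in> borel_measurable M" "X = L0_class M f"
        using X(1) unfolding L0_plus_def by (auto elim: L0_E)
      then have "AE w in M. - \<infinity> = ereal (f w)"
        using X(2) by (simp add: L0_map_class L0_class_eq_iff)
      then have "AE w in M. False" by eventually_elim simp
      then show False by simp
    qed
    then show ?thesis using s True by (simp add: as_bounded_def)
  next
    case ne: False
    obtain s where s: "is_ess_sup M ?F s" using ex_ess_sup[OF m] ne by auto
    have sup: "\<Squnion>\<^bsub>L0_bar M\<^esub>{L0_map M ereal (rnorm E g) | g. g \<in> G} = L0_class M s"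
      unfolding F by (rule L0_bar_sup[OF m s])
    have sm: "s \<in> borel_measurable M" using s by (simp add: is_ess_sup_def)
    have "L0_class M s \<in> L0_map M ereal ` L0_plus M \<longleftrightarrow> (\<exists>b\<in>borel_measurable M. \<forall>g\<in>G. AE w in M. nrm g w \<le> b w)"
    proof
      assume "L0_class M s \<in> L0_map M ereal ` L0_plus M"
      then obtain X where X: "X \<in> L0_plus M" "L0_class M s = L0_map M ereal X" by auto
      obtain f where f: "f \<in> borel_measurable M" "X = L0_class M f"
        using X(1) unfolding L0_plus_def by (auto elim: L0_E)
      then have ae: "AE w in M. s w = ereal (f w)"
        using X(2) sm by (simp add: L0_map_class L0_class_eq_iff)
      have "AE w in M. nrm g w \<le> f w" if "g \<in> G" for g
      proof -
        have "AE w in M. ereal (nrm g w) \<le> s w" by (rule is_ess_sup_upper[OF s]) (use that in auto)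
        with ae show ?thesis by eventually_elim simp
      qed
      then show "\<exists>b\<in>borel_measurable M. \<forall>g\<in>G. AE w in M. nrm g w \<le> b w" using f(1) by blast
    next
      assume "\<exists>b\<in>borel_measurable M. \<forall>g\<in>G. AE w in M. nrm g w \<le> b w"
      then obtain b where b: "b \<in> borel_measurable M" "\<And>g. g \<in> G \<Longrightarrow> AE w in M. nrm g w \<le> b w" by blast
      have up: "AE w in M. s w \<le> ereal (b w)" by (rule is_ess_sup_least[OF s]) (use b in auto)
      obtain g where g: "g \<in> G" using ne by blast
      have "AE w in M. ereal (nrm g w) \<le> s w" by (rule is_ess_sup_upper[OF s]) (use g in auto)
      then have lo: "AE w in M. 0 \<le> s w"
        by eventually_elim (use nrm_nonneg order_trans zero_ereal_def ereal_less_eq(3) in metis)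
      have eq: "AE w in M. s w = ereal (real_of_ereal (s w))"
        using up lo by eventually_elim (auto simp: ereal_real abs_ereal_ge0)
      have rm: "(\<lambda>w. real_of_ereal (s w)) \<in> borel_measurable M" using sm by simp
      have "L0_class M s = L0_map M ereal (L0_class M (\<lambda>w. real_of_ereal (s w)))"
        using eq sm rm by (simp add: L0_map_class L0_class_eq_iff)
      moreover have "L0_class M (\<lambda>w. real_of_ereal (s w)) \<in> L0_plus M"
        using rm by (subst L0_plus_class[OF rm]) (use lo in \<open>auto simp: real_of_ereal_pos elim: AE_mp\<close>)
      ultimately show "L0_class M s \<in> L0_map M ereal ` L0_plus M" by blast
    qed
    then show ?thesis using sub ne sup by (simp add: as_bounded_def)
  qed
qed (simp add: as_bounded_def)

section \<open>Closed sets in the \<open>(\<epsilon>, \<lambda>)\<close>-topology\<close>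

text \<open>
  The probability that \<open>x\<close> and \<open>y\<close> are at least \<open>e\<close> apart; with \<open>e\<close> in the role of both \<open>\<epsilon>\<close> and \<open>\<lambda>\<close> it generates
  the topology.
\<close>

definition far :: "'e \<Rightarrow> 'e \<Rightarrow> real \<Rightarrow> real" where
  "far x y e = prob {w \<in> space M. e \<le> dst x y w}"

text \<open>
  Almost sure convergence.  It is stronger than convergence in probability, but the two have the same closed sets
  and limits become pointwise.
\<close>

definition tends :: "(nat \<Rightarrow> 'e) \<Rightarrow> 'e \<Rightarrow> bool" where
  "tends y x \<longleftrightarrow> (AE w in M. (\<lambda>k. dst (y k) x w) \<longlonglongrightarrow> 0)"

lemma nhd_iff:
  assumes "x \<in> carrier E" "y \<in> carrier E"
  shows "y \<ominus> x \<in> eps_lam_nhd M E e l \<longleftrightarrow> far y x e < l"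
proof -
  have c: "y \<ominus> x \<in> carrier E" using assms by simp
  have f: "measure M {w \<in> space M. f w < e} = 1 - far y x e" if "f \<in> rnorm E (y \<ominus> x)" for f
  proof -
    have f: "f \<in> borel_measurable M" "AE w in M. f w = nrm (y \<ominus> x) w"
      using that c by (simp_all add: rnorm_nrm(2) L0_class_mem)
    have "measure M {w \<in> space M. f w < e} = measure M {w \<in> space M. dst y x w < e}"
      using f assms by (intro finite_measure_eq_AE) (auto simp: dst_def elim: AE_mp)
    also have "{w \<in> space M. dst y x w < e} = space M - {w \<in> space M. e \<le> dst y x w}" by auto
    also have "prob \<dots> = 1 - far y x e" unfolding far_def using assms by (intro prob_compl) simp
    finally show ?thesis .
  qed
  have "nrm (y \<ominus> x) \<in> rnorm E (y \<ominus> x)" using c by (simp add: rnorm_nrm(2) L0_class_self)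
  then show ?thesis using c f unfolding eps_lam_nhd_def by auto
qed

lemma far_mono:
  assumes "x \<in> carrier E" "y \<in> carrier E" "e \<le> e'"
  shows "far x y e' \<le> far x y e"
  unfolding far_def using assms by (intro finite_measure_mono) auto

lemma far_triangle:
  assumes "x \<in> carrier E" "y \<in> carrier E" "z \<in> carrier E"
  shows "far x z (a + b) \<le> far x y a + far y z b"
proof -
  have "far x z (a + b) \<le> prob ({w \<in> space M. a \<le> dst x y w} \<union> {w \<in> space M. b \<le> dst y z w})"
    unfolding far_def
    by (rule finite_measure_mono_AE) (use dst_triangle[OF assms] assms in auto)
  also have "\<dots> \<le> far x y a + far y z b" unfolding far_def using assms by (intro measure_Un_le) auto
  finally show ?thesis .
qed

definition near :: "'e \<Rightarrow> 'e set \<Rightarrow> bool" where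
  "near x X \<longleftrightarrow> (\<forall>e>0. \<exists>y\<in>X. far y x e < e)"

lemma eps_lam_open_iff:
  "eps_lam_open M E U \<longleftrightarrow> U \<subseteq> carrier E \<and> (\<forall>x\<in>U. \<exists>e>0. \<forall>y\<in>carrier E. far y x e < e \<longrightarrow> y \<in> U)"
proof (cases "U \<subseteq> carrier E")
  case U: True
  have "(\<exists>e>0. \<exists>l. 0 < l \<and> l < 1 \<and> (\<forall>y\<in>carrier E. y \<ominus> x \<in> eps_lam_nhd M E e l \<longrightarrow> y \<in> U)) \<longleftrightarrow>
      (\<exists>e>0. \<forall>y\<in>carrier E. far y x e < e \<longrightarrow> y \<in> U)" if x: "x \<in> U" for x
  proof
    assume "\<exists>e>0. \<exists>l. 0 < l \<and> l < 1 \<and> (\<forall>y\<in>carrier E. y \<ominus> x \<in> eps_lam_nhd M E e l \<longrightarrow> y \<in> U)"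
    then obtain e l where el: "e > 0" "0 < l" "l < 1" "\<And>y. y \<in> carrier E \<Longrightarrow> far y x e < l \<Longrightarrow> y \<in> U"
      using nhd_iff[of x] x U by blast
    have "y \<in> U" if "y \<in> carrier E" "far y x (min e l) < min e l" for y
      using el(4)[OF that(1)] far_mono[of y x "min e l" e] that x U by auto
    then show "\<exists>e>0. \<forall>y\<in>carrier E. far y x e < e \<longrightarrow> y \<in> U" using el by (intro exI[of _ "min e l"]) auto
  next
    assume "\<exists>e>0. \<forall>y\<in>carrier E. far y x e < e \<longrightarrow> y \<in> U"
    then obtain e where e: "e > 0" "\<And>y. y \<in> carrier E \<Longrightarrow> far y x e < e \<Longrightarrow> y \<in> U" by blast
    show "\<exists>e>0. \<exists>l. 0 < l \<and> l < 1 \<and> (\<forall>y\<in>carrier E. y \<ominus> x \<in> eps_lam_nhd M E e l \<longrightarrow> y \<in> U)"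
    proof (intro exI conjI ballI impI)
      fix y assume y: "y \<in> carrier E" "y \<ominus> x \<in> eps_lam_nhd M E e (min e (1/2))"
      then have "far y x e < e" using nhd_iff[of x y] x U by auto
      then show "y \<in> U" using e y by blast
    qed (use e in auto)
  qed
  then show ?thesis unfolding eps_lam_open_def by (intro conj_cong ball_cong refl)
qed (simp add: eps_lam_open_def)

lemma istopology_eps_lam: "istopology (eps_lam_open M E)"
  unfolding istopology_def
proof (intro conjI allI impI)
  fix S T assume S: "eps_lam_open M E S" and T: "eps_lam_open M E T"
  show "eps_lam_open M E (S \<inter> T)" unfolding eps_lam_open_iff
  proof (intro conjI ballI)
    show "S \<inter> T \<subseteq> carrier E" using S by (auto simp: eps_lam_open_iff)
    fix x assume x: "x \<in> S \<inter> T"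
    then have xc: "x \<in> carrier E" using S by (auto simp: eps_lam_open_iff)
    obtain e where e: "e > 0" "\<And>y. y \<in> carrier E \<Longrightarrow> far y x e < e \<Longrightarrow> y \<in> S"
      using S x unfolding eps_lam_open_iff by blast
    obtain e' where e': "e' > 0" "\<And>y. y \<in> carrier E \<Longrightarrow> far y x e' < e' \<Longrightarrow> y \<in> T"
      using T x unfolding eps_lam_open_iff by blast
    have "y \<in> S \<inter> T" if y: "y \<in> carrier E" "far y x (min e e') < min e e'" for y
    proof
      have "far y x e < e" using far_mono[OF y(1) xc, of "min e e'" e] y(2) by linarith
      then show "y \<in> S" by (rule e(2)[OF y(1)])
      have "far y x e' < e'" using far_mono[OF y(1) xc, of "min e e'" e'] y(2) by linarith
      then show "y \<in> T" by (rule e'(2)[OF y(1)])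
    qed
    then show "\<exists>e>0. \<forall>y\<in>carrier E. far y x e < e \<longrightarrow> y \<in> S \<inter> T"
      using e e' by (intro exI[of _ "min e e'"]) auto
  qed
next
  fix \<K> assume K: "\<forall>K\<in>\<K>. eps_lam_open M E K"
  show "eps_lam_open M E (\<Union>\<K>)" unfolding eps_lam_open_iff
  proof (intro conjI ballI)
    show "\<Union>\<K> \<subseteq> carrier E" using K by (auto simp: eps_lam_open_iff)
    fix x assume "x \<in> \<Union>\<K>"
    then obtain K' where K': "K' \<in> \<K>" "x \<in> K'" by blast
    then have "eps_lam_open M E K'" using K by blast
    then obtain e where "e > 0" "\<And>y. y \<in> carrier E \<Longrightarrow> far y x e < e \<Longrightarrow> y \<in> K'"
      using K'(2) unfolding eps_lam_open_iff by blast
    then show "\<exists>e>0. \<forall>y\<in>carrier E. far y x e < e \<longrightarrow> y \<in> \<Union>\<K>" using K' by blast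
  qed
qed

lemma openin_eps_lam: "openin (eps_lam_topology M E) = eps_lam_open M E"
  unfolding eps_lam_topology_def using istopology_eps_lam by (rule topology_inverse')

lemma topspace_eps_lam: "topspace (eps_lam_topology M E) = carrier E"
proof
  show "topspace (eps_lam_topology M E) \<subseteq> carrier E"
    unfolding topspace_def openin_eps_lam by (auto simp: eps_lam_open_iff)
  have "openin (eps_lam_topology M E) (carrier E)"
    unfolding openin_eps_lam eps_lam_open_iff by (auto intro: exI[of _ 1])
  then show "carrier E \<subseteq> topspace (eps_lam_topology M E)" by (rule openin_subset)
qed

lemma closed_iff_near:
  "eps_lam_closed M E X \<longleftrightarrow> X \<subseteq> carrier E \<and> (\<forall>x\<in>carrier E. near x X \<longrightarrow> x \<in> X)"
proof (cases "X \<subseteq> carrier E")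
  case X: True
  have "eps_lam_open M E (carrier E - X) \<longleftrightarrow> (\<forall>x\<in>carrier E. near x X \<longrightarrow> x \<in> X)"
    unfolding eps_lam_open_iff near_def using X by (auto; blast)
  then show ?thesis using X by (simp add: closedin_def topspace_eps_lam openin_eps_lam)
qed (simp add: closedin_def topspace_eps_lam)

lemma near_near:
  assumes "X \<subseteq> carrier E" "x \<in> carrier E" "near x {y \<in> carrier E. near y X}"
  shows "near x X"
  unfolding near_def
proof (intro allI impI)
  fix e :: real assume e: "e > 0"
  obtain y where y: "y \<in> carrier E" "near y X" "far y x (e/2) < e/2"
    using assms(3) e unfolding near_def[of x] by (auto dest: spec[of _ "e/2"])
  obtain z where z: "z \<in> X" "far z y (e/2) < e/2"
    using y(2) e unfolding near_def by (auto dest: spec[of _ "e/2"])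
  have "far z x (e/2 + e/2) \<le> far z y (e/2) + far y x (e/2)"
    using z y assms by (intro far_triangle) auto
  then show "\<exists>y\<in>X. far y x e < e" using z y by (intro bexI[of _ z]) auto
qed

text \<open>
  The set on the right is closed by the triangle inequality, contains \<open>X\<close>, and lies in every closed superset.
\<close>

lemma closure_iff_near:
  assumes "X \<subseteq> carrier E"
  shows "eps_lam_topology M E closure_of X = {x \<in> carrier E. near x X}"
proof
  have "near x X" if "x \<in> X" for x
  proof -
    have "far x x e < e" if "e > 0" for e
    proof -
      have xc: "x \<in> carrier E" using assms \<open>x \<in> X\<close> by auto
      have "AE w in M. \<not> e \<le> dst x x w" using dst_self[OF xc] by eventually_elim (use that in simp)
      then have "far x x e = prob {}" unfolding far_def
        using xc by (intro finite_measure_eq_AE) auto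
      then show ?thesis using that by simp
    qed
    then show ?thesis using that unfolding near_def by blast
  qed
  moreover have "eps_lam_closed M E {x \<in> carrier E. near x X}"
    unfolding closed_iff_near using near_near[OF assms] by auto
  ultimately show "eps_lam_topology M E closure_of X \<subseteq> {x \<in> carrier E. near x X}"
    using assms by (intro closure_of_minimal) auto
  have "eps_lam_closed M E (eps_lam_topology M E closure_of X)" by simp
  moreover have "X \<subseteq> eps_lam_topology M E closure_of X"
    using assms by (intro closure_of_subset) (simp add: topspace_eps_lam)
  ultimately show "{x \<in> carrier E. near x X} \<subseteq> eps_lam_topology M E closure_of X"
    unfolding closed_iff_near near_def by blast
qed

text \<open>
  From approximations with errors \<open>2\<^sup>-\<^sup>k\<close> the Borel--Cantelli lemma gives almost sure convergence; conversely,
  the events where some later distance is at least \<open>e\<close> decrease to a null set.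
\<close>

lemma near_iff_seq:
  assumes "X \<subseteq> carrier E" "x \<in> carrier E"
  shows "near x X \<longleftrightarrow> (\<exists>y. range y \<subseteq> X \<and> tends y x)"
proof
  assume near: "near x X"
  have "\<forall>k::nat. \<exists>y. y \<in> X \<and> far y x ((1/2)^k) < (1/2)^k"
  proof
    fix k :: nat
    have "(0::real) < (1/2)^k" by simp
    then show "\<exists>y. y \<in> X \<and> far y x ((1/2)^k) < (1/2)^k" using near unfolding near_def by blast
  qed
  from choice[OF this] obtain y where y0: "\<forall>k. y k \<in> X \<and> far (y k) x ((1/2)^k) < (1/2)^k" by (elim exE)
  have y: "y k \<in> X" "far (y k) x ((1/2)^k) < (1/2)^k" for k using y0 by simp_all
  have yc: "y k \<in> carrier E" for k using y(1) assms by auto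
  let ?A = "\<lambda>k. {w \<in> space M. (1/2)^k \<le> dst (y k) x w}"
  have "summable (\<lambda>k. prob (?A k))"
  proof (rule summable_comparison_test)
    show "\<exists>N. \<forall>n\<ge>N. norm (prob (?A n)) \<le> (1/2)^n"
      using y(2) by (intro exI[of _ 0]) (auto simp: far_def less_imp_le)
    show "summable (\<lambda>n. (1/2::real)^n)" by (rule summable_geometric) simp
  qed
  then have "AE w in M. eventually (\<lambda>k. w \<in> space M - ?A k) sequentially"
    using yc assms by (intro borel_cantelli_AE1) (auto simp: emeasure_eq_measure)
  then have "tends y x" unfolding tends_def
  proof eventually_elim
    case (elim w)
    have "(\<lambda>k. (1/2::real)^k) \<longlonglongrightarrow> 0" by (rule LIMSEQ_realpow_zero) auto
    moreover have "eventually (\<lambda>k. dst (y k) x w \<le> (1/2)^k) sequentially"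
      using elim by eventually_elim auto
    ultimately show ?case
      by (intro tendsto_sandwich[of "\<lambda>_. 0" "\<lambda>k. dst (y k) x w" sequentially "\<lambda>k. (1/2)^k" 0]) auto
  qed
  then show "\<exists>y. range y \<subseteq> X \<and> tends y x" using y(1) by blast
next
  assume "\<exists>y. range y \<subseteq> X \<and> tends y x"
  then obtain y where y: "range y \<subseteq> X" "tends y x" by blast
  have yc: "y k \<in> carrier E" for k using y(1) assms by auto
  show "near x X" unfolding near_def
  proof (intro allI impI)
    fix e :: real assume e: "e > 0"
    define A where "A k = (\<Union>j\<in>{k..}. {w \<in> space M. e \<le> dst (y j) x w})" for k
    have A: "A k \<in> events" for k unfolding A_def using yc assms by (intro sets.countable_UN') auto
    have "decseq A" unfolding decseq_def A_def by fastforce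
    then have lim: "(\<lambda>k. prob (A k)) \<longlonglongrightarrow> prob (\<Inter>k. A k)"
      using A by (intro finite_Lim_measure_decseq) auto
    have "AE w in M. w \<notin> (\<Inter>k. A k)"
      using y(2) unfolding tends_def
    proof eventually_elim
      case (elim w)
      then have "eventually (\<lambda>k. dst (y k) x w < e) sequentially" using e by (rule order_tendstoD)
      then obtain N where "\<And>k. k \<ge> N \<Longrightarrow> dst (y k) x w < e" by (auto simp: eventually_sequentially)
      then have "w \<notin> A N" unfolding A_def by force
      then show ?case by blast
    qed
    then have "prob (\<Inter>k. A k) = 0" using A prob_eq_0[of "\<Inter>k. A k"] by auto
    then have "eventually (\<lambda>k. prob (A k) < e) sequentially" using lim e by (intro order_tendstoD) auto
    then obtain k where k: "prob (A k) < e" by (auto simp: eventually_sequentially)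
    have "far (y k) x e \<le> prob (A k)" unfolding far_def by (rule finite_measure_mono[OF _ A]) (auto simp: A_def)
    then show "\<exists>y\<in>X. far y x e < e" using k y(1) by (intro bexI[of _ "y k"]) auto
  qed
qed

lemma closure_iff_seq:
  assumes "X \<subseteq> carrier E"
  shows "x \<in> eps_lam_topology M E closure_of X \<longleftrightarrow> x \<in> carrier E \<and> (\<exists>y. range y \<subseteq> X \<and> tends y x)"
  using closure_iff_near[OF assms] near_iff_seq[OF assms] by auto

section \<open>Closed convex sets\<close>

definition ccl :: "'e set \<Rightarrow> bool" where
  "ccl X \<longleftrightarrow> eps_lam_closed M E X \<and> L0_convex M E X"

lemma ccl_iff:
  "ccl X \<longleftrightarrow> X \<subseteq> carrier E \<and> (\<forall>x\<in>carrier E. \<forall>y. range y \<subseteq> X \<and> tends y x \<longrightarrow> x \<in> X) \<and>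
     (\<forall>x\<in>X. \<forall>y\<in>X. \<forall>f\<in>borel_measurable M. (AE w in M. 0 \<le> f w \<and> f w \<le> 1) \<longrightarrow> conv f x y \<in> X)"
proof (cases "X \<subseteq> carrier E")
  case X: True
  have "eps_lam_closed M E X \<longleftrightarrow> (\<forall>x\<in>carrier E. \<forall>y. range y \<subseteq> X \<and> tends y x \<longrightarrow> x \<in> X)"
    using closed_iff_near[of X] near_iff_seq[OF X] X by blast
  then show ?thesis using X L0_convex_iff[OF X] by (simp add: ccl_def)
qed (auto simp: ccl_def closed_iff_near)

lemma cclI:
  assumes "X \<subseteq> carrier E"
    and "\<And>x y. x \<in> carrier E \<Longrightarrow> (\<And>k. y k \<in> X) \<Longrightarrow> tends y x \<Longrightarrow> x \<in> X"
    and "\<And>x y f. x \<in> X \<Longrightarrow> y \<in> X \<Longrightarrow> f \<in> borel_measurable M \<Longrightarrow> AE w in M. 0 \<le> f w \<and> f w \<le> 1 \<Longrightarrow> conv f x y \<in> X"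
  shows "ccl X"
  unfolding ccl_iff
proof (intro conjI ballI allI impI)
  fix x y assume "x \<in> carrier E" "range y \<subseteq> X \<and> tends y x"
  then show "x \<in> X" by (intro assms(2)[of x y]) auto
qed (use assms in auto)

lemma ccl_sub: "ccl X \<Longrightarrow> X \<subseteq> carrier E" by (simp add: ccl_iff)

lemma ccl_conv:
  "ccl X \<Longrightarrow> x \<in> X \<Longrightarrow> y \<in> X \<Longrightarrow> f \<in> borel_measurable M \<Longrightarrow> AE w in M. 0 \<le> f w \<and> f w \<le> 1 \<Longrightarrow> conv f x y \<in> X"
  by (simp add: ccl_iff)

lemma ccl_patch: "ccl X \<Longrightarrow> x \<in> X \<Longrightarrow> y \<in> X \<Longrightarrow> A \<in> events \<Longrightarrow> patch A x y \<in> X"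
  unfolding patch_def by (rule ccl_conv) (auto simp: indicator_def)

lemma ccl_limit: "ccl X \<Longrightarrow> x \<in> carrier E \<Longrightarrow> (\<And>k. y k \<in> X) \<Longrightarrow> tends y x \<Longrightarrow> x \<in> X"
  unfolding ccl_iff by (metis image_subsetI)

lemma ccl_Inter:
  assumes ne: "\<X> \<noteq> {}" and ccl: "\<And>X. X \<in> \<X> \<Longrightarrow> ccl X"
  shows "ccl (\<Inter>\<X>)"
proof (rule cclI)
  show "\<Inter>\<X> \<subseteq> carrier E" using ne ccl_sub[OF ccl] by blast
next
  fix x y assume x: "x \<in> carrier E" "\<And>k. y k \<in> \<Inter>\<X>" "tends y x"
  show "x \<in> \<Inter>\<X>"
  proof (rule InterI)
    fix X assume "X \<in> \<X>"
    then show "x \<in> X" using x(2) by (intro ccl_limit[OF ccl x(1) _ x(3)]) auto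
  qed
next
  fix x y and f :: "'w \<Rightarrow> real" assume "x \<in> \<Inter>\<X>" "y \<in> \<Inter>\<X>" "f \<in> borel_measurable M" "AE w in M. 0 \<le> f w \<and> f w \<le> 1"
  then show "conv f x y \<in> \<Inter>\<X>" by (blast intro: ccl_conv[OF ccl])
qed

lemma ccl_Int:
  assumes "ccl X" "ccl Y"
  shows "ccl (X \<inter> Y)"
proof -
  have "ccl (\<Inter>{X, Y})" by (rule ccl_Inter) (use assms in blast)+
  then show ?thesis by simp
qed

lemma ccl_All:
  assumes "ccl X" "\<And>i. i \<in> I \<Longrightarrow> ccl {x \<in> carrier E. P i x}"
  shows "ccl {x \<in> X. \<forall>i\<in>I. P i x}"
proof -
  have "{x \<in> X. \<forall>i\<in>I. P i x} = \<Inter>(insert X ((\<lambda>i. {x \<in> carrier E. P i x}) ` I))"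
    using ccl_sub[OF assms(1)] by auto
  moreover have "ccl \<dots>" using assms by (intro ccl_Inter) auto
  ultimately show ?thesis by simp
qed

lemma null_squeeze:
  fixes a b :: "nat \<Rightarrow> real"
  assumes "\<forall>k. a k \<le> b k" "\<And>k. 0 \<le> a k" "b \<longlonglongrightarrow> 0"
  shows "a \<longlonglongrightarrow> 0"
  by (rule tendsto_sandwich[of "\<lambda>_. 0" a sequentially b 0])
     (simp_all add: assms always_eventually)

lemma tends_dst:
  assumes "\<And>k. y k \<in> carrier E" "x \<in> carrier E" "z \<in> carrier E" "tends y x"
  shows "AE w in M. (\<lambda>k. dst (y k) z w) \<longlonglongrightarrow> dst x z w"
proof -
  have "AE w in M. \<forall>k. dst (y k) z w \<le> dst (y k) x w + dst x z w"
    unfolding AE_all_countable using dst_triangle assms by blast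
  moreover have "AE w in M. \<forall>k. dst x z w \<le> dst x (y k) w + dst (y k) z w"
    unfolding AE_all_countable using dst_triangle assms by blast
  moreover have "AE w in M. \<forall>k. dst x (y k) w = dst (y k) x w"
    unfolding AE_all_countable using dst_sym assms by blast
  ultimately show ?thesis using assms(4) unfolding tends_def
  proof eventually_elim
    case (elim w)
    have "\<forall>k. norm (dst (y k) z w - dst x z w) \<le> dst (y k) x w"
    proof
      fix k show "norm (dst (y k) z w - dst x z w) \<le> dst (y k) x w"
        using spec[OF elim(1), of k] spec[OF elim(2), of k] spec[OF elim(3), of k]
        unfolding real_norm_def by linarith
    qed
    from Lim_null_comparison[OF always_eventually[OF this] elim(4)]
    have "(\<lambda>k. dst (y k) z w - dst x z w) \<longlonglongrightarrow> 0" .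
    then show ?case by (simp add: LIM_zero_iff)
  qed
qed

lemma tends_squeeze:
  assumes "tends y x" "\<And>k. AE w in M. dst (y' k) x' w \<le> g w * dst (y k) x w"
  shows "tends y' x'"
proof -
  have "AE w in M. \<forall>k. dst (y' k) x' w \<le> g w * dst (y k) x w" using assms(2) by (simp add: AE_all_countable)
  then show ?thesis using assms(1) unfolding tends_def
  proof eventually_elim
    case (elim w)
    have "(\<lambda>k. g w * dst (y k) x w) \<longlonglongrightarrow> 0" using tendsto_mult_right_zero[OF elim(2)] .
    then show ?case by (rule null_squeeze[OF elim(1) dst_nonneg])
  qed
qed

lemma tends_conv:
  assumes "f \<in> borel_measurable M" "\<And>k. x k \<in> carrier E" "\<And>k. y k \<in> carrier E" "a \<in> carrier E" "b \<in> carrier E"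
    "tends x a" "tends y b"
  shows "tends (\<lambda>k. conv f (x k) (y k)) (conv f a b)"
proof -
  have "AE w in M. \<forall>k. dst (conv f (x k) (y k)) (conv f a b) w \<le> \<bar>f w\<bar> * dst (x k) a w + \<bar>1 - f w\<bar> * dst (y k) b w"
    unfolding AE_all_countable using assms by (intro allI dst_conv_conv) auto
  then show ?thesis using assms(6,7) unfolding tends_def
  proof eventually_elim
    case (elim w)
    have "(\<lambda>k. \<bar>f w\<bar> * dst (x k) a w + \<bar>1 - f w\<bar> * dst (y k) b w) \<longlonglongrightarrow> 0"
      using tendsto_add[OF tendsto_mult_right_zero[OF elim(2)] tendsto_mult_right_zero[OF elim(3)]] by simp
    then show ?case by (rule null_squeeze[OF elim(1) dst_nonneg])
  qed
qed

lemma ccl_dst_le: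
  assumes z: "z \<in> carrier E"
  shows "ccl {x \<in> carrier E. AE w\<in>A in M. dst x z w \<le> \<phi> w}"
proof (rule cclI)
  fix x y assume x: "x \<in> carrier E" and y: "\<And>k::nat. y k \<in> {x \<in> carrier E. AE w\<in>A in M. dst x z w \<le> \<phi> w}" and t: "tends y x"
  have "AE w in M. \<forall>k. w \<in> A \<longrightarrow> dst (y k) z w \<le> \<phi> w"
    unfolding AE_all_countable using y by blast
  moreover have "AE w in M. (\<lambda>k. dst (y k) z w) \<longlonglongrightarrow> dst x z w" using y x t z by (intro tends_dst) auto
  ultimately have "AE w\<in>A in M. dst x z w \<le> \<phi> w"
    by eventually_elim (auto intro: LIMSEQ_le_const2)
  then show "x \<in> {x \<in> carrier E. AE w\<in>A in M. dst x z w \<le> \<phi> w}" using x by simp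
next
  fix x y and f :: "'w \<Rightarrow> real" assume x: "x \<in> {x \<in> carrier E. AE w\<in>A in M. dst x z w \<le> \<phi> w}"
    and y: "y \<in> {x \<in> carrier E. AE w\<in>A in M. dst x z w \<le> \<phi> w}" and f: "f \<in> borel_measurable M" "AE w in M. 0 \<le> f w \<and> f w \<le> 1"
  have "AE w in M. dst (conv f x y) z w \<le> \<bar>f w\<bar> * dst x z w + \<bar>1 - f w\<bar> * dst y z w"
    using x y f z by (intro dst_conv) auto
  moreover have "AE w\<in>A in M. dst x z w \<le> \<phi> w" "AE w\<in>A in M. dst y z w \<le> \<phi> w" using x y by auto
  ultimately have "AE w\<in>A in M. dst (conv f x y) z w \<le> \<phi> w" using f(2)
  proof eventually_elim
    case (elim w)
    show ?case
    proof
      assume "w \<in> A"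
      then have "\<bar>f w\<bar> * dst x z w + \<bar>1 - f w\<bar> * dst y z w \<le> f w * \<phi> w + (1 - f w) * \<phi> w"
        using elim by (intro add_mono) (auto intro: mult_left_mono)
      then show "dst (conv f x y) z w \<le> \<phi> w" using elim by (simp add: algebra_simps)
    qed
  qed
  then show "conv f x y \<in> {x \<in> carrier E. AE w\<in>A in M. dst x z w \<le> \<phi> w}" using x y f by simp
qed simp

lemma dst_affine:
  assumes "f \<in> borel_measurable M" "x \<in> carrier E" "y \<in> carrier E" "v \<in> carrier E"
  shows "AE w in M. dst (rsm f x \<oplus> v) (rsm f y \<oplus> v) w = \<bar>f w\<bar> * dst x y w"
proof -
  have "(rsm f x \<oplus> v) \<ominus> (rsm f y \<oplus> v) = rsm f (x \<ominus> y)"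
    by (insert assms, rule_tac is_lc_eq[of x y v v], (rule is_lc_intros | (simp add: algebra_simps; fail))+)
  then show ?thesis using nrm_rsm[of f "x \<ominus> y"] assms by (simp add: dst_def)
qed

text \<open>
  Translations and scalings are continuous and respect convex combinations.
\<close>

lemma ccl_affine_preimage:
  assumes X: "ccl X" and f: "f \<in> borel_measurable M" and v: "v \<in> carrier E"
  shows "ccl {x \<in> carrier E. rsm f x \<oplus> v \<in> X}"
proof (rule cclI)
  fix x y assume x: "x \<in> carrier E" and y: "\<And>k::nat. y k \<in> {x \<in> carrier E. rsm f x \<oplus> v \<in> X}" and t: "tends y x"
  have "tends (\<lambda>k. rsm f (y k) \<oplus> v) (rsm f x \<oplus> v)"
  proof (rule tends_squeeze[OF t, of _ _ "\<lambda>w. \<bar>f w\<bar>"])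
    fix k show "AE w in M. dst (rsm f (y k) \<oplus> v) (rsm f x \<oplus> v) w \<le> \<bar>f w\<bar> * dst (y k) x w"
      using dst_affine[OF f _ x v, of "y k"] y by auto
  qed
  moreover have "rsm f x \<oplus> v \<in> carrier E" using x f v by simp
  moreover have "rsm f (y k) \<oplus> v \<in> X" for k using y[of k] by simp
  ultimately have "rsm f x \<oplus> v \<in> X"
    using ccl_limit[OF X, of "rsm f x \<oplus> v" "\<lambda>k. rsm f (y k) \<oplus> v"] by simp
  then show "x \<in> {x \<in> carrier E. rsm f x \<oplus> v \<in> X}" using x by simp
next
  fix x y and g :: "'w \<Rightarrow> real" assume x: "x \<in> {x \<in> carrier E. rsm f x \<oplus> v \<in> X}" and y: "y \<in> {x \<in> carrier E. rsm f x \<oplus> v \<in> X}"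
    and g: "g \<in> borel_measurable M" "AE w in M. 0 \<le> g w \<and> g w \<le> 1"
  have xy: "x \<in> carrier E" "y \<in> carrier E" using x y by auto
  have eq: "rsm f (conv g x y) \<oplus> v = conv g (rsm f x \<oplus> v) (rsm f y \<oplus> v)"
    by (insert f v g xy, rule_tac is_lc_eq[of x y v v], (rule is_lc_intros | (simp add: algebra_simps; fail))+)
  show "conv g x y \<in> {x \<in> carrier E. rsm f x \<oplus> v \<in> X}"
    using x y g unfolding mem_Collect_eq eq by (auto intro: ccl_conv[OF X])
qed simp

lemma closure_ccl:
  assumes X: "X \<subseteq> carrier E"
    and conv: "\<And>x y f. x \<in> X \<Longrightarrow> y \<in> X \<Longrightarrow> f \<in> borel_measurable M \<Longrightarrow> AE w in M. 0 \<le> f w \<and> f w \<le> 1 \<Longrightarrow> conv f x y \<in> X"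
  shows "ccl (eps_lam_topology M E closure_of X)"
proof -
  let ?C = "eps_lam_topology M E closure_of X"
  have sub: "?C \<subseteq> carrier E" using closure_iff_seq[OF X] by blast
  have "L0_convex M E ?C" unfolding L0_convex_iff[OF sub]
  proof (intro ballI impI)
    fix x y and f :: "'w \<Rightarrow> real" assume x: "x \<in> ?C" and y: "y \<in> ?C" and f: "f \<in> borel_measurable M" "AE w in M. 0 \<le> f w \<and> f w \<le> 1"
    obtain x' where x': "range x' \<subseteq> X" "tends x' x" "x \<in> carrier E" using x closure_iff_seq[OF X] by blast
    obtain y' where y': "range y' \<subseteq> X" "tends y' y" "y \<in> carrier E" using y closure_iff_seq[OF X] by blast
    have "tends (\<lambda>k. conv f (x' k) (y' k)) (conv f x y)" using x' y' f X by (intro tends_conv) auto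
    moreover have "range (\<lambda>k. conv f (x' k) (y' k)) \<subseteq> X"
      using x'(1) y'(1) f by (auto simp: image_subset_iff intro!: conv)
    ultimately show "conv f x y \<in> ?C" using closure_iff_seq[OF X] x' y' f by blast
  qed
  then show ?thesis by (simp add: ccl_def)
qed

lemma closure_subset: "X \<subseteq> carrier E \<Longrightarrow> X \<subseteq> eps_lam_topology M E closure_of X"
  by (intro closure_of_subset) (simp add: topspace_eps_lam)

section \<open>Nested compactness and gluing\<close>

text \<open>
  Convex compactness for decreasing sequences.  This form passes at once to closed convex subsets and to translates.
\<close>

definition nested_compact :: "'e set \<Rightarrow> bool" where
  "nested_compact G \<longleftrightarrow> ccl G \<and> (\<forall>H::nat \<Rightarrow> 'e set. (\<forall>n. ccl (H n) \<and> H n \<noteq> {} \<and> H n \<subseteq> G \<and> H (Suc n) \<subseteq> H n) \<longrightarrow> (\<Inter>n. H n) \<noteq> {})"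

lemma convexly_compact_nested_compact:
  assumes "L0_convexly_compact M E G"
  shows "nested_compact G"
  unfolding nested_compact_def
proof (intro conjI allI impI)
  show "ccl G" using assms by (simp add: L0_convexly_compact_def ccl_def)
  fix H :: "nat \<Rightarrow> 'e set" assume H: "\<forall>n. ccl (H n) \<and> H n \<noteq> {} \<and> H n \<subseteq> G \<and> H (Suc n) \<subseteq> H n"
  have dec: "H n \<subseteq> H m" if "m \<le> n" for m n using H by (intro lift_Suc_antimono_le[OF _ that]) blast
  have fip: "\<forall>\<F>\<subseteq>range H. finite \<F> \<and> \<F> \<noteq> {} \<longrightarrow> \<Inter>\<F> \<noteq> {}"
  proof (intro allI impI)
    fix \<F> assume F: "\<F> \<subseteq> range H" "finite \<F> \<and> \<F> \<noteq> {}"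
    then obtain I where I: "finite I" "\<F> = H ` I" using finite_subset_image[of \<F> H UNIV] by auto
    have "H (Max I) \<subseteq> H i" if "i \<in> I" for i by (rule dec[OF Max_ge[OF I(1) that]])
    then have "H (Max I) \<subseteq> \<Inter>\<F>" unfolding I(2) by blast
    then show "\<Inter>\<F> \<noteq> {}" using H by blast
  qed
  have "range H \<noteq> {} \<and> (\<forall>X\<in>range H. X \<subseteq> G \<and> eps_lam_closed M E X \<and> L0_convex M E X)"
    using H by (auto simp: ccl_def)
  then show "(\<Inter>n. H n) \<noteq> {}" using assms fip unfolding L0_convexly_compact_def by blast
qed

lemma nested_compact_meet:
  assumes "nested_compact G" "\<And>n::nat. ccl (H n)" "\<And>n. H n \<noteq> {}" "\<And>n. H n \<subseteq> G" "\<And>n. H (Suc n) \<subseteq> H n"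
  obtains p where "\<And>n. p \<in> H n"
proof -
  have "(\<Inter>n. H n) \<noteq> {}" using assms unfolding nested_compact_def by blast
  then show thesis using that by blast
qed

lemma nested_compact_ccl: "nested_compact G \<Longrightarrow> ccl G" by (simp add: nested_compact_def)

lemma nested_compact_subset:
  assumes "nested_compact G" "ccl X" "X \<subseteq> G"
  shows "nested_compact X"
  unfolding nested_compact_def
proof (intro conjI allI impI)
  fix H :: "nat \<Rightarrow> 'e set" assume H: "\<forall>n. ccl (H n) \<and> H n \<noteq> {} \<and> H n \<subseteq> X \<and> H (Suc n) \<subseteq> H n"
  then have "H n \<subseteq> G" for n using assms(3) by (meson order_trans)
  with H show "(\<Inter>n. H n) \<noteq> {}" using assms(1) unfolding nested_compact_def by simp
qed (rule assms(2))

lemma sigma_stable_iff: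
  "sigma_stable M E X \<longleftrightarrow> X \<noteq> {} \<and> X \<subseteq> carrier E \<and>
    (\<forall>x A. range x \<subseteq> X \<and> meas_partition M A \<longrightarrow> (\<exists>y\<in>X. \<forall>n. AE w\<in>A n in M. dst y (x n) w = 0))"
proof (cases "X \<subseteq> carrier E")
  case X: True
  have "(\<forall>n. L0_ind M (A n) \<odot> y = L0_ind M (A n) \<odot> x n) \<longleftrightarrow> (\<forall>n. AE w\<in>A n in M. dst y (x n) w = 0)"
    if "range x \<subseteq> X" "meas_partition M A" "y \<in> X" for x A y
    using that X by (intro all_cong1 ind_smult_eq_iff) (auto simp: meas_partition_def)
  then have "(range x \<subseteq> X \<and> meas_partition M A \<longrightarrow> (\<exists>y\<in>X. \<forall>n. L0_ind M (A n) \<odot> y = L0_ind M (A n) \<odot> x n)) \<longleftrightarrow>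
      (range x \<subseteq> X \<and> meas_partition M A \<longrightarrow> (\<exists>y\<in>X. \<forall>n. AE w\<in>A n in M. dst y (x n) w = 0))" for x A
    by (intro imp_cong bex_cong refl) auto
  then show ?thesis unfolding sigma_stable_def by (intro conj_cong refl all_cong1)
qed (simp add: sigma_stable_def)

text \<open>
  The points that agree with \<open>x\<^sub>0, \<dots>, x\<^sub>n\<close> on \<open>A\<^sub>0, \<dots>, A\<^sub>n\<close> form decreasing closed convex sets, non-empty by
  finitely many patches; a common point is the required countable gluing.
\<close>

lemma nested_compact_sigma_stable:
  assumes G: "nested_compact X" and ne: "X \<noteq> {}"
  shows "sigma_stable M E X"
  unfolding sigma_stable_iff
proof (intro conjI allI impI)
  have X: "ccl X" by (rule nested_compact_ccl[OF G])
  show sub: "X \<subseteq> carrier E" by (rule ccl_sub[OF X])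
  fix x :: "nat \<Rightarrow> 'e" and A :: "nat \<Rightarrow> 'w set"
  assume asm: "range x \<subseteq> X \<and> meas_partition M A"
  then have x: "x n \<in> X" and xc: "x n \<in> carrier E" and A: "A n \<in> events" for n
    using sub by (auto simp: meas_partition_def)
  have disj: "A i \<inter> A j = {}" if "i \<noteq> j" for i j
    using asm that by (auto simp: meas_partition_def disjoint_family_on_def)
  define H where "H n = {z \<in> X. \<forall>k\<in>{..n}. AE w\<in>A k in M. dst z (x k) w \<le> 0}" for n
  have "ccl (H n)" for n unfolding H_def using xc by (intro ccl_All[OF X] ccl_dst_le)
  moreover have "H n \<noteq> {}" for n
  proof (induction n)
    case 0
    have "x 0 \<in> H 0" unfolding H_def using x dst_self[OF xc[of 0]] by auto
    then show ?case by blast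
  next
    case (Suc n)
    then obtain z where z: "z \<in> X" "\<And>k. k \<le> n \<Longrightarrow> AE w\<in>A k in M. dst z (x k) w \<le> 0"
      unfolding H_def by auto
    let ?p = "patch (A (Suc n)) (x (Suc n)) z"
    have pX: "?p \<in> X" using X x z A by (intro ccl_patch)
    have zc: "z \<in> carrier E" and pc: "?p \<in> carrier E" using z pX sub by auto
    note pd = patch_dst[OF A[of "Suc n"] xc[of "Suc n"] zc]
    have "AE w\<in>A k in M. dst ?p (x k) w \<le> 0" if k: "k \<le> Suc n" for k
    proof (cases "k = Suc n")
      case True then show ?thesis using pd by auto
    next
      case False
      then have kn: "k \<le> n" using k by simp
      have d: "w \<notin> A (Suc n)" if "w \<in> A k" for w using disj[of k "Suc n"] False that by auto
      show ?thesis using pd z(2)[OF kn] dst_triangle[OF pc zc xc[of k]]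
        by eventually_elim (use d in auto)
    qed
    then have "?p \<in> H (Suc n)" using pX unfolding H_def by auto
    then show ?case by blast
  qed
  moreover have "H n \<subseteq> X" "H (Suc n) \<subseteq> H n" for n unfolding H_def by auto
  ultimately obtain p where p: "\<And>n. p \<in> H n" using nested_compact_meet[OF G, of H] by blast
  have "AE w\<in>A n in M. dst p (x n) w = 0" for n
  proof -
    have "AE w\<in>A n in M. dst p (x n) w \<le> 0" using p[of n] unfolding H_def by auto
    then show ?thesis by eventually_elim (use dst_nonneg in \<open>auto intro: antisym\<close>)
  qed
  moreover have "p \<in> X" using p[of 0] by (simp add: H_def)
  ultimately show "\<exists>y\<in>X. \<forall>n. AE w\<in>A n in M. dst y (x n) w = 0" by blast
qed (rule ne)

text \<open>
  Make the events disjoint and add the uncovered remainder to the first one.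
\<close>

lemma ex_partition:
  assumes Be: "\<And>n::nat. B n \<in> events"
  shows "\<exists>A. meas_partition M A \<and> (\<forall>n. A n \<inter> (\<Union>k. B k) \<subseteq> B n)"
proof -
  define A where "A n = disjointed B n \<union> (if n = 0 then space M - (\<Union>n. B n) else {})" for n
  have "disjoint_family A" unfolding disjoint_family_on_def
  proof (intro ballI impI)
    fix m n :: nat assume "m \<noteq> n"
    then have "disjointed B m \<inter> disjointed B n = {}"
      using disjoint_family_disjointed[of B] by (auto simp: disjoint_family_on_def)
    moreover have "disjointed B k \<inter> (space M - (\<Union>n. B n)) = {}" for k
      using disjointed_subset[of B k] by blast
    ultimately show "A m \<inter> A n = {}" using \<open>m \<noteq> n\<close> unfolding A_def
      by (cases "m = 0"; cases "n = 0") (simp_all add: Int_Un_distrib Int_Un_distrib2 Int_commute del: disjointed_0)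
  qed
  moreover have "range A \<subseteq> events"
  proof -
    have "range (disjointed B) \<subseteq> events" using Be by (intro sets.range_disjointed_sets) auto
    moreover have "space M - (\<Union>n. B n) \<in> events" using Be by auto
    ultimately show ?thesis unfolding A_def by (auto simp del: disjointed_0)
  qed
  moreover have "(\<Union>n. A n) = space M"
  proof
    show "(\<Union>n. A n) \<subseteq> space M" using calculation(2) sets.sets_into_space by blast
    show "space M \<subseteq> (\<Union>n. A n)"
    proof
      fix w assume w: "w \<in> space M"
      show "w \<in> (\<Union>n. A n)"
      proof (cases "w \<in> (\<Union>n. B n)")
        case True
        then have "w \<in> (\<Union>n. disjointed B n)" by (simp add: UN_disjointed_eq)
        then show ?thesis unfolding A_def by blast
      next
        case False then have "w \<in> A 0" using w by (simp add: A_def) then show ?thesis by blast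
      qed
    qed
  qed
  ultimately have "meas_partition M A" by (simp add: meas_partition_def)
  moreover have "A n \<inter> (\<Union>k. B k) \<subseteq> B n" for n
    using disjointed_subset[of B n] unfolding A_def by auto
  ultimately show ?thesis by blast
qed

text \<open>
  Countably many of the events \<open>(Q x)\<close> cover all of them up to null sets; glue the corresponding points along a
  partition refining these events.  Locality of \<open>Q\<close> carries the property over to the glued point.
\<close>

lemma maximal_event:
  assumes X: "sigma_stable M E X"
    and meas: "\<And>x. x \<in> X \<Longrightarrow> {w \<in> space M. Q x w} \<in> events"
    and loc: "\<And>x y. x \<in> X \<Longrightarrow> y \<in> X \<Longrightarrow> AE w in M. dst x y w = 0 \<longrightarrow> Q y w \<longrightarrow> Q x w"
  obtains z where "z \<in> X" "\<And>x. x \<in> X \<Longrightarrow> AE w in M. Q x w \<longrightarrow> Q z w"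
proof -
  define ev where "ev x = {w \<in> space M. Q x w}" for x
  have ne: "X \<noteq> {}" using X by (simp add: sigma_stable_def)
  have sub: "ev ` X \<subseteq> events" using meas by (auto simp: ev_def)
  obtain B :: "nat \<Rightarrow> 'w set" where B: "range B \<subseteq> ev ` X" "\<And>C. C \<in> ev ` X \<Longrightarrow> AE w\<in>C in M. w \<in> (\<Union>n. B n)"
    using ess_union[OF sub] ne by blast
  have "\<forall>n. \<exists>x. x \<in> X \<and> B n = ev x" using B(1) by blast
  from choice[OF this] obtain x where x: "\<And>n. x n \<in> X" "\<And>n. B n = ev (x n)" by blast
  have Be: "B n \<in> events" for n using B(1) sub by auto
  obtain A where A0: "meas_partition M A \<and> (\<forall>n. A n \<inter> (\<Union>k. B k) \<subseteq> B n)"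
    using ex_partition[of B, OF Be] by (elim exE)
  have A: "meas_partition M A" "A n \<inter> (\<Union>k. B k) \<subseteq> B n" for n using A0 by simp_all
  have "range x \<subseteq> X" using x(1) by auto
  with A(1) obtain z where z: "z \<in> X" "\<And>n. AE w\<in>A n in M. dst z (x n) w = 0"
    using X unfolding sigma_stable_iff by blast
  have all: "AE w in M. \<forall>n. (w \<in> A n \<longrightarrow> dst z (x n) w = 0) \<and> (dst z (x n) w = 0 \<longrightarrow> Q (x n) w \<longrightarrow> Q z w)"
    unfolding AE_all_countable using z(2) loc[OF z(1) x(1)] by auto
  have "AE w in M. Q y w \<longrightarrow> Q z w" if y: "y \<in> X" for y
  proof -
    have "AE w in M. w \<in> ev y \<longrightarrow> w \<in> (\<Union>n. B n)" using y by (intro B(2)) auto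
    then show ?thesis using all AE_space
    proof eventually_elim
      case (elim w)
      show ?case
      proof
        assume "Q y w"
        then have U: "w \<in> (\<Union>n. B n)" "w \<in> (\<Union>n. A n)" using elim A(1) by (auto simp: ev_def meas_partition_def)
        from U(2) obtain n where n: "w \<in> A n" by (rule UN_E)
        then have "w \<in> B n" using U(1) by (intro subsetD[OF A(2)] IntI)
        then have "Q (x n) w" by (simp add: x(2) ev_def)
        then show "Q z w" using spec[OF elim(2), of n] n by simp
      qed
    qed
  qed
  then show thesis using z(1) that by blast
qed

section \<open>Boundedness of compact sets\<close>

lemma nrm_diff:
  assumes "x \<in> carrier E" "y \<in> carrier E"
  shows "AE w in M. nrm x w \<le> dst x y w + nrm y w"
  using dst_triangle[OF assms M.zero_closed] by (simp add: dst_zero assms)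

lemma nrm_local:
  assumes "x \<in> carrier E" "y \<in> carrier E"
  shows "AE w in M. dst x y w = 0 \<longrightarrow> nrm x w = nrm y w"
  using nrm_diff[OF assms] nrm_diff[OF assms(2,1)] dst_sym[OF assms] by eventually_elim auto

lemma ccl_scale:
  assumes "ccl G" "\<zero> \<in> G" "z \<in> G" "0 \<le> t" "t \<le> 1"
  shows "rsm (\<lambda>_. t) z \<in> G"
proof -
  have z: "z \<in> carrier E" using assms ccl_sub by blast
  have "rsm (\<lambda>_. t) z = conv (\<lambda>_. t) z \<zero>"
    by (insert z, rule_tac is_lc_eq[of z z z z], (rule is_lc_intros | (simp add: algebra_simps; fail))+)
  then show ?thesis using assms by (auto intro: ccl_conv)
qed

lemma ray_points:
  assumes "v \<in> carrier E" "\<xi> \<in> borel_measurable M" "AE w in M. real n \<le> \<xi> w \<and> \<xi> w \<le> real K"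
    and G: "ccl G" "\<zero> \<in> G" "rsm (\<lambda>_. real (Suc K)) v \<in> G"
  shows "rsm \<xi> v \<in> G"
proof -
  have eq: "rsm \<xi> v = conv (\<lambda>w. \<xi> w / real (Suc K)) (rsm (\<lambda>_. real (Suc K)) v) \<zero>"
    by (insert assms(1,2), rule_tac is_lc_eq[of v v v v], (rule is_lc_intros | (simp; fail))+)
  have "AE w in M. 0 \<le> \<xi> w / real (Suc K) \<and> \<xi> w / real (Suc K) \<le> 1"
    using assms(3) by eventually_elim (auto simp: field_simps intro: order_trans[OF of_nat_0_le_iff])
  then show ?thesis unfolding eq using assms(2) G by (intro ccl_conv) auto
qed

text \<open>
  The closures of \<open>{\<xi> v | n \<le> \<xi> \<le> K, K \<in> \<nat>}\<close> are decreasing closed convex subsets of \<open>G\<close>.  A common point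
  \<open>p\<close> satisfies \<open>\<parallel>p\<parallel> \<ge> n \<parallel>v\<parallel>\<close> for all \<open>n\<close>.
\<close>

lemma no_ray:
  assumes G: "nested_compact G" and z: "\<zero> \<in> G" and v: "v \<in> carrier E"
    and ray: "\<And>n. rsm (\<lambda>_. real n) v \<in> G"
  shows "v = \<zero>"
proof -
  have cG: "ccl G" by (rule nested_compact_ccl[OF G])
  define S where "S n = {rsm \<xi> v | \<xi>. \<xi> \<in> borel_measurable M \<and> (\<exists>K::nat. AE w in M. real n \<le> \<xi> w \<and> \<xi> w \<le> real K)}" for n :: nat
  define H where "H n = eps_lam_topology M E closure_of S n" for n
  have Sc: "S n \<subseteq> carrier E" for n using v by (auto simp: S_def)
  have SG: "S n \<subseteq> G" for n unfolding S_def using ray_points[OF v _ _ cG z ray] by blast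
  have "ccl (H n)" for n unfolding H_def
  proof (rule closure_ccl[OF Sc])
    fix x y and f :: "'w \<Rightarrow> real" assume x: "x \<in> S n" and y: "y \<in> S n" and f: "f \<in> borel_measurable M" "AE w in M. 0 \<le> f w \<and> f w \<le> 1"
    obtain \<xi> K where xi: "x = rsm \<xi> v" "\<xi> \<in> borel_measurable M" "AE w in M. real n \<le> \<xi> w \<and> \<xi> w \<le> real K"
      using x unfolding S_def by blast
    obtain \<eta> L where eta: "y = rsm \<eta> v" "\<eta> \<in> borel_measurable M" "AE w in M. real n \<le> \<eta> w \<and> \<eta> w \<le> real L"
      using y unfolding S_def by blast
    have eq: "conv f x y = rsm (\<lambda>w. f w * \<xi> w + (1 - f w) * \<eta> w) v"
      unfolding xi(1) eta(1)
      by (insert v f(1) xi(2) eta(2), rule_tac is_lc_eq[of v v v v], (rule is_lc_intros | (simp add: algebra_simps; fail))+)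
    have "AE w in M. real n \<le> f w * \<xi> w + (1 - f w) * \<eta> w \<and> f w * \<xi> w + (1 - f w) * \<eta> w \<le> real (max K L)"
      using f(2) xi(3) eta(3)
    proof eventually_elim
      case (elim w)
      have "f w * real n + (1 - f w) * real n \<le> f w * \<xi> w + (1 - f w) * \<eta> w"
        using elim by (intro add_mono mult_left_mono) auto
      moreover have "f w * \<xi> w + (1 - f w) * \<eta> w \<le> f w * real (max K L) + (1 - f w) * real (max K L)"
        using elim by (intro add_mono mult_left_mono) auto
      ultimately show ?case by (simp add: algebra_simps)
    qed
    moreover have "(\<lambda>w. f w * \<xi> w + (1 - f w) * \<eta> w) \<in> borel_measurable M" using f(1) xi(2) eta(2) by simp
    ultimately show "conv f x y \<in> S n" unfolding eq S_def by blast
  qed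
  moreover have "H n \<noteq> {}" for n
  proof -
    have "rsm (\<lambda>_. real n) v \<in> S n" unfolding S_def by (auto intro!: exI[of _ "\<lambda>_. real n"])
    then show ?thesis using closure_subset[OF Sc[of n]] unfolding H_def by blast
  qed
  moreover have "H n \<subseteq> G" for n unfolding H_def
    using SG cG by (intro closure_of_minimal) (auto simp: ccl_def)
  moreover have "H (Suc n) \<subseteq> H n" for n unfolding H_def
  proof (rule closure_of_mono)
    show "S (Suc n) \<subseteq> S n" unfolding S_def
    proof safe
      fix \<xi> :: "'w \<Rightarrow> real" and K :: nat
      assume "\<xi> \<in> borel_measurable M" and ae: "AE w in M. real (Suc n) \<le> \<xi> w \<and> \<xi> w \<le> real K"
      moreover have "AE w in M. real n \<le> \<xi> w \<and> \<xi> w \<le> real K" using ae by eventually_elim auto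
      ultimately show "\<exists>\<xi>'. rsm \<xi> v = rsm \<xi>' v \<and> \<xi>' \<in> borel_measurable M \<and> (\<exists>K. AE w in M. real n \<le> \<xi>' w \<and> \<xi>' w \<le> real K)"
        by blast
    qed
  qed
  ultimately obtain p where p: "\<And>n. p \<in> H n" using nested_compact_meet[OF G, of H] by blast
  have "AE w in M. real n * nrm v w \<le> nrm p w" for n
  proof -
    obtain y where y: "range y \<subseteq> S n" "tends y p" and pc: "p \<in> carrier E"
      using p[of n] unfolding H_def closure_iff_seq[OF Sc] by blast
    have yc: "y k \<in> carrier E" for k using y(1) Sc by blast
    have "AE w in M. real n * nrm v w \<le> nrm (y k) w" for k
    proof -
      have "y k \<in> S n" using y(1) by blast
      then obtain \<xi> where xi: "y k = rsm \<xi> v" "\<xi> \<in> borel_measurable M" "AE w in M. real n \<le> \<xi> w"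
        unfolding S_def by auto
      show ?thesis using nrm_rsm[OF xi(2) v] xi(3) unfolding xi(1)
        by eventually_elim (auto intro!: mult_right_mono)
    qed
    then have "AE w in M. \<forall>k. real n * nrm v w \<le> nrm (y k) w" by (simp add: AE_all_countable)
    moreover have "AE w in M. (\<lambda>k. nrm (y k) w) \<longlonglongrightarrow> nrm p w"
      using tends_dst[OF yc pc M.zero_closed y(2)] yc pc by (simp add: dst_zero)
    ultimately show ?thesis by eventually_elim (auto intro: LIMSEQ_le_const)
  qed
  then have "AE w in M. \<forall>n. real n * nrm v w \<le> nrm p w" by (simp add: AE_all_countable)
  then have "AE w in M. nrm v w = 0"
  proof eventually_elim
    case (elim w)
    show ?case
    proof (rule ccontr)
      assume "nrm v w \<noteq> 0"
      then have "0 < nrm v w" using nrm_nonneg[of v w] by linarith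
      then obtain n where "nrm p w < real n * nrm v w" using ex_less_of_nat_mult by blast
      then show False using elim by (meson not_le)
    qed
  qed
  then show ?thesis by (rule nrm_eq_0[OF v])
qed

text \<open>
  If for every \<open>n\<close> the largest event on which some point of \<open>(1/n) G\<close> comes within \<open>\<parallel>y\<parallel>/2\<close> of \<open>y\<close> had probability
  above \<open>e\<close>, these decreasing events would meet in a non-null event \<open>D\<close>.  The sets of \<open>v \<in> (1/n) G\<close> with
  \<open>\<parallel>v - y\<parallel> \<le> \<parallel>y\<parallel>/2\<close> on \<open>D\<close> are then decreasing, closed, convex and non-empty, and a common \<open>v\<close> spans a ray in \<open>G\<close>.
  So \<open>v = \<theta>\<close> and \<open>\<parallel>y\<parallel> \<le> \<parallel>y\<parallel>/2\<close> on \<open>D\<close>, although \<open>y\<close> does not vanish there.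
\<close>

lemma escape:
  assumes G: "nested_compact G" and z: "\<zero> \<in> G" and y: "y \<in> carrier E" and e: "e > 0"
  obtains n :: nat where "\<And>z. z \<in> G \<Longrightarrow> prob {w \<in> space M. dst (rsm (\<lambda>_. 1 / real (Suc n)) z) y w < nrm y w / 2} \<le> e"
proof -
  have cG: "ccl G" by (rule nested_compact_ccl[OF G])
  have GE: "x \<in> carrier E" if "x \<in> G" for x using ccl_sub[OF cG] that by blast
  have sG: "sigma_stable M E G" using nested_compact_sigma_stable[OF G] z by blast
  define Q where "Q n x w \<longleftrightarrow> dst (rsm (\<lambda>_. 1 / real (Suc n)) x) y w < nrm y w / 2" for n x w
  have Qm: "{w \<in> space M. Q n x w} \<in> events" if "x \<in> G" for n x
    unfolding Q_def using GE[OF that] y by simp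
  have "\<exists>x\<in>G. \<forall>x'\<in>G. AE w in M. Q n x' w \<longrightarrow> Q n x w" for n
  proof (rule maximal_event[OF sG, of "Q n"])
    show "{w \<in> space M. Q n x w} \<in> events" if "x \<in> G" for x by (rule Qm[OF that])
    fix x x' assume xx: "x \<in> G" "x' \<in> G"
    let ?f = "\<lambda>_::'w. 1 / real (Suc n)"
    have c: "x \<in> carrier E" "x' \<in> carrier E" using xx GE by auto
    have "AE w in M. dst (rsm ?f x) (rsm ?f x') w = \<bar>?f w\<bar> * dst x x' w"
      using dst_affine[of ?f x x' \<zero>] c by simp
    moreover have "AE w in M. dst (rsm ?f x) y w \<le> dst (rsm ?f x) (rsm ?f x') w + dst (rsm ?f x') y w"
      using c y by (intro dst_triangle) auto
    ultimately show "AE w in M. dst x x' w = 0 \<longrightarrow> Q n x' w \<longrightarrow> Q n x w"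
      by eventually_elim (auto simp: Q_def)
  qed blast
  then have "\<forall>n. \<exists>x. x \<in> G \<and> (\<forall>x'\<in>G. AE w in M. Q n x' w \<longrightarrow> Q n x w)" by blast
  from choice[OF this] obtain x where x: "\<And>n. x n \<in> G" "\<And>n x'. x' \<in> G \<Longrightarrow> AE w in M. Q n x' w \<longrightarrow> Q n (x n) w"
    by auto
  define D where "D n = {w \<in> space M. Q n (x n) w}" for n
  have De: "D n \<in> events" for n unfolding D_def by (rule Qm[OF x(1)])
  have small: "\<exists>n. prob (D n) \<le> e"
  proof (rule ccontr)
    assume "\<not> (\<exists>n. prob (D n) \<le> e)"
    then have big: "e \<le> prob (D n)" for n by (meson less_imp_le not_le)
    have scal: "rsm (\<lambda>_. 1 / real (Suc (Suc n))) u = rsm (\<lambda>_. 1 / real (Suc n)) (rsm (\<lambda>_. real (Suc n) / real (Suc (Suc n))) u)"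
      if "u \<in> carrier E" for n u
      using that by (simp add: rsm_rsm)
    have step: "AE w in M. w \<in> D (Suc n) \<longrightarrow> w \<in> D n" for n
    proof -
      have "rsm (\<lambda>_. real (Suc n) / real (Suc (Suc n))) (x (Suc n)) \<in> G"
        by (rule ccl_scale[OF cG z x(1)]) auto
      then have "AE w in M. Q n (rsm (\<lambda>_. real (Suc n) / real (Suc (Suc n))) (x (Suc n))) w \<longrightarrow> Q n (x n) w"
        by (rule x(2))
      moreover have Qs: "Q (Suc n) (x (Suc n)) w \<longleftrightarrow> Q n (rsm (\<lambda>_. real (Suc n) / real (Suc (Suc n))) (x (Suc n))) w" for w
        unfolding Q_def by (simp only: scal[OF GE[OF x(1)], of n])
      ultimately show ?thesis by (auto simp only: D_def Qs mem_Collect_eq elim!: AE_mp)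
    qed
    have stepall: "AE w in M. \<forall>n. w \<in> D (Suc n) \<longrightarrow> w \<in> D n" using step by (simp add: AE_all_countable)
    define D' where "D' n = (\<Inter>k\<in>{..n}. D k)" for n
    have D'e: "D' n \<in> events" for n unfolding D'_def using De by (intro sets.finite_INT) auto
    have "prob (D' n) = prob (D n)" for n
    proof (rule finite_measure_eq_AE[OF _ D'e De])
      show "AE w in M. w \<in> D' n \<longleftrightarrow> w \<in> D n" using stepall
      proof eventually_elim
        case (elim w)
        have "w \<in> D n \<Longrightarrow> k \<le> n \<Longrightarrow> w \<in> D k" for k
          using elim by (induction n) (auto simp: le_Suc_eq)
        then show ?case unfolding D'_def by auto
      qed
    qed
    then have big': "e \<le> prob (D' n)" for n using big by simp
    define DD where "DD = (\<Inter>n. D' n)"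
    have DDe: "DD \<in> events" unfolding DD_def using D'e by auto
    have DDn: "w \<in> D n" if "w \<in> DD" for w n using that unfolding DD_def D'_def by auto
    have "decseq D'" unfolding decseq_def D'_def by fastforce
    then have "(\<lambda>n. prob (D' n)) \<longlonglongrightarrow> prob DD"
      unfolding DD_def using D'e by (intro finite_Lim_measure_decseq) auto
    then have DDp: "e \<le> prob DD" using big' by (intro LIMSEQ_le_const) auto
    define F where "F n = {v \<in> carrier E. rsm (\<lambda>_. real (Suc n)) v \<oplus> \<zero> \<in> G} \<inter>
      (G \<inter> {v \<in> carrier E. AE w\<in>DD in M. dst v y w \<le> nrm y w / 2})" for n
    have "ccl (F n)" for n unfolding F_def
      by (intro ccl_Int ccl_affine_preimage cG ccl_dst_le y) auto
    moreover have "F n \<noteq> {}" for n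
    proof -
      let ?v = "rsm (\<lambda>_. 1 / real (Suc n)) (x n)"
      have "rsm (\<lambda>_. real (Suc n)) ?v = x n"
        using GE[OF x(1)[of n]] by (simp add: rsm_rsm rsm_1)
      moreover have "?v \<in> G" by (rule ccl_scale[OF cG z x(1)]) auto
      moreover have "AE w\<in>DD in M. dst ?v y w \<le> nrm y w / 2"
        using DDn[of _ n] by (auto simp: D_def Q_def intro: less_imp_le)
      ultimately have "?v \<in> F n" using x(1)[of n] GE unfolding F_def by auto
      then show ?thesis by blast
    qed
    moreover have "F n \<subseteq> G" for n unfolding F_def by blast
    moreover have "F (Suc n) \<subseteq> F n" for n
    proof
      fix v assume v: "v \<in> F (Suc n)"
      then have vc: "v \<in> carrier E" by (simp add: F_def)
      have "rsm (\<lambda>_. real (Suc n) / real (Suc (Suc n))) (rsm (\<lambda>_. real (Suc (Suc n))) v) \<in> G"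
        by (rule ccl_scale[OF cG z]) (use v vc in \<open>auto simp: F_def\<close>)
      then have "rsm (\<lambda>_. real (Suc n)) v \<in> G" using vc by (simp add: rsm_rsm)
      then show "v \<in> F n" using v vc by (simp add: F_def)
    qed
    ultimately obtain v where v: "\<And>n. v \<in> F n" using nested_compact_meet[OF G, of F] by blast
    have vc: "v \<in> carrier E" using v[of 0] by (simp add: F_def)
    have "rsm (\<lambda>_. real n) v \<in> G" for n
      using v[of "n - 1"] vc z by (cases n) (auto simp: F_def rsm_0)
    then have v0: "v = \<zero>" by (rule no_ray[OF G z vc])
    have "AE w in M. dst \<zero> y w = nrm y w" using dst_sym[OF M.zero_closed y] dst_zero[OF y] by simp
    moreover have "AE w\<in>DD in M. dst \<zero> y w \<le> nrm y w / 2" using v[of 0] unfolding F_def v0 by simp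
    ultimately have "AE w in M. w \<notin> DD"
    proof eventually_elim
      case (elim w)
      show ?case
      proof
        assume w: "w \<in> DD"
        have "dst (rsm (\<lambda>_. 1 / real (Suc 0)) (x 0)) y w < nrm y w / 2" using DDn[OF w, of 0] by (simp add: D_def Q_def)
        then have "0 < nrm y w" using dst_nonneg[of "rsm (\<lambda>_. 1 / real (Suc 0)) (x 0)" y w] by linarith
        then show False using elim w by linarith
      qed
    qed
    then have "prob DD = 0" using DDe prob_eq_0 by blast
    then show False using DDp e by simp
  qed
  then obtain n where n: "prob (D n) \<le> e" by blast
  have "prob {w \<in> space M. dst (rsm (\<lambda>_. 1 / real (Suc n)) u) y w < nrm y w / 2} \<le> e" if u: "u \<in> G" for u
  proof -
    have "prob {w \<in> space M. Q n u w} \<le> prob (D n)"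
      by (rule finite_measure_mono_AE[OF _ De]) (use x(2)[OF u, of n] in \<open>auto simp: D_def elim: AE_mp\<close>)
    then show ?thesis using n unfolding Q_def by simp
  qed
  then show thesis by (rule that)
qed

text \<open>
  Intersect the largest events on which the norm reaches \<open>n\<close>.  If the intersection were null, the first \<open>n\<close> whose
  event misses \<open>w\<close> would be a random bound; on the intersection, gluing reaches any prescribed random level.
\<close>

lemma unbounded_event:
  assumes sG: "sigma_stable M E G" and unb: "\<not> (\<exists>b\<in>borel_measurable M. \<forall>g\<in>G. AE w in M. nrm g w \<le> b w)"
  obtains B where "B \<in> events" "prob B > 0"
    "\<And>\<xi>. \<xi> \<in> borel_measurable M \<Longrightarrow> \<exists>g\<in>G. AE w\<in>B in M. \<xi> w \<le> nrm g w"
proof -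
  have GE: "x \<in> carrier E" if "x \<in> G" for x using sG that by (auto simp: sigma_stable_iff)
  have max: "\<exists>x\<in>G. \<forall>x'\<in>G. AE w in M. \<xi> w \<le> nrm x' w \<longrightarrow> \<xi> w \<le> nrm x w" if xi: "\<xi> \<in> borel_measurable M" for \<xi>
  proof (rule maximal_event[OF sG, of "\<lambda>x w. \<xi> w \<le> nrm x w"])
    show "{w \<in> space M. \<xi> w \<le> nrm x w} \<in> events" if "x \<in> G" for x using GE[OF that] xi by simp
    show "AE w in M. dst x y w = 0 \<longrightarrow> \<xi> w \<le> nrm y w \<longrightarrow> \<xi> w \<le> nrm x w" if "x \<in> G" "y \<in> G" for x y
      using nrm_local[OF GE GE, OF that] by eventually_elim simp
  qed blast
  have "\<forall>n::nat. \<exists>x. x \<in> G \<and> (\<forall>x'\<in>G. AE w in M. real n \<le> nrm x' w \<longrightarrow> real n \<le> nrm x w)"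
  proof
    fix n :: nat
    show "\<exists>x. x \<in> G \<and> (\<forall>x'\<in>G. AE w in M. real n \<le> nrm x' w \<longrightarrow> real n \<le> nrm x w)"
      using max[of "\<lambda>_. real n"] by auto
  qed
  from choice[OF this] obtain g where g: "\<And>n. g n \<in> G" "\<And>n x'. x' \<in> G \<Longrightarrow> AE w in M. real n \<le> nrm x' w \<longrightarrow> real n \<le> nrm (g n) w"
    by auto
  define B where "B n = {w \<in> space M. real n \<le> nrm (g n) w}" for n
  have Be [measurable]: "B n \<in> events" for n unfolding B_def using GE[OF g(1)[of n]] by simp
  define BB where "BB = (\<Inter>n. B n)"
  have BBe: "BB \<in> events" unfolding BB_def using Be by auto
  have "prob BB \<noteq> 0"
  proof
    assume "prob BB = 0"
    then have ae: "AE w in M. w \<notin> BB" using BBe prob_eq_0 by blast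
    define b where "b w = real (LEAST n. w \<notin> B n)" for w
    have "b \<in> borel_measurable M" unfolding b_def
      by (rule measurable_compose[OF measurable_Least]) (use Be in auto)
    moreover have "AE w in M. nrm x w \<le> b w" if x: "x \<in> G" for x
    proof -
      have "AE w in M. \<forall>n. real n \<le> nrm x w \<longrightarrow> real n \<le> nrm (g n) w"
        using g(2)[OF x] by (simp add: AE_all_countable)
      then show ?thesis using ae AE_space
      proof eventually_elim
        case (elim w)
        have "\<exists>n. w \<notin> B n" using elim(2) by (auto simp: BB_def)
        then have "w \<notin> B (LEAST n. w \<notin> B n)" by (rule LeastI_ex)
        then have "\<not> real (LEAST n. w \<notin> B n) \<le> nrm x w" using elim by (auto simp: B_def)
        then show ?case by (simp add: b_def)
      qed
    qed
    ultimately show False using unb by blast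
  qed
  then have pos: "prob BB > 0" by (simp add: zero_less_measure_iff)
  have "\<exists>x\<in>G. AE w\<in>BB in M. \<xi> w \<le> nrm x w" if xi: "\<xi> \<in> borel_measurable M" for \<xi>
  proof -
    obtain x where x: "x \<in> G" "\<And>x'. x' \<in> G \<Longrightarrow> AE w in M. \<xi> w \<le> nrm x' w \<longrightarrow> \<xi> w \<le> nrm x w" using max[OF xi] by blast
    have "AE w in M. \<forall>n. \<xi> w \<le> nrm (g n) w \<longrightarrow> \<xi> w \<le> nrm x w" unfolding AE_all_countable using x(2)[OF g(1)] by blast
    then have "AE w\<in>BB in M. \<xi> w \<le> nrm x w"
    proof eventually_elim
      case (elim w)
      show ?case
      proof
        assume w: "w \<in> BB"
        obtain n where n: "\<xi> w \<le> real n" using real_arch_simple by blast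
        have "real n \<le> nrm (g n) w" using w by (auto simp: BB_def B_def)
        then show "\<xi> w \<le> nrm x w" using n spec[OF elim, of n] by linarith
      qed
    qed
    then show ?thesis using x(1) by blast
  qed
  then show thesis using that BBe pos by blast
qed

lemma ccl_affine_image:
  assumes X: "ccl X" and L: "L \<noteq> 0" and y: "y \<in> carrier E"
  shows "ccl ((\<lambda>z. y \<oplus> rsm (\<lambda>_. L) z) ` X)"
proof -
  let ?v = "rsm (\<lambda>_. - 1 / L) y"
  have "(\<lambda>z. y \<oplus> rsm (\<lambda>_. L) z) ` X = {x \<in> carrier E. rsm (\<lambda>_. 1 / L) x \<oplus> ?v \<in> X}"
  proof (intro equalityI subsetI)
    fix x assume "x \<in> (\<lambda>z. y \<oplus> rsm (\<lambda>_. L) z) ` X"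
    then obtain z where z: "z \<in> X" "x = y \<oplus> rsm (\<lambda>_. L) z" by blast
    have zc: "z \<in> carrier E" using z ccl_sub[OF X] by blast
    have "rsm (\<lambda>_. 1 / L) x \<oplus> ?v = z" unfolding z(2)
      by (insert zc y L, rule_tac is_lc_eq[of y z y z], (rule is_lc_intros | (simp add: field_simps; fail))+)
    then show "x \<in> {x \<in> carrier E. rsm (\<lambda>_. 1 / L) x \<oplus> ?v \<in> X}" using z zc y by simp
  next
    fix x assume x: "x \<in> {x \<in> carrier E. rsm (\<lambda>_. 1 / L) x \<oplus> ?v \<in> X}"
    then have xc: "x \<in> carrier E" by simp
    have "x = y \<oplus> rsm (\<lambda>_. L) (rsm (\<lambda>_. 1 / L) x \<oplus> ?v)"
      by (insert xc y L, rule_tac is_lc_eq[of y x y x], (rule is_lc_intros | (simp add: field_simps; fail))+)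
    then show "x \<in> (\<lambda>z. y \<oplus> rsm (\<lambda>_. L) z) ` X" using x by blast
  qed
  then show ?thesis using ccl_affine_preimage[OF X, of "\<lambda>_. 1 / L" ?v] y by simp
qed

text \<open>
  The nested sets \<open>y\<^sub>n + L\<^sub>n G\<close> have a common point \<open>p\<close>; by construction \<open>\<parallel>p\<parallel> \<ge> n\<close> on \<open>B\<close> except on an event of
  probability at most \<open>P(B)/2\<close>, which is absurd for large \<open>n\<close>.
\<close>

lemma bounded_at_zero:
  assumes G: "nested_compact G" and z: "\<zero> \<in> G"
  shows "\<exists>b\<in>borel_measurable M. \<forall>g\<in>G. AE w in M. nrm g w \<le> b w"
proof (rule ccontr)
  assume unb: "\<not> ?thesis"
  have cG: "ccl G" by (rule nested_compact_ccl[OF G])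
  have GE: "x \<in> carrier E" if "x \<in> G" for x using ccl_sub[OF cG] that by blast
  have sG: "sigma_stable M E G" using nested_compact_sigma_stable[OF G] z by blast
  obtain B where B: "B \<in> events" "prob B > 0"
    and far: "\<And>\<xi>. \<xi> \<in> borel_measurable M \<Longrightarrow> \<exists>g\<in>G. AE w\<in>B in M. \<xi> w \<le> nrm g w"
    using unbounded_event[OF sG unb] by blast
  define e where "e = prob B / 2"
  have e: "e > 0" using B by (simp add: e_def)
  \<comment> \<open>The state \<open>(y, L)\<close> stands for the set \<open>y + L G\<close>; its points have norm at least \<open>\<parallel>y\<parallel>/2 \<ge> n\<close> on \<open>B\<close>,
    up to an event of probability \<open>e\<close>.  The relation \<open>R\<close> says that the next set is contained in the present one.\<close>
  define P where "P n s \<longleftrightarrow> (case s of (y, L) \<Rightarrow> y \<in> carrier E \<and> 0 < L \<and> (\<forall>u\<in>G. y \<oplus> rsm (\<lambda>_. L) u \<in> G) \<and>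
      (AE w\<in>B in M. 2 * real n \<le> nrm y w) \<and>
      (\<forall>u\<in>G. prob {w \<in> space M. nrm (y \<oplus> rsm (\<lambda>_. L) u) w < nrm y w / 2} \<le> e))" for n :: nat and s :: "'e \<times> real"
  define R where "R s t \<longleftrightarrow> (\<forall>u\<in>G. \<exists>u'\<in>G. fst t \<oplus> rsm (\<lambda>_. snd t) u = fst s \<oplus> rsm (\<lambda>_. snd s) u')" for s t :: "'e \<times> real"
  have base: "P 0 (\<zero>, 1)"
  proof -
    have "prob {w \<in> space M. nrm (\<zero> \<oplus> rsm (\<lambda>_. 1) u) w < nrm \<zero> w / 2} \<le> e" if "u \<in> G" for u
    proof -
      have "AE w in M. \<not> nrm (\<zero> \<oplus> rsm (\<lambda>_. 1) u) w < nrm \<zero> w / 2"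
        using nrm_zero by eventually_elim (simp add: not_less)
      then have "prob {w \<in> space M. nrm (\<zero> \<oplus> rsm (\<lambda>_. 1) u) w < nrm \<zero> w / 2} = 0"
        using GE[OF that] by (subst prob_eq_0) auto
      then show ?thesis using e by simp
    qed
    then show ?thesis using GE unfolding P_def by (auto simp: rsm_1)
  qed
  have step: "\<exists>t. P (Suc n) t \<and> R s t" if Ps: "P n s" for s n
  proof -
    obtain y L where s: "s = (y, L)" by force
    have y: "y \<in> carrier E" and L: "0 < L" and sub: "\<And>u. u \<in> G \<Longrightarrow> y \<oplus> rsm (\<lambda>_. L) u \<in> G" using Ps by (auto simp: P_def s)
    \<comment> \<open>Large enough that \<open>\<parallel>y + (L/2) x\<parallel> \<ge> 2 (n + 1)\<close> on \<open>B\<close>.\<close>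
    obtain x where x: "x \<in> G" "AE w\<in>B in M. (2 * real (Suc n) + nrm y w) * (2 / L) \<le> nrm x w"
      using far[of "\<lambda>w. (2 * real (Suc n) + nrm y w) * (2 / L)"] y by auto
    have xc: "x \<in> carrier E" using GE x by blast
    define y' where "y' = y \<oplus> rsm (\<lambda>_. L / 2) x"
    have y'c: "y' \<in> carrier E" using y xc by (simp add: y'_def)
    define ny where "ny = rsm (\<lambda>_. - 1) y'"
    have nyc: "ny \<in> carrier E" using y'c by (simp add: ny_def)
    have nyn: "AE w in M. nrm ny w = nrm y' w" unfolding ny_def using nrm_rsm[of "\<lambda>_. - 1", OF _ y'c] by simp
    obtain m :: nat where m: "\<And>u. u \<in> G \<Longrightarrow> prob {w \<in> space M. dst (rsm (\<lambda>_. 1 / real (Suc m)) u) ny w < nrm ny w / 2} \<le> e"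
      using escape[OF G z nyc e] by blast
    \<comment> \<open>The bound \<open>L/2\<close> leaves room for the summand \<open>(L/2) x\<close> inside \<open>L G\<close>; \<open>1/(m + 1)\<close> comes from \<open>escape\<close>.\<close>
    define L' where "L' = min (L / 2) (1 / real (Suc m))"
    have L': "0 < L'" "L' \<le> L / 2" "L' \<le> 1 / real (Suc m)" using L by (auto simp: L'_def)
    have R: "\<exists>u'\<in>G. y' \<oplus> rsm (\<lambda>_. L') u = y \<oplus> rsm (\<lambda>_. L) u'" if u: "u \<in> G" for u
    proof
      let ?u' = "conv (\<lambda>_. 1 / 2) x (rsm (\<lambda>_. 2 * L' / L) u)"
      have uc: "u \<in> carrier E" using GE u by blast
      have "rsm (\<lambda>_. 2 * L' / L) u \<in> G" using L L' by (intro ccl_scale[OF cG z u]) (auto simp: field_simps)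
      then show "?u' \<in> G" using x(1) by (intro ccl_conv[OF cG]) auto
      show "y' \<oplus> rsm (\<lambda>_. L') u = y \<oplus> rsm (\<lambda>_. L) ?u'" unfolding y'_def
        by (insert uc y xc L, rule_tac is_lc_eq[of y x u u], (rule is_lc_intros | (simp add: field_simps; fail))+)
    qed
    have small: "prob {w \<in> space M. nrm (y' \<oplus> rsm (\<lambda>_. L') u) w < nrm y' w / 2} \<le> e" if u: "u \<in> G" for u
    proof -
      have uc: "u \<in> carrier E" using GE u by blast
      let ?u = "rsm (\<lambda>_. L' * real (Suc m)) u"
      have uG: "?u \<in> G" using L' by (intro ccl_scale[OF cG z u]) (auto simp: field_simps)
      have eq: "y' \<oplus> rsm (\<lambda>_. L') u = rsm (\<lambda>_. 1 / real (Suc m)) ?u \<ominus> ny" unfolding ny_def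
        by (insert uc y'c, rule_tac is_lc_eq[of y' u u u], (rule is_lc_intros | (simp; fail))+)
      have "prob {w \<in> space M. nrm (y' \<oplus> rsm (\<lambda>_. L') u) w < nrm y' w / 2} =
          prob {w \<in> space M. dst (rsm (\<lambda>_. 1 / real (Suc m)) ?u) ny w < nrm ny w / 2}"
        unfolding eq dst_def using uc nyc y'c
        by (intro finite_measure_eq_AE) (use nyn in \<open>auto elim: AE_mp\<close>)
      then show ?thesis using m[OF uG] by simp
    qed
    have "AE w in M. nrm (rsm (\<lambda>_. L / 2) x) w = L / 2 * nrm x w" using nrm_rsm[of "\<lambda>_. L / 2", OF _ xc] L by simp
    moreover have "AE w in M. nrm (rsm (\<lambda>_. L / 2) x) w \<le> nrm y' w + nrm y w"
    proof -
      have "rsm (\<lambda>_. L / 2) x = y' \<oplus> rsm (\<lambda>_. - 1) y" unfolding y'_def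
        by (insert y xc, rule_tac is_lc_eq[of y x x x], (rule is_lc_intros | (simp; fail))+)
      then have "AE w in M. nrm (rsm (\<lambda>_. L / 2) x) w \<le> nrm y' w + nrm (rsm (\<lambda>_. - 1) y) w"
        using nrm_triangle[OF y'c, of "rsm (\<lambda>_. - 1) y"] y by simp
      moreover have "AE w in M. nrm (rsm (\<lambda>_. - 1) y) w = nrm y w" using nrm_rsm[of "\<lambda>_. - 1", OF _ y] by simp
      ultimately show ?thesis by eventually_elim simp
    qed
    ultimately have big: "AE w\<in>B in M. 2 * real (Suc n) \<le> nrm y' w" using x(2)
    proof eventually_elim
      case (elim w)
      show ?case
      proof
        assume "w \<in> B"
        then have "L / 2 * ((2 * real (Suc n) + nrm y w) * (2 / L)) \<le> L / 2 * nrm x w"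
          using elim L by (intro mult_left_mono) auto
        moreover have "L / 2 * ((2 * real (Suc n) + nrm y w) * (2 / L)) = 2 * real (Suc n) + nrm y w" using L by simp
        ultimately show "2 * real (Suc n) \<le> nrm y' w" using elim(1,2) by linarith
      qed
    qed
    have "y' \<oplus> rsm (\<lambda>_. L') u \<in> G" if "u \<in> G" for u using R[OF that] sub by auto
    then have "P (Suc n) (y', L')" using y'c L' big small by (simp add: P_def)
    moreover have "R s (y', L')" using R by (simp add: R_def s)
    ultimately show ?thesis by blast
  qed
  obtain s where s: "\<And>n. P n (s n)" "\<And>n. R (s n) (s (Suc n))"
    using dependent_nat_choice[of P "\<lambda>_. R"] base step by metis
  define y L where "y n = fst (s n)" and "L n = snd (s n)" for n
  have sn: "s n = (y n, L n)" for n by (simp add: y_def L_def)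
  have Pn: "y n \<in> carrier E" "0 < L n" "\<And>u. u \<in> G \<Longrightarrow> y n \<oplus> rsm (\<lambda>_. L n) u \<in> G"
      "AE w\<in>B in M. 2 * real n \<le> nrm (y n) w"
      "\<And>u. u \<in> G \<Longrightarrow> prob {w \<in> space M. nrm (y n \<oplus> rsm (\<lambda>_. L n) u) w < nrm (y n) w / 2} \<le> e" for n
    using s(1)[of n] unfolding sn P_def by auto
  define H where "H n = (\<lambda>u. y n \<oplus> rsm (\<lambda>_. L n) u) ` G" for n
  have "ccl (H n)" for n unfolding H_def using Pn(1,2)[of n] by (intro ccl_affine_image[OF cG]) auto
  moreover have "H n \<noteq> {}" for n unfolding H_def using z by blast
  moreover have "H n \<subseteq> G" for n unfolding H_def using Pn(3) by blast
  moreover have "H (Suc n) \<subseteq> H n" for n using s(2)[of n] unfolding H_def R_def sn by auto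
  ultimately obtain p where p: "\<And>n. p \<in> H n" using nested_compact_meet[OF G, of H] by blast
  have pc: "p \<in> carrier E" using p[of 0] Pn GE unfolding H_def by blast
  define A where "A n = B \<inter> {w \<in> space M. nrm p w < real n}" for n
  have Ae: "A n \<in> events" for n unfolding A_def using B pc by simp
  have Ale: "prob (A n) \<le> e" for n
  proof -
    obtain u where u: "u \<in> G" "p = y n \<oplus> rsm (\<lambda>_. L n) u" using p[of n] unfolding H_def by blast
    have "prob (A n) \<le> prob {w \<in> space M. nrm p w < nrm (y n) w / 2}"
    proof (rule finite_measure_mono_AE)
      show "AE w\<in>A n in M. w \<in> {w \<in> space M. nrm p w < nrm (y n) w / 2}"
        using Pn(4)[of n] by eventually_elim (auto simp: A_def)
      show "{w \<in> space M. nrm p w < nrm (y n) w / 2} \<in> events" using pc Pn(1) by simp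
    qed
    also have "\<dots> \<le> e" using Pn(5)[OF u(1), of n] u(2) by simp
    finally show ?thesis .
  qed
  have "incseq A" unfolding incseq_def A_def by (auto intro: less_le_trans)
  then have "(\<lambda>n. prob (A n)) \<longlonglongrightarrow> prob (\<Union>n. A n)" using Ae by (intro finite_Lim_measure_incseq) auto
  moreover have "(\<Union>n. A n) = B"
    using subsetD[OF sets.sets_into_space[OF B(1)]] reals_Archimedean2 by (auto simp: A_def)
  ultimately have "prob B \<le> e" using Ale by (intro LIMSEQ_le_const2) auto
  then show False using e by (simp add: e_def)
qed

lemma nested_compact_bounded:
  assumes G: "nested_compact G" and ne: "G \<noteq> {}"
  shows "as_bounded M E G"
proof -
  have cG: "ccl G" by (rule nested_compact_ccl[OF G])
  have GE: "x \<in> carrier E" if "x \<in> G" for x using ccl_sub[OF cG] that by blast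
  obtain g where g: "g \<in> G" using ne by blast
  have gc: "g \<in> carrier E" using GE g by blast
  define T where "T v X = {x \<in> carrier E. rsm (\<lambda>_. 1) x \<oplus> v \<in> X}" for v X
  have T: "ccl (T v X)" if "ccl X" "v \<in> carrier E" for v X
    unfolding T_def using that by (intro ccl_affine_preimage) auto
  have inv: "rsm (\<lambda>_. 1) (rsm (\<lambda>_. 1) x \<oplus> v) \<oplus> rsm (\<lambda>_. - 1) v = x" "rsm (\<lambda>_. 1) (rsm (\<lambda>_. 1) x \<oplus> rsm (\<lambda>_. - 1) v) \<oplus> v = x"
    if "x \<in> carrier E" "v \<in> carrier E" for x v
    by (insert that, rule_tac is_lc_eq[of x v v v], (rule is_lc_intros | (simp; fail))+)+
  let ?g = "rsm (\<lambda>_. - 1) g"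
  have "nested_compact (T g G)" unfolding nested_compact_def
  proof (intro conjI allI impI)
    show "ccl (T g G)" by (rule T[OF cG gc])
    fix H :: "nat \<Rightarrow> 'e set" assume H: "\<forall>n. ccl (H n) \<and> H n \<noteq> {} \<and> H n \<subseteq> T g G \<and> H (Suc n) \<subseteq> H n"
    have HE: "x \<in> carrier E" if "x \<in> H n" for x n using H that unfolding T_def by blast
    have "ccl (T ?g (H n))" for n using H gc by (intro T) auto
    moreover have "T ?g (H n) \<noteq> {}" for n
    proof -
      obtain x where x: "x \<in> H n" using H by blast
      have "rsm (\<lambda>_. 1) x \<oplus> g \<in> T ?g (H n)" unfolding T_def using x inv(1)[OF HE[OF x] gc] HE[OF x] gc by simp
      then show ?thesis by blast
    qed
    moreover have "T ?g (H n) \<subseteq> G" for n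
    proof
      fix x assume x: "x \<in> T ?g (H n)"
      then have "rsm (\<lambda>_. 1) (rsm (\<lambda>_. 1) x \<oplus> ?g) \<oplus> g \<in> G" using H unfolding T_def by blast
      then show "x \<in> G" using x inv(2)[of x g] gc by (simp add: T_def)
    qed
    moreover have "T ?g (H (Suc n)) \<subseteq> T ?g (H n)" for n using H unfolding T_def by blast
    ultimately obtain p where p: "\<And>n. p \<in> T ?g (H n)" using nested_compact_meet[OF G, of "\<lambda>n. T ?g (H n)"] by blast
    then have "rsm (\<lambda>_. 1) p \<oplus> ?g \<in> H n" for n unfolding T_def by blast
    then show "(\<Inter>n. H n) \<noteq> {}" by blast
  qed
  moreover have "\<zero> \<in> T g G" unfolding T_def using g gc by (simp add: rsm_1)
  ultimately obtain b where b: "b \<in> borel_measurable M" "\<And>x. x \<in> T g G \<Longrightarrow> AE w in M. nrm x w \<le> b w"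
    using bounded_at_zero by blast
  have "AE w in M. nrm x w \<le> b w + nrm g w" if x: "x \<in> G" for x
  proof -
    have xc: "x \<in> carrier E" using GE x by blast
    have "rsm (\<lambda>_. 1) (x \<ominus> g) \<oplus> g = x"
      by (insert xc gc, rule_tac is_lc_eq[of x g g g], (rule is_lc_intros | (simp; fail))+)
    then have "x \<ominus> g \<in> T g G" using x xc gc by (simp add: T_def)
    then have "AE w in M. dst x g w \<le> b w" unfolding dst_def by (rule b(2))
    then show ?thesis using nrm_diff[OF xc gc] by eventually_elim linarith
  qed
  then show ?thesis unfolding as_bounded_iff using ne ccl_sub[OF cG] b(1) gc
    by (intro conjI bexI[of _ "\<lambda>w. b w + nrm g w"]) auto
qed

section \<open>Chebyshev centres\<close>

lemma dst_le_nrm: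
  assumes "x \<in> carrier E" "y \<in> carrier E"
  shows "AE w in M. dst x y w \<le> nrm x w + nrm y w"
  using dst_triangle[OF assms(1) M.zero_closed assms(2)] dst_sym[OF M.zero_closed assms(2)]
  unfolding dst_zero[OF assms(1)] dst_zero[OF assms(2)] by eventually_elim simp

lemma dst_local:
  assumes "x \<in> carrier E" "x' \<in> carrier E" "y \<in> carrier E"
  shows "AE w in M. dst x x' w = 0 \<longrightarrow> dst x y w = dst x' y w"
  using dst_triangle[OF assms] dst_triangle[OF assms(2,1,3)] dst_sym[OF assms(1,2)] by eventually_elim auto

lemma rad_lipschitz:
  assumes H: "H \<subseteq> carrier E" "H \<noteq> {}" and x: "x \<in> carrier E" "x' \<in> carrier E"
  shows "AE w in M. rad H x w \<le> ereal (dst x x' w) + rad H x' w"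
proof (rule rad_least[OF H x(1)])
  show "(\<lambda>w. ereal (dst x x' w) + rad H x' w) \<in> borel_measurable M"
    using rad_measurable[OF H x(2)] x by (intro borel_measurable_ereal_add) auto
  fix y assume y: "y \<in> H"
  then have yc: "y \<in> carrier E" using H by blast
  show "AE w in M. ereal (dst x y w) \<le> ereal (dst x x' w) + rad H x' w"
    using dst_triangle[OF x yc] rad_upper[OF H(1) x(2) y]
  proof eventually_elim
    case (elim w)
    have "ereal (dst x y w) \<le> ereal (dst x x' w) + ereal (dst x' y w)" using elim by simp
    also have "\<dots> \<le> ereal (dst x x' w) + rad H x' w" using elim by (intro add_left_mono)
    finally show ?case .
  qed
qed

lemma cheb_rad_real:
  assumes H: "H \<subseteq> carrier E" "H \<noteq> {}" and W: "W \<subseteq> carrier E" "W \<noteq> {}"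
    and b: "b \<in> borel_measurable M" "\<And>x y. x \<in> W \<Longrightarrow> y \<in> H \<Longrightarrow> AE w in M. dst x y w \<le> b w"
  obtains r where "r \<in> borel_measurable M" "AE w in M. 0 \<le> r w" "cheb_rad M E H W = L0_class M (\<lambda>w. ereal (r w))"
proof -
  obtain s where s: "is_ess_inf M (rad H ` W) s" "cheb_rad M E H W = L0_class M s" using ex_cheb_rad[OF H W] by blast
  have sm: "s \<in> borel_measurable M" using s(1) by (simp add: is_ess_inf_def)
  obtain x y where x: "x \<in> W" and y: "y \<in> H" using H W by blast
  have "AE w in M. rad H x w \<le> ereal (b w)"
    by (rule rad_least[OF H]) (use W x b in auto)
  moreover have "AE w in M. s w \<le> rad H x w" using is_ess_inf_lower[OF s(1)] x by blast
  ultimately have up: "AE w in M. s w \<le> ereal (b w)" by eventually_elim (rule order_trans)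
  have lo: "AE w in M. 0 \<le> s w"
  proof (rule is_ess_inf_greatest[OF s(1)])
    fix f assume "f \<in> rad H ` W"
    then obtain u where u: "u \<in> W" "f = rad H u" by blast
    have "AE w in M. ereal (dst u y w) \<le> rad H u w" using rad_upper[OF H(1) _ y] u(1) W by blast
    then show "AE w in M. 0 \<le> f w" unfolding u(2)
      by eventually_elim (use dst_nonneg order_trans zero_ereal_def ereal_less_eq(3) in metis)
  qed simp
  have eq: "AE w in M. s w = ereal (real_of_ereal (s w))"
    using up lo by eventually_elim (auto simp: ereal_real abs_ereal_ge0)
  show thesis
  proof (rule that)
    show "(\<lambda>w. real_of_ereal (s w)) \<in> borel_measurable M" using sm by simp
    show "AE w in M. 0 \<le> real_of_ereal (s w)" using lo by eventually_elim (simp add: real_of_ereal_pos)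
    show "cheb_rad M E H W = L0_class M (\<lambda>w. ereal (real_of_ereal (s w)))"
      using eq sm s(2) by (simp add: L0_class_eq_iff)
  qed
qed

lemma cheb_rad_le:
  assumes H: "H \<subseteq> carrier E" "H \<noteq> {}" and W: "W \<subseteq> carrier E" "c \<in> W"
    and r: "r \<in> borel_measurable M" "cheb_rad M E H W = L0_class M (\<lambda>w. ereal (r w))"
  shows "AE w in M. ereal (r w) \<le> rad H c w"
proof -
  obtain s where s: "is_ess_inf M (rad H ` W) s" "cheb_rad M E H W = L0_class M s"
    using ex_cheb_rad[OF H W(1)] W(2) by blast
  have "s \<in> borel_measurable M" using s(1) by (simp add: is_ess_inf_def)
  then have "AE w in M. ereal (r w) = s w" using s(2) r by (simp add: L0_class_eq_iff)
  moreover have "AE w in M. s w \<le> rad H c w" using is_ess_inf_lower[OF s(1)] W by blast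
  ultimately show ?thesis by eventually_elim simp
qed

lemma cheb_rad_greatest:
  assumes H: "H \<subseteq> carrier E" "H \<noteq> {}" and W: "W \<subseteq> carrier E" "W \<noteq> {}"
    and r: "r \<in> borel_measurable M" "cheb_rad M E H W = L0_class M (\<lambda>w. ereal (r w))"
    and h: "h \<in> borel_measurable M" "\<And>x. x \<in> W \<Longrightarrow> AE w in M. h w \<le> rad H x w"
  shows "AE w in M. h w \<le> ereal (r w)"
proof -
  obtain s where s: "is_ess_inf M (rad H ` W) s" "cheb_rad M E H W = L0_class M s"
    using ex_cheb_rad[OF H W] by blast
  have "s \<in> borel_measurable M" using s(1) by (simp add: is_ess_inf_def)
  then have "AE w in M. ereal (r w) = s w" using s(2) r by (simp add: L0_class_eq_iff)
  moreover have "AE w in M. h w \<le> s w" using h by (intro is_ess_inf_greatest[OF s(1)]) auto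
  ultimately show ?thesis by eventually_elim simp
qed

text \<open>
  Every radius at a point of \<open>W\<close> is at least \<open>r\<close>, so a centre is a point whose distances never exceed \<open>r\<close>.
\<close>

lemma cheb_centre_iff:
  assumes H: "H \<subseteq> carrier E" "H \<noteq> {}" and W: "W \<subseteq> carrier E"
    and r: "r \<in> borel_measurable M" "cheb_rad M E H W = L0_class M (\<lambda>w. ereal (r w))"
  shows "x \<in> cheb_centre M E H W \<longleftrightarrow> x \<in> W \<and> (\<forall>y\<in>H. AE w in M. dst x y w \<le> r w)"
proof (cases "x \<in> W")
  case x: True
  then have xc: "x \<in> carrier E" using W by blast
  have "x \<in> cheb_centre M E H W \<longleftrightarrow> (AE w in M. rad H x w = ereal (r w))"
    using x r rad_measurable[OF H xc] by (simp add: cheb_centre_def cheb_rad_at_eq[OF H xc] L0_class_eq_iff)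
  also have "\<dots> \<longleftrightarrow> (\<forall>y\<in>H. AE w in M. dst x y w \<le> r w)"
  proof
    assume eq: "AE w in M. rad H x w = ereal (r w)"
    show "\<forall>y\<in>H. AE w in M. dst x y w \<le> r w"
    proof
      fix y assume "y \<in> H"
      from rad_upper[OF H(1) xc this] eq show "AE w in M. dst x y w \<le> r w" by eventually_elim simp
    qed
  next
    assume "\<forall>y\<in>H. AE w in M. dst x y w \<le> r w"
    then have "AE w in M. rad H x w \<le> ereal (r w)" using r by (intro rad_least[OF H xc]) auto
    then show "AE w in M. rad H x w = ereal (r w)"
      using cheb_rad_le[OF H W x r] by eventually_elim simp
  qed
  finally show ?thesis using x by simp
qed (simp add: cheb_centre_def)

text \<open>
  The points whose distances to \<open>W\<close> stay below \<open>r + 1/n\<close> form decreasing closed convex sets.  They are non-empty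
  because the largest event on which some radius is below \<open>r + 1/n\<close> is everything: off it, \<open>r + 1/n\<close> would be a
  lower bound of all radii.
\<close>

lemma cheb_centre_nonempty:
  assumes G: "nested_compact W" and ne: "W \<noteq> {}"
    and r: "r \<in> borel_measurable M" "cheb_rad M E W W = L0_class M (\<lambda>w. ereal (r w))"
  shows "cheb_centre M E W W \<noteq> {}"
proof -
  have cW: "ccl W" by (rule nested_compact_ccl[OF G])
  have WE: "W \<subseteq> carrier E" by (rule ccl_sub[OF cW])
  have xE: "x \<in> carrier E" if "x \<in> W" for x using WE that by blast
  have sW: "sigma_stable M E W" by (rule nested_compact_sigma_stable[OF G ne])
  have rm: "rad W x \<in> borel_measurable M" if "x \<in> W" for x by (rule rad_measurable[OF WE ne xE[OF that]])
  define F where "F n = {x \<in> W. \<forall>y\<in>W. AE w\<in>space M in M. dst x y w \<le> r w + 1 / real (Suc n)}" for n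
  have "ccl (F n)" for n unfolding F_def using xE by (intro ccl_All[OF cW] ccl_dst_le)
  moreover have "F n \<noteq> {}" for n
  proof -
    let ?Q = "\<lambda>x w. rad W x w \<le> ereal (r w + 1 / real (Suc n))"
    have "\<exists>x\<in>W. \<forall>x'\<in>W. AE w in M. ?Q x' w \<longrightarrow> ?Q x w"
    proof (rule maximal_event[OF sW, of ?Q])
      show "{w \<in> space M. ?Q x w} \<in> events" if "x \<in> W" for x
        using rm[OF that] r(1) by simp
      show "AE w in M. dst x y w = 0 \<longrightarrow> ?Q y w \<longrightarrow> ?Q x w" if "x \<in> W" "y \<in> W" for x y
        using rad_lipschitz[OF WE ne xE xE, OF that] by eventually_elim (auto simp flip: zero_ereal_def intro: order_trans)
    qed blast
    then obtain x where x: "x \<in> W" "\<And>x'. x' \<in> W \<Longrightarrow> AE w in M. ?Q x' w \<longrightarrow> ?Q x w" by blast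
    \<comment> \<open>A lower bound of all radii, by maximality of \<open>x\<close>; comparison with \<open>r\<close> shows that the second case is null.\<close>
    define h where "h w = (if ?Q x w then - \<infinity> else ereal (r w + 1 / real (Suc n)))" for w
    have "h \<in> borel_measurable M" unfolding h_def using rm[OF x(1)] r(1) by (intro measurable_If) auto
    moreover have "AE w in M. h w \<le> rad W x' w" if "x' \<in> W" for x'
      using x(2)[OF that] by eventually_elim (auto simp: h_def)
    ultimately have "AE w in M. h w \<le> ereal (r w)" by (intro cheb_rad_greatest[OF WE ne WE ne r])
    then have Qx: "AE w in M. ?Q x w" by eventually_elim (auto simp: h_def split: if_splits)
    have "AE w in M. dst x y w \<le> r w + 1 / real (Suc n)" if "y \<in> W" for y
      using Qx rad_upper[OF WE xE[OF x(1)] that]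
    proof eventually_elim
      case (elim w)
      then have "ereal (dst x y w) \<le> ereal (r w + 1 / real (Suc n))" by (rule order_trans[rotated])
      then show ?case by simp
    qed
    then have "x \<in> F n" using x(1) unfolding F_def by (auto elim: AE_mp)
    then show ?thesis by blast
  qed
  moreover have "F n \<subseteq> W" for n unfolding F_def by blast
  moreover have "F (Suc n) \<subseteq> F n" for n
  proof
    fix x assume x: "x \<in> F (Suc n)"
    have le: "1 / real (Suc (Suc n)) \<le> 1 / real (Suc n)" by (intro divide_left_mono) auto
    have "AE w\<in>space M in M. dst x y w \<le> r w + 1 / real (Suc n)" if "y \<in> W" for y
    proof -
      have "AE w\<in>space M in M. dst x y w \<le> r w + 1 / real (Suc (Suc n))" using x that unfolding F_def by blast
      then show ?thesis by eventually_elim (use le in linarith)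
    qed
    then show "x \<in> F n" using x unfolding F_def by blast
  qed
  ultimately obtain p where p: "\<And>n. p \<in> F n" using nested_compact_meet[OF G, of F] by blast
  have pW: "p \<in> W" using p[of 0] by (simp add: F_def)
  have "AE w in M. dst p y w \<le> r w" if "y \<in> W" for y
  proof -
    have "AE w\<in>space M in M. dst p y w \<le> r w + 1 / real (Suc n)" for n
      using p[of n] that unfolding F_def by blast
    then have "AE w in M. \<forall>n. w \<in> space M \<longrightarrow> dst p y w \<le> r w + 1 / real (Suc n)" unfolding AE_all_countable by blast
    then show ?thesis using AE_space
    proof eventually_elim
      case (elim w)
      show ?case
      proof (rule field_le_epsilon)
        fix e :: real assume "0 < e"
        then obtain n where "1 / real (Suc n) < e" using nat_approx_posE by blast
        then show "dst p y w \<le> r w + e" using elim(1)[rule_format, of n] elim(2) by linarith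
      qed
    qed
  qed
  then show ?thesis using cheb_centre_iff[OF WE ne WE r] pW by blast
qed

text \<open>
  The radius of \<open>V\<close> at \<open>c\<close> is at least \<open>r\<close>; the largest event on which some point of \<open>V\<close> has distance at least
  \<open>r - d\<close> from \<open>c\<close> is therefore everything.
\<close>

lemma far_point:
  assumes V: "sigma_stable M E V" and W: "W \<subseteq> carrier E" "c \<in> W"
    and r: "r \<in> borel_measurable M" "cheb_rad M E V W = L0_class M (\<lambda>w. ereal (r w))" and d: "d > 0"
  obtains x where "x \<in> V" "AE w in M. r w - d \<le> dst x c w"
proof -
  have VE: "V \<subseteq> carrier E" and ne: "V \<noteq> {}" using V by (auto simp: sigma_stable_iff)
  have xE: "x \<in> carrier E" if "x \<in> V" for x using VE that by blast
  have c: "c \<in> carrier E" using W by blast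
  let ?Q = "\<lambda>x w. r w - d \<le> dst x c w"
  have "\<exists>x\<in>V. \<forall>x'\<in>V. AE w in M. ?Q x' w \<longrightarrow> ?Q x w"
  proof (rule maximal_event[OF V, of ?Q])
    show "{w \<in> space M. ?Q x w} \<in> events" if "x \<in> V" for x using xE[OF that] c r(1) by simp
    show "AE w in M. dst x y w = 0 \<longrightarrow> ?Q y w \<longrightarrow> ?Q x w" if "x \<in> V" "y \<in> V" for x y
      using dst_local[OF xE xE c, OF that] by eventually_elim auto
  qed blast
  then obtain x where x: "x \<in> V" "\<And>x'. x' \<in> V \<Longrightarrow> AE w in M. ?Q x' w \<longrightarrow> ?Q x w" by blast
  \<comment> \<open>An upper bound of the distances from \<open>c\<close>, by maximality of \<open>x\<close>; comparison with \<open>r\<close> shows that the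
    second case is null.\<close>
  define h where "h w = (if ?Q x w then \<infinity> else ereal (r w - d))" for w
  have "h \<in> borel_measurable M" unfolding h_def using xE[OF x(1)] c r(1) by (intro measurable_If) auto
  then have "AE w in M. rad V c w \<le> h w"
  proof (rule rad_least[OF VE ne c])
    fix y assume y: "y \<in> V"
    show "AE w in M. ereal (dst c y w) \<le> h w"
      using x(2)[OF y] dst_sym[OF c xE[OF y]] by eventually_elim (auto simp: h_def)
  qed
  then have "AE w in M. r w - d \<le> dst x c w"
    using cheb_rad_le[OF VE ne W r]
  proof eventually_elim
    case (elim w)
    then have "ereal (r w) \<le> h w" by (rule order_trans[rotated])
    then show ?case using d by (auto simp: h_def split: if_splits)
  qed
  then show thesis using that x(1) by blast
qed

section \<open>Diametral sets\<close>

text \<open>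
  Here \<open>c\<^sub>n\<close> is the mean of \<open>y\<^sub>0, \<dots>, y\<^sub>n\<close> with dyadic weights, and \<open>H\<close> is the closed convex hull of the \<open>y\<^sub>n\<close>, taken as
  an intersection.  The diameter bound passes from the \<open>y\<^sub>n\<close> to \<open>H\<close> in each argument separately.  For the lower
  bound, consider the points \<open>z\<close> of \<open>H\<close> that enter every mean from some index on with weight at least \<open>2\<^sup>-\<^sup>m\<close>, that is,
  \<open>c\<^sub>m = 2\<^sup>-\<^sup>m z + (1 - 2\<^sup>-\<^sup>m) z'\<close> with \<open>z' \<in> H\<close>.  They form a convex set containing every \<open>y\<^sub>i\<close>, so they are dense in \<open>H\<close>.
  As \<open>y\<^sub>m\<^sub>+\<^sub>1\<close> is within \<open>r\<close> of \<open>z'\<close> but at least \<open>(1 - 2 \<cdot> 4\<^sup>-\<^sup>m\<^sup>-\<^sup>1) r\<close> away from \<open>c\<^sub>m\<close>, it must be at least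
  \<open>(1 - 2\<^sup>-\<^sup>m\<^sup>-\<^sup>1) r\<close> away from \<open>z\<close>.
\<close>

lemma diametral:
  assumes W: "ccl W" and y: "\<And>n. y n \<in> W" and r: "r \<in> borel_measurable M" "AE w in M. 0 \<le> r w"
    and B: "B \<in> events"
    and le: "\<And>n m. AE w\<in>B in M. dst (y n) (y m) w \<le> r w"
    and off: "\<And>n m. AE w in M. w \<notin> B \<longrightarrow> dst (y n) (y m) w = 0"
    and c0: "c 0 = y 0" and cS: "\<And>n. c (Suc n) = conv (\<lambda>_. 1/2) (y (Suc n)) (c n)"
    and ge: "\<And>n. AE w\<in>B in M. (1 - 2 * (1/4)^Suc n) * r w \<le> dst (y (Suc n)) (c n) w"
  obtains H where "H \<subseteq> W" "ccl H" "H \<noteq> {}"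
    "\<And>u v. u \<in> H \<Longrightarrow> v \<in> H \<Longrightarrow> AE w in M. dst u v w \<le> (if w \<in> B then r w else 0)"
    "\<And>z h. z \<in> H \<Longrightarrow> (\<And>u. u \<in> H \<Longrightarrow> AE w in M. ereal (dst z u w) \<le> h w) \<Longrightarrow>
      AE w\<in>B in M. ereal (r w) \<le> h w"
proof -
  define H where "H = \<Inter>{X. ccl X \<and> range y \<subseteq> X}"
  define R where "R w = (if w \<in> B then r w else 0)" for w
  have WH: "H \<subseteq> W" unfolding H_def using W y by blast
  have HX: "H \<subseteq> X" if "ccl X" "\<And>n. y n \<in> X" for X unfolding H_def using that by blast
  have cH: "ccl H" unfolding H_def by (rule ccl_Inter) (use W y in blast)+
  have yH: "y n \<in> H" for n unfolding H_def by blast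
  have HE: "x \<in> carrier E" if "x \<in> H" for x using ccl_sub[OF cH] that by blast
  have HH: "AE w in M. dst u v w \<le> R w" if u: "u \<in> H" and v: "v \<in> H" for u v
  proof -
    have yy: "AE w in M. dst (y n) (y m) w \<le> R w" for n m
      using le[of n m] off[of n m] by eventually_elim (auto simp: R_def)
    have xy: "AE w in M. dst x (y m) w \<le> R w" if x: "x \<in> H" for x m
    proof -
      have "H \<subseteq> {x \<in> carrier E. AE w\<in>space M in M. dst x (y m) w \<le> R w}"
      proof (rule HX)
        show "ccl {x \<in> carrier E. AE w\<in>space M in M. dst x (y m) w \<le> R w}"
          by (rule ccl_dst_le[OF HE[OF yH]])
        fix n show "y n \<in> {x \<in> carrier E. AE w\<in>space M in M. dst x (y m) w \<le> R w}"
          using yy[of n m] HE[OF yH[of n]] by (auto elim: AE_mp)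
      qed
      then have "AE w\<in>space M in M. dst x (y m) w \<le> R w" using x by blast
      then show ?thesis using AE_space by eventually_elim simp
    qed
    have "H \<subseteq> {x \<in> carrier E. AE w\<in>space M in M. dst x v w \<le> R w}"
    proof (rule HX)
      show "ccl {x \<in> carrier E. AE w\<in>space M in M. dst x v w \<le> R w}"
        by (rule ccl_dst_le[OF HE[OF v]])
      fix n
      have "AE w\<in>space M in M. dst (y n) v w \<le> R w"
        using xy[OF v, of n] dst_sym[OF HE[OF v] HE[OF yH[of n]]] by eventually_elim simp
      then show "y n \<in> {x \<in> carrier E. AE w\<in>space M in M. dst x v w \<le> R w}"
        using HE[OF yH[of n]] by simp
    qed
    then have "AE w\<in>space M in M. dst u v w \<le> R w" using u by blast
    then show ?thesis using AE_space by eventually_elim simp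
  qed
  have cnH: "c n \<in> H" for n
    by (induction n) (auto simp: c0 cS yH intro!: ccl_conv[OF cH])
  define t where "t m = (1/2::real)^m" for m :: nat
  have t: "0 < t m" "t m \<le> 1" "t (Suc m) \<le> 1/2" "t (Suc m) = t m / 2" for m by (auto simp: t_def power_le_one)
  \<comment> \<open>The points entering every mean from some index on with weight \<open>t m\<close>.\<close>
  define S where "S = {z \<in> H. \<exists>n. \<forall>m\<ge>n. \<exists>z'\<in>H. c m = conv (\<lambda>_. t m) z z'}"
  have SE: "S \<subseteq> carrier E" using HE by (auto simp: S_def)
  have Sconv: "conv f z1 z2 \<in> S"
    if z1: "z1 \<in> S" and z2: "z2 \<in> S" and f: "f \<in> borel_measurable M" "AE w in M. 0 \<le> f w \<and> f w \<le> 1" for z1 z2 f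
  proof -
    obtain n1 where n1: "\<And>m. m \<ge> n1 \<Longrightarrow> \<exists>z'\<in>H. c m = conv (\<lambda>_. t m) z1 z'" using z1 unfolding S_def by blast
    obtain n2 where n2: "\<And>m. m \<ge> n2 \<Longrightarrow> \<exists>z'\<in>H. c m = conv (\<lambda>_. t m) z2 z'" using z2 unfolding S_def by blast
    have "\<exists>z'\<in>H. c m = conv (\<lambda>_. t m) (conv f z1 z2) z'" if m: "m \<ge> max n1 n2" for m
    proof -
      obtain z1' where z1': "z1' \<in> H" "c m = conv (\<lambda>_. t m) z1 z1'" using n1[of m] m by auto
      obtain z2' where z2': "z2' \<in> H" "c m = conv (\<lambda>_. t m) z2 z2'" using n2[of m] m by auto
      have E: "z1 \<in> carrier E" "z2 \<in> carrier E" "z1' \<in> carrier E" "z2' \<in> carrier E"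
        using z1 z2 z1' z2' HE by (auto simp: S_def)
      have "c m = conv f (c m) (c m)" using conv_same[OF f(1) HE[OF cnH]] by simp
      also have "\<dots> = conv f (conv (\<lambda>_. t m) z1 z1') (conv (\<lambda>_. t m) z2 z2')" using z1'(2) z2'(2) by simp
      also have "\<dots> = conv (\<lambda>_. t m) (conv f z1 z2) (conv f z1' z2')"
        by (insert E f(1), rule_tac is_lc_eq[of z1 z2 z1' z2'], (rule is_lc_intros | (simp add: algebra_simps; fail))+)
      finally show ?thesis using ccl_conv[OF cH z1'(1) z2'(1) f] by blast
    qed
    moreover have "conv f z1 z2 \<in> H" using z1 z2 by (intro ccl_conv[OF cH _ _ f]) (auto simp: S_def)
    ultimately show ?thesis unfolding S_def by blast
  qed
  have yS: "y i \<in> S" for i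
  proof -
    have "\<exists>z'\<in>H. c m = conv (\<lambda>_. t m) (y i) z'" if "m \<ge> i" for m
      using that
    proof (induction m rule: dec_induct)
      case base
      show ?case
      proof (cases i)
        case 0
        have "c i = conv (\<lambda>_. t i) (y i) (y i)" using conv_same[of "\<lambda>_. t i" "y i"] HE[OF yH] by (simp add: 0 c0)
        then show ?thesis using yH by blast
      next
        case (Suc j)
        have ti: "t i \<le> 1/2" "0 < t i" using t(3)[of j] t(1)[of i] Suc by auto
        have E: "y i \<in> carrier E" "c j \<in> carrier E" using HE yH cnH by auto
        \<comment> \<open>The remaining weight \<open>1/2 - t i\<close> of \<open>y i\<close>, relative to \<open>1 - t i\<close>.\<close>
        define s where "s = (1/2 - t i) / (1 - t i)"
        have s: "(1 - t i) * s = 1/2 - t i" "0 \<le> s" "s \<le> 1" using ti by (auto simp: s_def field_simps)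
        have s': "(1 - t i) * (1 - s) = 1/2" using s(1) by (simp add: algebra_simps)
        have "c i = conv (\<lambda>_. 1/2) (y i) (c j)" using cS[of j] Suc by simp
        also have "\<dots> = conv (\<lambda>_. t i) (y i) (conv (\<lambda>_. s) (y i) (c j))"
          by (insert E s(1) s', rule_tac is_lc_eq[of "y i" "c j" "c j" "c j"], (rule is_lc_intros | (simp; fail))+)
        finally have eq: "c i = conv (\<lambda>_. t i) (y i) (conv (\<lambda>_. s) (y i) (c j))" .
        have "conv (\<lambda>_. s) (y i) (c j) \<in> H"
          by (rule ccl_conv[OF cH yH cnH]) (use s in auto)
        then show ?thesis using eq by blast
      qed
    next
      case (step m)
      then obtain z' where z': "z' \<in> H" "c m = conv (\<lambda>_. t m) (y i) z'" by blast
      have tm: "0 < t m" "t m \<le> 1" using t by auto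
      have E: "y i \<in> carrier E" "y (Suc m) \<in> carrier E" "z' \<in> carrier E" using HE yH z' by auto
      \<comment> \<open>The weight \<open>1/2\<close> of the new point, relative to what the halved weight of \<open>y i\<close> leaves.\<close>
      define s where "s = (1/2) / (1 - t m / 2)"
      have s: "(1 - t m / 2) * s = 1/2" "0 \<le> s" "s \<le> 1" using tm by (auto simp: s_def field_simps)
      have s': "(1 - t m / 2) * (1 - s) = (1 - t m) / 2"
        unfolding right_diff_distrib[of "1 - t m / 2"] s(1) by (simp add: diff_divide_distrib)
      have "c (Suc m) = conv (\<lambda>_. 1/2) (y (Suc m)) (conv (\<lambda>_. t m) (y i) z')" using cS z'(2) by simp
      also have "\<dots> = conv (\<lambda>_. t m / 2) (y i) (conv (\<lambda>_. s) (y (Suc m)) z')"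
        by (insert E s(1) s', rule_tac is_lc_eq[of "y i" "y (Suc m)" z' z'], (rule is_lc_intros | (simp; fail))+)
      finally have eq: "c (Suc m) = conv (\<lambda>_. t (Suc m)) (y i) (conv (\<lambda>_. s) (y (Suc m)) z')" by (simp add: t(4))
      have "conv (\<lambda>_. s) (y (Suc m)) z' \<in> H"
        by (rule ccl_conv[OF cH yH z'(1)]) (use s in auto)
      then show ?case using eq by blast
    qed
    then show ?thesis using yH unfolding S_def by blast
  qed
  have HS: "H \<subseteq> eps_lam_topology M E closure_of S"
  proof (rule HX)
    show "ccl (eps_lam_topology M E closure_of S)" by (rule closure_ccl[OF SE Sconv])
    show "y n \<in> eps_lam_topology M E closure_of S" for n using closure_subset[OF SE] yS by blast
  qed
  have Sdiam: "AE w\<in>B in M. ereal (r w) \<le> h w"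
    if z: "z \<in> S" and h: "\<And>u. u \<in> H \<Longrightarrow> AE w in M. ereal (dst z u w) \<le> h w" for z h
  proof -
    have zH: "z \<in> H" and zE: "z \<in> carrier E" using z HE by (auto simp: S_def)
    obtain n where n: "\<And>m. m \<ge> n \<Longrightarrow> \<exists>z'\<in>H. c m = conv (\<lambda>_. t m) z z'" using z unfolding S_def by blast
    have "AE w\<in>B in M. ereal ((1 - t (Suc (n + k))) * r w) \<le> h w" for k
    proof -
      let ?m = "n + k"
      obtain z' where z': "z' \<in> H" "c ?m = conv (\<lambda>_. t ?m) z z'" using n[of ?m] by auto
      have E: "y (Suc ?m) \<in> carrier E" "z' \<in> carrier E" "c ?m \<in> carrier E" using HE[OF yH] HE[OF z'(1)] HE[OF cnH] by blast+
      have "AE w in M. dst (c ?m) (y (Suc ?m)) w \<le> \<bar>t ?m\<bar> * dst z (y (Suc ?m)) w + \<bar>1 - t ?m\<bar> * dst z' (y (Suc ?m)) w"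
        unfolding z'(2) using E zE by (intro dst_conv) auto
      then show ?thesis using ge[of ?m] h[OF yH[of "Suc ?m"]] HH[OF z'(1) yH[of "Suc ?m"]] dst_sym[OF E(1,3)]
      proof eventually_elim
        case (elim w)
        show ?case
        proof
          assume w: "w \<in> B"
          have tm: "0 < t ?m" "t ?m \<le> 1" using t by auto
          have "(1 - t ?m) * dst z' (y (Suc ?m)) w \<le> (1 - t ?m) * r w"
            using elim(4) w tm by (intro mult_left_mono) (auto simp: R_def)
          then have "(1 - 2 * (1/4)^Suc ?m) * r w \<le> t ?m * dst z (y (Suc ?m)) w + (1 - t ?m) * r w"
            using elim(1,2,5) w tm by auto
          moreover have "2 * (1/4::real)^Suc ?m = t ?m * t (Suc ?m)"
            unfolding t_def by (simp add: power_mult_distrib[symmetric])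
          ultimately have "t ?m * ((1 - t (Suc ?m)) * r w) \<le> t ?m * dst z (y (Suc ?m)) w"
            by (simp add: algebra_simps)
          then have "(1 - t (Suc ?m)) * r w \<le> dst z (y (Suc ?m)) w" using tm by simp
          then have "ereal ((1 - t (Suc ?m)) * r w) \<le> ereal (dst z (y (Suc ?m)) w)" by simp
          also have "\<dots> \<le> h w" by (rule elim(3))
          finally show "ereal ((1 - t (Suc ?m)) * r w) \<le> h w" .
        qed
      qed
    qed
    then have "AE w in M. \<forall>k. w \<in> B \<longrightarrow> ereal ((1 - t (Suc (n + k))) * r w) \<le> h w" unfolding AE_all_countable by blast
    then show ?thesis
    proof eventually_elim
      case (elim w)
      show ?case
      proof
        assume w: "w \<in> B"
        have "(\<lambda>k. (1 / 2 :: real)^k) \<longlonglongrightarrow> 0" by (rule LIMSEQ_realpow_zero) auto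
        then have "(\<lambda>k. t (k + Suc n)) \<longlonglongrightarrow> 0" unfolding t_def by (rule LIMSEQ_ignore_initial_segment)
        then have "(\<lambda>k. (1 - t (k + Suc n)) * r w) \<longlonglongrightarrow> (1 - 0) * r w" by (intro tendsto_intros)
        then have lim: "(\<lambda>k. ereal ((1 - t (k + Suc n)) * r w)) \<longlonglongrightarrow> ereal (r w)" by simp
        have "ereal ((1 - t (k + Suc n)) * r w) \<le> h w" for k
          using elim w by (simp add: add.commute)
        then show "ereal (r w) \<le> h w" by (intro LIMSEQ_le_const2[OF lim]) blast
      qed
    qed
  qed
  have Hdiam: "AE w\<in>B in M. ereal (r w) \<le> h w"
    if z: "z \<in> H" and h: "\<And>u. u \<in> H \<Longrightarrow> AE w in M. ereal (dst z u w) \<le> h w" for z h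
  proof -
    have zE: "z \<in> carrier E" using z HE by blast
    obtain x where x: "range x \<subseteq> S" "tends x z" using HS z closure_iff_seq[OF SE] by blast
    have xS: "x k \<in> S" for k using x(1) by blast
    have xE: "x k \<in> carrier E" for k using xS SE by blast
    have "AE w\<in>B in M. ereal (r w) \<le> ereal (dst (x k) z w) + h w" for k
    proof (rule Sdiam[OF xS])
      fix u assume u: "u \<in> H"
      show "AE w in M. ereal (dst (x k) u w) \<le> ereal (dst (x k) z w) + h w"
        using dst_triangle[OF xE zE HE[OF u], of k] h[OF u]
      proof eventually_elim
        case (elim w)
        have "ereal (dst (x k) u w) \<le> ereal (dst (x k) z w) + ereal (dst z u w)" using elim by simp
        also have "\<dots> \<le> ereal (dst (x k) z w) + h w" using elim by (intro add_left_mono)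
        finally show ?case .
      qed
    qed
    then have "AE w in M. \<forall>k. w \<in> B \<longrightarrow> ereal (r w) \<le> ereal (dst (x k) z w) + h w" unfolding AE_all_countable by blast
    then show ?thesis using x(2) unfolding tends_def
    proof eventually_elim
      case (elim w)
      show ?case
      proof
        assume w: "w \<in> B"
        show "ereal (r w) \<le> h w"
        proof (cases "h w")
          case (real a)
          have "r w \<le> dst (x k) z w + a" for k using elim(1) w by (simp add: real)
          moreover have "(\<lambda>k. dst (x k) z w + a) \<longlonglongrightarrow> 0 + a" using elim(2) by (intro tendsto_intros)
          ultimately have "r w \<le> 0 + a" by (intro LIMSEQ_le_const) auto
          then show ?thesis by (simp add: real)
        qed (use elim(1) w in auto)
      qed
    qed
  qed
  show thesis
    by (rule that[OF WH cH _ _ Hdiam]) (use yH HH in \<open>auto simp: R_def\<close>)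
qed

lemma patch_patch_dst:
  assumes "A \<in> events" "x \<in> carrier E" "x' \<in> carrier E" "p \<in> carrier E"
  shows "AE w in M. dst (patch A x p) (patch A x' p) w = indicator A w * dst x x' w"
proof -
  have "patch A x p \<ominus> patch A x' p = rsm (indicator A) (x \<ominus> x')" unfolding patch_def
    by (insert assms, rule_tac is_lc_eq[of x x' p p], (rule is_lc_intros | (simp add: algebra_simps; fail))+)
  then show ?thesis using nrm_rsm[of "indicator A" "x \<ominus> x'"] assms by (simp add: dst_def)
qed

text \<open>
  On \<open>B1\<close> the diameter of \<open>H\<close> is exactly \<open>r > 0\<close> and every point of \<open>H\<close> has radius at least \<open>r\<close>.
\<close>

lemma no_diametral_subset:
  assumes rns: "random_normal_structure M E G" and bG: "as_bounded M E G"
    and H: "H \<subseteq> G" "ccl H" "H \<noteq> {}" and B1: "B1 \<in> events" and B1pos: "prob B1 > 0"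
    and r: "r \<in> borel_measurable M" and rpos: "\<And>w. w \<in> B1 \<Longrightarrow> 0 < r w"
    and Hle: "\<And>u v. u \<in> H \<Longrightarrow> v \<in> H \<Longrightarrow> AE w in M. dst u v w \<le> (if w \<in> B1 then r w else 0)"
    and Hge: "\<And>z h. z \<in> H \<Longrightarrow> (\<And>u. u \<in> H \<Longrightarrow> AE w in M. ereal (dst z u w) \<le> h w) \<Longrightarrow>
      AE w\<in>B1 in M. ereal (r w) \<le> h w"
  shows False
proof -
  have HE: "H \<subseteq> carrier E" by (rule ccl_sub[OF H(2)])
  note Dm = diam_measurable[OF HE H(3)] and Dup = diam_upper[OF HE]
  have Dle: "AE w in M. diam H w \<le> ereal (if w \<in> B1 then r w else 0)"
  proof (rule diam_least[OF HE H(3)])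
    show "(\<lambda>w. ereal (if w \<in> B1 then r w else 0)) \<in> borel_measurable M" using B1 r by simp
    fix u v assume uv: "u \<in> H" "v \<in> H"
    from Hle[OF uv] show "AE w in M. ereal (dst u v w) \<le> ereal (if w \<in> B1 then r w else 0)"
      by eventually_elim simp
  qed
  obtain z0 where z0: "z0 \<in> H" using H(3) by blast
  have Dge: "AE w\<in>B1 in M. ereal (r w) \<le> diam H w" by (rule Hge[OF z0]) (rule Dup[OF z0])
  have D0: "AE w in M. 0 \<le> diam H w" using Dup[OF z0 z0]
    by eventually_elim (use dst_nonneg order_trans zero_ereal_def ereal_less_eq(3) in metis)
  have notnull: "\<not> (AE w in M. w \<notin> B1)" using B1pos prob_eq_0[OF B1] by simp
  have "L0_class M (\<lambda>_. 0) \<noteq> L0_class M (diam H)"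
  proof
    assume "L0_class M (\<lambda>_. 0) = L0_class M (diam H)"
    then have "AE w in M. 0 = diam H w" using Dm by (simp add: L0_class_eq_iff)
    then have "AE w in M. w \<notin> B1" using Dge
    proof eventually_elim
      case (elim w)
      show ?case
      proof
        assume w: "w \<in> B1"
        then have "ereal (r w) \<le> ereal 0" using elim by simp
        then show False using rpos[OF w] by simp
      qed
    qed
    then show False using notnull by blast
  qed
  then have "L0_less M (L0_class M (\<lambda>_. 0)) (rdiam M E H)"
    unfolding L0_less_def rdiam_eq[OF HE H(3)] using D0 Dm by (simp add: L0_le_class)
  moreover have "as_bounded M E H" using bG H HE unfolding as_bounded_iff by blast
  ultimately obtain z where z: "z \<in> H" "L0_less_on M (L0_less_event M (L0_class M (\<lambda>_. 0)) (rdiam M E H))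
      (cheb_rad_at M E H z) (rdiam M E H)"
    using rns H(1,2) unfolding random_normal_structure_def ccl_def by blast
  have zE: "z \<in> carrier E" using z(1) HE by blast
  have zm: "rad H z \<in> borel_measurable M" by (rule rad_measurable[OF HE H(3) zE])
  have "AE w in M. w \<in> L0_less_event M (L0_class M (\<lambda>_. 0)) (rdiam M E H) \<longrightarrow> rad H z w < diam H w"
    using z(2) zm Dm unfolding cheb_rad_at_eq[OF HE H(3) zE] rdiam_eq[OF HE H(3)] by (simp add: L0_less_on_class)
  moreover note diam_event[OF HE H(3)]
  moreover have "AE w\<in>B1 in M. ereal (r w) \<le> rad H z w"
    by (rule Hge[OF z(1)]) (rule rad_upper[OF HE zE])
  ultimately have "AE w in M. w \<notin> B1" using Dge Dle
  proof eventually_elim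
    case (elim w)
    show ?case
    proof
      assume w: "w \<in> B1"
      have "ereal 0 < ereal (r w)" using rpos[OF w] by simp
      then have "0 < diam H w" using elim(4) w unfolding zero_ereal_def by (meson less_le_trans)
      then have "rad H z w < diam H w" using elim(1,2) by blast
      also have "diam H w \<le> ereal (r w)" using elim(5) w by simp
      also have "\<dots> \<le> rad H z w" using elim(3) w by blast
      finally show False by simp
    qed
  qed
  then show False using notnull by blast
qed

text \<open>
  The random form of Lim's construction.  The family \<open>\<V>\<close> abstracts a decreasing net, and \<open>approx\<close> is what
  density of the centres on \<open>B\<close> provides.  Restricting to an event where \<open>r\<close> has a constant lower bound \<open>\<rho>\<close> makes all
  tolerances deterministic; the exceptional events of the countably many steps together cost less than that event.
\<close>

lemma net_not_dense:
  assumes rns: "random_normal_structure M E G" and bG: "as_bounded M E G"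
    and W: "ccl W" "W \<subseteq> G" and pW: "p \<in> W"
    and r: "r \<in> borel_measurable M" "AE w in M. 0 \<le> r w"
    and p: "\<And>y. y \<in> W \<Longrightarrow> AE w in M. dst y p w \<le> r w"
    and B: "B \<in> events" "prob B > 0" "AE w\<in>B in M. 0 < r w"
    and V: "\<V> \<noteq> {}" "\<And>V. V \<in> \<V> \<Longrightarrow> sigma_stable M E V" "\<And>V. V \<in> \<V> \<Longrightarrow> V \<subseteq> W"
      "\<And>V. V \<in> \<V> \<Longrightarrow> cheb_rad M E V W = L0_class M (\<lambda>w. ereal (r w))"
      "\<And>U V. U \<in> \<V> \<Longrightarrow> V \<in> \<V> \<Longrightarrow> \<exists>T\<in>\<V>. T \<subseteq> U \<inter> V"
    and approx: "\<And>y e. y \<in> W \<Longrightarrow> e > 0 \<Longrightarrow> \<exists>V\<in>\<V>. \<exists>N\<in>events. prob N < e \<and>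
      (\<forall>v\<in>V. AE w in M. w \<in> B \<and> w \<notin> N \<longrightarrow> dst y v w \<le> r w + e)"
  shows False
proof -
  have WE: "W \<subseteq> carrier E" by (rule ccl_sub[OF W(1)])
  have xE: "x \<in> carrier E" if "x \<in> W" for x using WE that by blast
  have pE: "p \<in> carrier E" by (rule xE[OF pW])
  obtain \<rho> B0 where \<rho>: "0 < \<rho>" and B0: "B0 \<in> events" "prob B0 > 0" "B0 \<subseteq> B" "\<And>w. w \<in> B0 \<Longrightarrow> \<rho> \<le> r w"
  proof -
    define Bk where "Bk k = B \<inter> {w \<in> space M. 1 / real (Suc k) \<le> r w}" for k
    have Bke: "Bk k \<in> events" for k unfolding Bk_def using B(1) r(1) by simp
    have "\<exists>k. prob (Bk k) > 0"
    proof (rule ccontr)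
      assume "\<not> ?thesis"
      then have "prob (Bk k) = 0" for k using measure_nonneg[of M "Bk k"] by (meson antisym not_le)
      then have "AE w in M. w \<notin> Bk k" for k using Bke[of k] prob_eq_0 by blast
      then have "AE w in M. \<forall>k. w \<notin> Bk k" by (simp add: AE_all_countable)
      then have "AE w in M. w \<notin> B" using B(3) AE_space
      proof eventually_elim
        case (elim w)
        show ?case
        proof
          assume w: "w \<in> B"
          then obtain k where "1 / real (Suc k) < r w" using elim(2) nat_approx_posE by blast
          then have "w \<in> Bk k" using w elim(3) by (simp add: Bk_def)
          then show False using elim(1) by blast
        qed
      qed
      then show False using B(2) prob_eq_0[OF B(1)] by simp
    qed
    then obtain k where "prob (Bk k) > 0" by blast
    then show thesis using that[of "1 / real (Suc k)" "Bk k"] Bke[of k] by (auto simp: Bk_def)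
  qed
  define \<beta> where "\<beta> = prob B0"
  have fin: "\<exists>V\<in>\<V>. \<exists>N\<in>events. prob N < e \<and> (\<forall>y\<in>Y. \<forall>v\<in>V. AE w in M. w \<in> B0 \<and> w \<notin> N \<longrightarrow> dst y v w \<le> r w + d)"
    if "finite Y" "Y \<subseteq> W" "d > 0" "e > 0" for Y d e
    using that
  proof (induction Y arbitrary: e rule: finite_induct)
    case empty
    obtain V0 where "V0 \<in> \<V>" using V(1) by blast
    then show ?case using empty.prems by (intro bexI[of _ V0] bexI[of _ "{}"]) auto
  next
    case (insert y Y)
    obtain V1 N1 where 1: "V1 \<in> \<V>" "N1 \<in> events" "prob N1 < min d (e/2)"
      "\<And>v. v \<in> V1 \<Longrightarrow> AE w in M. w \<in> B \<and> w \<notin> N1 \<longrightarrow> dst y v w \<le> r w + min d (e/2)"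
      using approx[of y "min d (e/2)"] insert.prems by auto
    obtain V2 N2 where 2: "V2 \<in> \<V>" "N2 \<in> events" "prob N2 < e/2"
      "\<And>u v. u \<in> Y \<Longrightarrow> v \<in> V2 \<Longrightarrow> AE w in M. w \<in> B0 \<and> w \<notin> N2 \<longrightarrow> dst u v w \<le> r w + d"
      using insert.IH[of "e/2"] insert.prems by auto
    obtain V3 where V3: "V3 \<in> \<V>" "V3 \<subseteq> V1 \<inter> V2" using V(5)[OF 1(1) 2(1)] by blast
    have "prob (N1 \<union> N2) \<le> prob N1 + prob N2" by (rule measure_Un_le[OF 1(2) 2(2)])
    then have "prob (N1 \<union> N2) < e" using 1(3) 2(3) by linarith
    moreover have "AE w in M. w \<in> B0 \<and> w \<notin> N1 \<union> N2 \<longrightarrow> dst u v w \<le> r w + d" if "u \<in> insert y Y" "v \<in> V3" for u v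
    proof (cases "u = y")
      case True
      have "v \<in> V1" using that V3 by blast
      from 1(4)[OF this] show ?thesis unfolding True by eventually_elim (use B0(3) in auto)
    next
      case False
      have "u \<in> Y" "v \<in> V2" using that V3 False by auto
      from 2(4)[OF this] show ?thesis by eventually_elim auto
    qed
    ultimately show ?case using V3(1) 1(2) 2(2) by (intro bexI[of _ V3] bexI[of _ "N1 \<union> N2"]) auto
  qed
  have step: "\<exists>y\<in>W. \<exists>N\<in>events. prob N < e \<and> (AE w\<in>B0 in M. dst y p w \<le> (1 - \<sigma>) * r w) \<and>
      (\<forall>u\<in>Y. AE w in M. w \<in> B0 \<and> w \<notin> N \<longrightarrow> dst y u w \<le> r w) \<and>
      (AE w\<in>B0 in M. (1 - 2 * \<sigma>) * r w \<le> dst y c w)"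
    if Y: "finite Y" "Y \<subseteq> W" and c: "c \<in> W" and s: "0 < s" "s \<le> 1" and \<sigma>: "0 < \<sigma>" "\<sigma> < 1" and e: "e > 0"
      and Yp: "\<And>u. u \<in> Y \<Longrightarrow> AE w\<in>B0 in M. dst u p w \<le> (1 - s) * r w" for Y c s \<sigma> e
  proof -
    \<comment> \<open>The pull towards \<open>p\<close> by \<open>\<sigma>\<close> gains at least \<open>\<sigma> s r\<close> against each earlier point, because these already lie
      within \<open>(1 - s) r\<close> of \<open>p\<close>; this pays for the error \<open>d \<le> \<sigma> s r\<close>.\<close>
    define d where "d = \<sigma> * s * \<rho>"
    have d: "0 < d" using \<sigma> s \<rho> by (simp add: d_def)
    have dr: "d \<le> \<sigma> * s * r w" "\<sigma> * s * r w \<le> \<sigma> * r w" if "w \<in> B0" for w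
    proof -
      show "d \<le> \<sigma> * s * r w" unfolding d_def using B0(4)[OF that] \<sigma> s by (intro mult_left_mono) auto
      have "0 \<le> r w" using B0(4)[OF that] \<rho> by linarith
      then have "s * r w \<le> 1 * r w" using s by (intro mult_right_mono) auto
      then show "\<sigma> * s * r w \<le> \<sigma> * r w" using \<sigma> mult_left_mono[of "s * r w" "r w" \<sigma>] by (simp add: mult.assoc)
    qed
    obtain V N where VN: "V \<in> \<V>" "N \<in> events" "prob N < e"
      "\<And>u v. u \<in> Y \<Longrightarrow> v \<in> V \<Longrightarrow> AE w in M. w \<in> B0 \<and> w \<notin> N \<longrightarrow> dst u v w \<le> r w + d"
      using fin[OF Y d e] by auto
    obtain x where x: "x \<in> V" "AE w in M. r w - d \<le> dst x c w"
      using far_point[OF V(2)[OF VN(1)] WE c r(1) V(4)[OF VN(1)] d] by blast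
    have xW: "x \<in> W" using x(1) V(3)[OF VN(1)] by blast
    have cE: "c \<in> carrier E" and xc: "x \<in> carrier E" using c xW xE by auto
    let ?y = "conv (\<lambda>_. 1 - \<sigma>) x p"
    have yW: "?y \<in> W" using \<sigma> by (intro ccl_conv[OF W(1) xW pW]) auto
    have yE: "?y \<in> carrier E" by (rule xE[OF yW])
    note dx = dst_conv[of "\<lambda>_. 1 - \<sigma>", OF _ xc pE]
    have yp: "AE w\<in>B0 in M. dst ?y p w \<le> (1 - \<sigma>) * r w"
    proof -
      have "AE w in M. dst ?y p w \<le> \<bar>1 - \<sigma>\<bar> * dst x p w + \<bar>1 - (1 - \<sigma>)\<bar> * dst p p w" using pE by (intro dx) auto
      then show ?thesis using p[OF xW] dst_self[OF pE]
      proof eventually_elim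
        case (elim w)
        have "(1 - \<sigma>) * dst x p w \<le> (1 - \<sigma>) * r w" using elim(2) \<sigma> by (intro mult_left_mono) auto
        moreover have "dst ?y p w \<le> (1 - \<sigma>) * dst x p w" using elim(1,3) \<sigma> by simp
        ultimately show ?case by linarith
      qed
    qed
    have yu: "AE w in M. w \<in> B0 \<and> w \<notin> N \<longrightarrow> dst ?y u w \<le> r w" if u: "u \<in> Y" for u
    proof -
      have uE: "u \<in> carrier E" using u Y xE by blast
      have "AE w in M. dst ?y u w \<le> \<bar>1 - \<sigma>\<bar> * dst x u w + \<bar>1 - (1 - \<sigma>)\<bar> * dst p u w" using uE by (intro dx) auto
      then show ?thesis using VN(4)[OF u x(1)] Yp[OF u] dst_sym[OF xc uE] dst_sym[OF pE uE]
      proof eventually_elim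
        case (elim w)
        show ?case
        proof
          assume w: "w \<in> B0 \<and> w \<notin> N"
          have "(1 - \<sigma>) * dst x u w \<le> (1 - \<sigma>) * (r w + d)" using elim w \<sigma> by (intro mult_left_mono) auto
          moreover have "\<sigma> * dst p u w \<le> \<sigma> * ((1 - s) * r w)" using elim w \<sigma> by (intro mult_left_mono) auto
          moreover have "dst ?y u w \<le> (1 - \<sigma>) * dst x u w + \<sigma> * dst p u w" using elim(1) \<sigma> by simp
          ultimately have "dst ?y u w \<le> (1 - \<sigma>) * (r w + d) + \<sigma> * ((1 - s) * r w)" by linarith
          also have "\<dots> = r w + (d - \<sigma> * s * r w) - \<sigma> * d" by (simp add: algebra_simps)
          also have "\<dots> \<le> r w"
            using dr(1)[of w] w mult_pos_pos[OF \<sigma>(1) d] by linarith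
          finally show "dst ?y u w \<le> r w" .
        qed
      qed
    qed
    have yc: "AE w\<in>B0 in M. (1 - 2 * \<sigma>) * r w \<le> dst ?y c w"
    proof -
      have "AE w in M. dst ?y x w \<le> \<bar>1 - (1 - \<sigma>)\<bar> * dst x p w" using xc pE by (intro dst_conv_left) auto
      then show ?thesis using x(2) p[OF xW] dst_triangle[OF xc yE cE] dst_sym[OF xc yE]
      proof eventually_elim
        case (elim w)
        show ?case
        proof
          assume w: "w \<in> B0"
          have "\<sigma> * dst x p w \<le> \<sigma> * r w" using elim(3) \<sigma> by (intro mult_left_mono) auto
          moreover have "dst ?y x w \<le> \<sigma> * dst x p w" using elim(1) \<sigma> by simp
          ultimately have "dst x ?y w \<le> \<sigma> * r w" using elim(5) by linarith
          then have "r w - d - \<sigma> * r w \<le> dst ?y c w" using elim(2,4) by linarith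
          moreover have "d \<le> \<sigma> * r w" using dr[OF w] by linarith
          ultimately show "(1 - 2 * \<sigma>) * r w \<le> dst ?y c w" by (simp add: algebra_simps)
        qed
      qed
    qed
    show ?thesis using yW VN(2,3) yp yu yc by blast
  qed
  \<comment> \<open>A state records the points chosen so far, the last of them, the dyadic mean and the exceptional event of the
    last step.  The margin \<open>4\<^sup>-\<^sup>n\<close> beats the weight \<open>2\<^sup>-\<^sup>n\<close> with which the earliest points enter the mean.\<close>
  define P where "P n st \<longleftrightarrow> (case st of (Y, y, c, N) \<Rightarrow> finite Y \<and> Y \<subseteq> W \<and> y \<in> Y \<and> c \<in> W \<and> N \<in> events \<and>
      prob N \<le> \<beta> / 4 * (1/2)^n \<and> (\<forall>u\<in>Y. AE w\<in>B0 in M. dst u p w \<le> (1 - (1/4)^n) * r w))"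
    for n :: nat and st :: "'e set \<times> 'e \<times> 'e \<times> 'w set"
  define Q where "Q n st st' \<longleftrightarrow> (case st of (Y, y, c, N) \<Rightarrow> case st' of (Y', y', c', N') \<Rightarrow>
      Y' = insert y' Y \<and> c' = conv (\<lambda>_. 1/2) y' c \<and> (\<forall>u\<in>Y. AE w in M. w \<in> B0 \<and> w \<notin> N' \<longrightarrow> dst y' u w \<le> r w) \<and>
      (AE w\<in>B0 in M. (1 - 2 * (1/4)^Suc n) * r w \<le> dst y' c w))"
    for n :: nat and st st' :: "'e set \<times> 'e \<times> 'e \<times> 'w set"
  have "\<exists>st. (\<forall>n. P n (st n) \<and> Q n (st n) (st (Suc n))) \<and> st 0 = ({p}, p, p, {})"
  proof -
    have base: "P 0 ({p}, p, p, {})"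
      using dst_self[OF pE] pW B0(2) unfolding P_def by (auto simp: \<beta>_def elim: AE_mp)
    have nxt: "\<exists>st'. P (Suc n) st' \<and> Q n st st'" if Pst: "P n st" for st n
    proof -
      obtain Y y c N where st: "st = (Y, y, c, N)" by (metis prod_cases4)
      have Y: "finite Y" "Y \<subseteq> W" "c \<in> W" and Yp: "\<And>u. u \<in> Y \<Longrightarrow> AE w\<in>B0 in M. dst u p w \<le> (1 - (1/4)^n) * r w"
        using Pst by (auto simp: P_def st)
      have pw: "(0::real) < (1/4)^n" "(1/4::real)^n \<le> 1" "(0::real) < (1/4)^Suc n" "(1/4::real)^Suc n < 1" "(1/4::real)^Suc n \<le> (1/4)^n"
      proof -
        have q: "(0::real) < (1/4)^n" "(1/4::real)^n \<le> 1" by (auto simp: power_le_one)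
        then show "(0::real) < (1/4)^n" "(1/4::real)^n \<le> 1" "(0::real) < (1/4)^Suc n" "(1/4::real)^Suc n < 1"
          "(1/4::real)^Suc n \<le> (1/4)^n"
          unfolding power_Suc by linarith+
      qed
      have "0 < \<beta> / 4 * (1/2)^Suc n" using B0(2) by (simp add: \<beta>_def)
      then obtain y' N' where y': "y' \<in> W" "N' \<in> events" "prob N' < \<beta> / 4 * (1/2)^Suc n"
        "AE w\<in>B0 in M. dst y' p w \<le> (1 - (1/4)^Suc n) * r w"
        "\<forall>u\<in>Y. AE w in M. w \<in> B0 \<and> w \<notin> N' \<longrightarrow> dst y' u w \<le> r w"
        "AE w\<in>B0 in M. (1 - 2 * (1/4)^Suc n) * r w \<le> dst y' c w"
        using step[OF Y pw(1-4) _ Yp, of "\<beta> / 4 * (1/2)^Suc n"] by blast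
      have "AE w\<in>B0 in M. dst u p w \<le> (1 - (1/4)^Suc n) * r w" if "u \<in> insert y' Y" for u
      proof (cases "u = y'")
        case False
        then have "u \<in> Y" using that by blast
        from Yp[OF this] show ?thesis using r(2)
        proof eventually_elim
          case (elim w)
          have "(1 - (1/4)^n) * r w \<le> (1 - (1/4)^Suc n) * r w" using pw(5) elim(2) by (intro mult_right_mono) auto
          then show ?case using elim(1) by linarith
        qed
      qed (use y'(4) in simp)
      moreover have "conv (\<lambda>_. 1/2) y' c \<in> W" by (rule ccl_conv[OF W(1) y'(1) Y(3)]) auto
      ultimately have "P (Suc n) (insert y' Y, y', conv (\<lambda>_. 1/2) y' c, N')"
        using Y y'(1-3) by (auto simp: P_def)
      moreover have "Q n st (insert y' Y, y', conv (\<lambda>_. 1/2) y' c, N')"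
        using y'(5,6) by (simp add: Q_def st)
      ultimately show ?thesis by blast
    qed
    have nxt': "\<exists>st'. (P (Suc n) st' \<and> (Suc n = 0 \<longrightarrow> st' = ({p}, p, p, {}))) \<and> Q n st st'"
      if "P n st \<and> (n = 0 \<longrightarrow> st = ({p}, p, p, {}))" for n st
      using nxt[of n st] that by auto
    show ?thesis
      using dependent_nat_choice[of "\<lambda>n st. P n st \<and> (n = 0 \<longrightarrow> st = ({p}, p, p, {}))" Q, OF _ nxt'] base by blast
  qed
  then obtain st where st: "\<And>n. P n (st n)" "\<And>n. Q n (st n) (st (Suc n))" "st 0 = ({p}, p, p, {})" by blast
  define Y y c N where "Y n = fst (st n)" and "y n = fst (snd (st n))" and "c n = fst (snd (snd (st n)))"
    and "N n = snd (snd (snd (st n)))" for n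
  have stn: "st n = (Y n, y n, c n, N n)" for n by (simp add: Y_def y_def c_def N_def)
  have Pn: "Y n \<subseteq> W" "y n \<in> Y n" "c n \<in> W" "N n \<in> events" "prob (N n) \<le> \<beta> / 4 * (1/2)^n" for n
    using st(1)[of n] unfolding stn P_def by auto
  have Qn: "Y (Suc n) = insert (y (Suc n)) (Y n)" "c (Suc n) = conv (\<lambda>_. 1/2) (y (Suc n)) (c n)"
    "\<And>u. u \<in> Y n \<Longrightarrow> AE w in M. w \<in> B0 \<and> w \<notin> N (Suc n) \<longrightarrow> dst (y (Suc n)) u w \<le> r w"
    "AE w\<in>B0 in M. (1 - 2 * (1/4)^Suc n) * r w \<le> dst (y (Suc n)) (c n) w" for n
    using st(2)[of n] unfolding stn Q_def by auto
  have c0: "c 0 = y 0" using st(3) by (simp add: y_def c_def)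
  have yY: "y m \<in> Y n" if "m \<le> n" for m n
    using that by (induction n) (use Pn(2) Qn(1) le_Suc_eq in auto)
  have yE: "y n \<in> carrier E" and cE: "c n \<in> carrier E" and yW: "y n \<in> W" for n using Pn xE by blast+
  define B1 where "B1 = B0 - (\<Union>n. N n)"
  have B1: "B1 \<in> events" unfolding B1_def using B0 Pn(4) by auto
  have "prob (\<Union>n. N n) \<le> \<beta> / 2"
  proof -
    have geo: "(\<lambda>n. \<beta> / 4 * (1/2)^n) sums (\<beta> / 4 * 2)"
      using geometric_sums[of "1/2::real"] by (intro sums_mult) simp
    have sm: "summable (\<lambda>n. prob (N n))"
      by (rule summable_comparison_test[OF _ sums_summable[OF geo]]) (use Pn(5) in auto)
    have "prob (\<Union>n. N n) \<le> (\<Sum>n. prob (N n))" using Pn(4) sm by (intro finite_measure_subadditive_countably) auto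
    also have "\<dots> \<le> (\<Sum>n. \<beta> / 4 * (1/2)^n)" using Pn(5) sm sums_summable[OF geo] by (intro suminf_le)
    also have "\<dots> = \<beta> / 2" using sums_unique[OF geo] by simp
    finally show ?thesis .
  qed
  moreover have "prob B0 \<le> prob B1 + prob (\<Union>n. N n)"
  proof -
    have "prob B0 \<le> prob (B1 \<union> (\<Union>n. N n))" using B1 Pn(4) by (intro finite_measure_mono sets.Un sets.countable_UN) (auto simp: B1_def)
    also have "\<dots> \<le> prob B1 + prob (\<Union>n. N n)" using B1 Pn(4) by (intro measure_Un_le) auto
    finally show ?thesis .
  qed
  ultimately have B1pos: "prob B1 > 0" using B0(2) unfolding \<beta>_def by linarith
  have yy: "AE w\<in>B1 in M. dst (y n) (y m) w \<le> r w" for n m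
  proof -
    have lt: "AE w\<in>B1 in M. dst (y n) (y m) w \<le> r w" if "m < n" for n m
    proof -
      define k where "k = n - 1"
      have k: "n = Suc k" "m \<le> k" using that by (auto simp: k_def)
      show ?thesis using Qn(3)[OF yY[OF k(2)]] unfolding k(1) by eventually_elim (auto simp: B1_def)
    qed
    consider "m < n" | "n < m" | "n = m" by linarith
    then show ?thesis
    proof cases
      case 1 then show ?thesis by (rule lt)
    next
      case 2 show ?thesis using lt[OF 2] dst_sym[OF yE yE, of m n] by eventually_elim simp
    next
      case 3 show ?thesis using dst_self[OF yE, of m] r(2) unfolding 3 by eventually_elim simp
    qed
  qed
  \<comment> \<open>Off \<open>B1\<close> everything is glued to \<open>p\<close>, so that the diameter vanishes there.\<close>
  define y' c' where "y' n = patch B1 (y n) p" and "c' n = patch B1 (c n) p" for n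
  have y'W: "y' n \<in> W" for n unfolding y'_def by (rule ccl_patch[OF W(1) yW pW B1])
  have c'0: "c' 0 = y' 0" by (simp add: c'_def y'_def c0)
  have c'S: "c' (Suc n) = conv (\<lambda>_. 1/2) (y' (Suc n)) (c' n)" for n
    unfolding c'_def y'_def Qn(2) patch_def
    by (insert yE[of "Suc n"] cE[of n] pE B1, rule_tac is_lc_eq[of "y (Suc n)" "c n" p p], (rule is_lc_intros | (simp add: field_simps; fail))+)
  have le: "AE w\<in>B1 in M. dst (y' n) (y' m) w \<le> r w" for n m
    using patch_patch_dst[OF B1 yE yE pE, of n m] yy[of n m] by eventually_elim (auto simp: y'_def)
  have off: "AE w in M. w \<notin> B1 \<longrightarrow> dst (y' n) (y' m) w = 0" for n m
    using patch_patch_dst[OF B1 yE yE pE, of n m] by eventually_elim (auto simp: y'_def)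
  have ge: "AE w\<in>B1 in M. (1 - 2 * (1/4)^Suc n) * r w \<le> dst (y' (Suc n)) (c' n) w" for n
    using patch_patch_dst[OF B1 yE cE pE, of "Suc n" n] Qn(4)[of n]
    by eventually_elim (auto simp: y'_def c'_def B1_def)
  obtain H where H: "H \<subseteq> W" "ccl H" "H \<noteq> {}"
    and Hle: "\<And>u v. u \<in> H \<Longrightarrow> v \<in> H \<Longrightarrow> AE w in M. dst u v w \<le> (if w \<in> B1 then r w else 0)"
    and Hge: "\<And>z h. z \<in> H \<Longrightarrow> (\<And>u. u \<in> H \<Longrightarrow> AE w in M. ereal (dst z u w) \<le> h w) \<Longrightarrow>
      AE w\<in>B1 in M. ereal (r w) \<le> h w"
    using diametral[OF W(1) y'W r B1 le off c'0 c'S ge] by blast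
  have HG: "H \<subseteq> G" using H(1) W(2) by blast
  have rpos: "0 < r w" if "w \<in> B1" for w using B0(4)[of w] \<rho> that by (auto simp: B1_def)
  show False by (rule no_diametral_subset[OF rns bG HG H(2,3) B1 B1pos r(1) rpos Hle Hge])
qed

section \<open>The constant net\<close>

text \<open>
  Representatives of a partition of unity must first be replaced by a genuine partition before \<open>\<sigma>\<close>-stability applies.
\<close>

lemma stable_sum_sets_const:
  assumes H: "sigma_stable M E H" and a: "partition_of_unity M a"
    and A: "\<And>n. A n \<in> events" "\<And>n. a n = event_class M (A n)"
  shows "stable_sum_sets M E A (\<lambda>_. H) = H"
proof -
  have HE: "H \<subseteq> carrier E" using H by (simp add: sigma_stable_iff)
  note part = partition_of_unity_AE[OF a A]
  obtain A' where A'0: "meas_partition M A' \<and> (\<forall>n. A' n \<inter> (\<Union>k. A k) \<subseteq> A n)"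
    using ex_partition[of A, OF A(1)] by (elim exE)
  have A': "meas_partition M A'" "A' n \<inter> (\<Union>k. A k) \<subseteq> A n" for n using A'0 by simp_all
  have glue: "\<exists>y\<in>H. stable_sum M E A x = y \<and> (\<forall>n. L0_ind M (A n) \<odot> y = L0_ind M (A n) \<odot> x n)" if x: "\<And>n. x n \<in> H" for x
  proof -
    have xE: "x n \<in> carrier E" for n using x HE by blast
    have "range x \<subseteq> H" using x by blast
    then obtain y where y: "y \<in> H" "\<And>n. AE w\<in>A' n in M. dst y (x n) w = 0"
      using H A'(1) unfolding sigma_stable_iff by blast
    have yE: "y \<in> carrier E" using y(1) HE by blast
    have y2: "AE w\<in>A n in M. dst y (x n) w = 0" for n
    proof -
      have "AE w in M. \<forall>m. w \<in> A' m \<longrightarrow> dst y (x m) w = 0" using y(2) by (simp add: AE_all_countable)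
      then show ?thesis using part AE_space
      proof eventually_elim
        case (elim w)
        show ?case
        proof
          assume w: "w \<in> A n"
          have "w \<in> (\<Union>m. A' m)" using elim(3) A'(1) by (simp add: meas_partition_def)
          then obtain m where m: "w \<in> A' m" by (rule UN_E)
          then have "w \<in> A m" using w by (intro subsetD[OF A'(2)]) blast
          then have "m = n" using elim(2) w by blast
          then show "dst y (x n) w = 0" using elim(1) m by blast
        qed
      qed
    qed
    then have y3: "\<forall>n. L0_ind M (A n) \<odot> y = L0_ind M (A n) \<odot> x n" using ind_smult_eq_iff[OF A(1) yE xE] by blast
    have "stable_sum M E A x = y" unfolding stable_sum_def
    proof (rule the_equality)
      fix y' assume y': "y' \<in> carrier E \<and> (\<forall>n. L0_ind M (A n) \<odot> y' = L0_ind M (A n) \<odot> x n)"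
      then have y'E: "y' \<in> carrier E" by blast
      have "AE w\<in>A n in M. dst y' y w = 0" for n
        using ind_smult_eq_iff[OF A(1) y'E yE, of n] y' y3 by simp
      then have "AE w in M. \<forall>n. w \<in> A n \<longrightarrow> dst y' y w = 0" unfolding AE_all_countable by blast
      then have "AE w in M. dst y' y w = 0" using part by eventually_elim blast
      then show "y' = y" by (rule dst_eq_0[OF y'E yE])
    qed (use yE y3 in blast)
    then show ?thesis using y(1) y3 by blast
  qed
  show ?thesis
  proof (intro equalityI subsetI)
    fix z assume "z \<in> stable_sum_sets M E A (\<lambda>_. H)"
    then obtain x where "\<forall>n. x n \<in> H" "z = stable_sum M E A x" unfolding stable_sum_sets_def by blast
    then show "z \<in> H" using glue[of x] by auto
  next
    fix z assume z: "z \<in> H"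
    obtain y where y: "y \<in> H" "stable_sum M E A (\<lambda>_. z) = y" "\<forall>n. L0_ind M (A n) \<odot> y = L0_ind M (A n) \<odot> z"
      using glue[of "\<lambda>_. z"] z by blast
    have E: "y \<in> carrier E" "z \<in> carrier E" using y z HE by auto
    have "AE w\<in>A n in M. dst y z w = 0" for n using ind_smult_eq_iff[OF A(1) E] y(3) by blast
    then have "AE w in M. \<forall>n. w \<in> A n \<longrightarrow> dst y z w = 0" unfolding AE_all_countable by blast
    then have "AE w in M. dst y z w = 0" using part by eventually_elim blast
    then have "y = z" by (rule dst_eq_0[OF E])
    then have "z = stable_sum M E A (\<lambda>_. z)" using y(2) by simp
    then show "z \<in> stable_sum_sets M E A (\<lambda>_. H)"
      unfolding stable_sum_sets_def mem_Collect_eq by (intro exI[of _ "\<lambda>_. z"] conjI allI z)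
  qed
qed

text \<open>
  A one-point index set with the trivial relation \<open>i|a = i|b \<longleftrightarrow> a = b\<close>, available in every index type.
\<close>

lemma constant_net:
  fixes i :: 'i
  assumes H: "sigma_stable M E H"
  shows "consistent_net M E H {i} {(i, i)} ((\<lambda>a. ((i, a), (i, a))) ` carrier (meas_alg M)) (\<lambda>_. H)"
proof -
  let ?r = "(\<lambda>a. ((i, a), (i, a))) ` carrier (meas_alg M)"
  have top: "event_class M (space M) \<in> carrier (meas_alg M)" by (auto simp: meas_alg_carrier)
  have "equiv ({i} \<times> carrier (meas_alg M)) ?r"
    by (rule equivI) (auto simp: refl_on_def sym_def trans_def)
  moreover have "greatest (meas_alg M) (event_class M (space M)) {a \<in> carrier (meas_alg M). ((i, a), (i, a)) \<in> ?r}"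
    unfolding greatest_def
  proof (intro conjI ballI)
    fix a assume "a \<in> {a \<in> carrier (meas_alg M). ((i, a), (i, a)) \<in> ?r}"
    then obtain A where A: "A \<in> events" "a = event_class M A" by (auto simp: meas_alg_carrier)
    have "AE w\<in>A in M. w \<in> space M" using AE_space by eventually_elim simp
    then show "a \<sqsubseteq>\<^bsub>meas_alg M\<^esub> event_class M (space M)" using A by (simp add: meas_alg_le)
  qed (use top in auto)
  ultimately have "regular_equiv M {i} ?r" unfolding regular_equiv_def by blast
  then have "B_stable M {i} ?r"
    unfolding B_stable_def partition_of_unity_def by (auto simp: image_subset_iff)
  moreover have "directed_set {i} {(i, i)}"
    by (auto simp: directed_set_def preorder_on_def refl_on_def trans_def)
  moreover have "stable_sum_sets M E A (\<lambda>n. H) = H"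
    if "partition_of_unity M a" "\<forall>n. A n \<in> events \<and> a n = event_class M (A n)" for a A
    using that by (intro stable_sum_sets_const[OF H, of a]) auto
  ultimately show ?thesis unfolding consistent_net_def using H by auto
qed

section \<open>The equivalence\<close>

text \<open>
  The event \<open>B\<close> of the argument by the constant net is where the diameter is positive and at most \<open>r = R(H, H)\<close>.
  There the distances from any \<open>y \<in> H\<close> are at most \<open>r\<close>, so gluing \<open>y\<close> on \<open>B\<close> with a centre off \<open>B\<close> gives a centre.
\<close>

lemma complete_imp_normal:
  assumes G: "nested_compact G" "G \<noteq> {}" and c: "random_complete_normal_structure TYPE('i) M E G"
  shows "random_normal_structure M E G"
  unfolding random_normal_structure_def
proof (intro conjI allI impI)
  have cG: "ccl G" by (rule nested_compact_ccl[OF G(1)])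
  then show "eps_lam_closed M E G" "L0_convex M E G" by (auto simp: ccl_def)
  fix H assume H0: "H \<subseteq> G \<and> as_bounded M E H \<and> eps_lam_closed M E H \<and> L0_convex M E H \<and>
    L0_less M (L0_class M (\<lambda>_. 0)) (rdiam M E H)"
  then have HG: "H \<subseteq> G" and bH: "as_bounded M E H" and cH: "ccl H" and
    less: "L0_less M (L0_class M (\<lambda>_. 0)) (rdiam M E H)" by (auto simp: ccl_def)
  have HE: "H \<subseteq> carrier E" and ne: "H \<noteq> {}" using bH by (auto simp: as_bounded_iff)
  have xE: "x \<in> carrier E" if "x \<in> H" for x using HE that by blast
  have nH: "nested_compact H" by (rule nested_compact_subset[OF G(1) cH HG])
  have sH: "sigma_stable M E H" by (rule nested_compact_sigma_stable[OF nH ne])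
  note Dm = diam_measurable[OF HE ne] and Dup = diam_upper[OF HE]
  have two: "\<exists>x\<in>H. \<exists>y\<in>H. x \<noteq> y"
  proof (rule ccontr)
    assume "\<not> ?thesis"
    then have eq: "x = y" if "x \<in> H" "y \<in> H" for x y using that by blast
    have "AE w in M. diam H w \<le> 0"
    proof (rule diam_least[OF HE ne])
      fix x y assume xy: "x \<in> H" "y \<in> H"
      from dst_self[OF xE[OF xy(1)]] show "AE w in M. ereal (dst x y w) \<le> 0"
        unfolding eq[OF xy(2,1)] by eventually_elim simp
    qed simp
    moreover have "AE w in M. 0 \<le> diam H w"
      using less Dm unfolding L0_less_def rdiam_eq[OF HE ne] by (simp add: L0_le_class)
    ultimately have "AE w in M. 0 = diam H w" by eventually_elim simp
    then have "L0_class M (\<lambda>_. 0) = L0_class M (diam H)" using Dm by (simp add: L0_class_eq_iff)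
    then show False using less unfolding L0_less_def rdiam_eq[OF HE ne] by blast
  qed
  obtain i :: 'i where True by blast
  let ?r = "(\<lambda>a. ((i, a), (i, a))) ` carrier (meas_alg M)"
  let ?S = "\<Union>\<alpha>\<in>{i}. cheb_centre M E H H"
  let ?C = "eps_lam_topology M E closure_of ?S"
  have dec: "decreasing_net {i} {(i, i)} (\<lambda>_. H)" by (simp add: decreasing_net_def)
  have "let C = ?C in C \<noteq> {} \<and> (\<forall>B\<in>events. (AE w\<in>B in M. w \<in> L0_less_event M (L0_class M (\<lambda>_. 0)) (rdiam M E H)) \<and>
      measure M B > 0 \<longrightarrow> (\<exists>y\<in>H. L0_ind M B \<odot> y \<notin> (\<lambda>z. L0_ind M B \<odot> z) ` C))"
  proof -
    have net: "consistent_net M E H {i} {(i, i)} ?r (\<lambda>_. H) \<and> decreasing_net {i} {(i, i)} (\<lambda>_. H) \<and>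
        (\<forall>\<alpha>\<in>{i}. cheb_rad M E H H = cheb_rad M E H H)"
      using constant_net[OF sH, of i] dec by blast
    have Hp: "H \<subseteq> G \<and> eps_lam_closed M E H \<and> L0_convex M E H \<and> (\<exists>x\<in>H. \<exists>y\<in>H. x \<noteq> y)"
      using H0 two by blast
    note c' = c[unfolded random_complete_normal_structure_def, THEN conjunct2, THEN conjunct2, THEN conjunct2]
    show ?thesis
      by (rule c'[THEN spec[of _ H], THEN mp, OF Hp, THEN spec[of _ "{i}"], THEN spec[of _ "{(i, i)}"],
        THEN spec[of _ ?r], THEN spec[of _ "\<lambda>_. H"], THEN mp, OF net])
  qed
  then have Cne: "?C \<noteq> {}" and
    C: "\<And>B. B \<in> events \<Longrightarrow> AE w\<in>B in M. w \<in> L0_less_event M (L0_class M (\<lambda>_. 0)) (rdiam M E H) \<Longrightarrow>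
      prob B > 0 \<Longrightarrow> \<exists>y\<in>H. L0_ind M B \<odot> y \<notin> (\<lambda>z. L0_ind M B \<odot> z) ` ?C"
    by (auto simp: Let_def)
  have "?S \<noteq> {}" using Cne by (metis closure_of_empty)
  then obtain z where z: "z \<in> cheb_centre M E H H" by blast
  then have zH: "z \<in> H" by (simp add: cheb_centre_def)
  have zE: "z \<in> carrier E" by (rule xE[OF zH])
  obtain b where b: "b \<in> borel_measurable M" "\<And>x. x \<in> H \<Longrightarrow> AE w in M. nrm x w \<le> b w"
    using bH by (auto simp: as_bounded_iff)
  have db: "AE w in M. dst x y w \<le> b w + b w" if "x \<in> H" "y \<in> H" for x y
    using dst_le_nrm[OF xE xE, OF that] b(2)[OF that(1)] b(2)[OF that(2)] by eventually_elim linarith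
  obtain r where r: "r \<in> borel_measurable M" "AE w in M. 0 \<le> r w" "cheb_rad M E H H = L0_class M (\<lambda>w. ereal (r w))"
    by (rule cheb_rad_real[OF HE ne HE ne _ db]) (use b(1) in auto)
  have zr: "AE w in M. dst z y w \<le> r w" if "y \<in> H" for y
    using z that cheb_centre_iff[OF HE ne HE r(1,3)] by blast
  \<comment> \<open>The event on which \<open>z\<close> might be diametral.\<close>
  define B where "B = {w \<in> space M. diam H w \<le> ereal (r w) \<and> 0 < diam H w}"
  have Be: "B \<in> events" unfolding B_def using Dm r(1) by simp
  have "prob B = 0"
  proof (rule ccontr)
    assume "prob B \<noteq> 0"
    then have pos: "prob B > 0" by (simp add: zero_less_measure_iff)
    have "AE w\<in>B in M. w \<in> L0_less_event M (L0_class M (\<lambda>_. 0)) (rdiam M E H)"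
      using diam_event[OF HE ne] by eventually_elim (simp add: B_def)
    from C[OF Be this pos] obtain y where y: "y \<in> H" "L0_ind M B \<odot> y \<notin> (\<lambda>z. L0_ind M B \<odot> z) ` ?C" by blast
    have yE: "y \<in> carrier E" by (rule xE[OF y(1)])
    let ?p = "patch B y z"
    have pH: "?p \<in> H" by (rule ccl_patch[OF cH y(1) zH Be])
    have pE: "?p \<in> carrier E" by (rule xE[OF pH])
    note pd = patch_dst[OF Be yE zE]
    have "AE w in M. dst ?p v w \<le> r w" if v: "v \<in> H" for v
      using pd dst_local[OF pE yE xE[OF v]] dst_local[OF pE zE xE[OF v]] zr[OF v] Dup[OF y(1) v]
    proof eventually_elim
      case (elim w)
      show ?case
      proof (cases "w \<in> B")
        case True
        then have "ereal (dst y v w) \<le> ereal (r w)" using elim(5) unfolding B_def by (blast intro: order_trans)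
        then show ?thesis using elim(1,2) True by simp
      next
        case False then show ?thesis using elim by simp
      qed
    qed
    then have "?p \<in> cheb_centre M E H H" using cheb_centre_iff[OF HE ne HE r(1,3)] pH by blast
    then have "?p \<in> ?C" using closure_subset[of ?S] HE by (auto simp: cheb_centre_def)
    moreover have "L0_ind M B \<odot> y = L0_ind M B \<odot> ?p"
      using pd dst_sym[OF yE pE] by (subst ind_smult_eq_iff[OF Be yE pE]) (auto elim: AE_mp)
    ultimately show False using y(2) by blast
  qed
  then have "AE w in M. w \<notin> B" using prob_eq_0[OF Be] by blast
  moreover have "AE w in M. rad H z w \<le> ereal (r w)" by (rule rad_least[OF HE ne zE]) (use r zr in auto)
  moreover note diam_event[OF HE ne]
  ultimately have "AE w in M. w \<in> L0_less_event M (L0_class M (\<lambda>_. 0)) (rdiam M E H) \<longrightarrow> rad H z w < diam H w"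
    using AE_space
  proof eventually_elim
    case (elim w)
    show ?case
    proof
      assume "w \<in> L0_less_event M (L0_class M (\<lambda>_. 0)) (rdiam M E H)"
      then have "ereal (r w) < diam H w" using elim(1,3,4) by (auto simp: B_def not_le)
      then show "rad H z w < diam H w" using elim(2) by (rule le_less_trans[rotated])
    qed
  qed
  then have "L0_less_on M (L0_less_event M (L0_class M (\<lambda>_. 0)) (rdiam M E H)) (cheb_rad_at M E H z) (rdiam M E H)"
    unfolding rdiam_eq[OF HE ne] cheb_rad_at_eq[OF HE ne zE] using rad_measurable[OF HE ne zE] Dm by (simp add: L0_less_on_class)
  then show "\<exists>z\<in>H. L0_less_on M (L0_less_event M (L0_class M (\<lambda>_. 0)) (rdiam M E H)) (cheb_rad_at M E H z) (rdiam M E H)"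
    using zH by blast
qed (rule G(2))

text \<open>
  A centre of \<open>W\<close> in itself is a centre of every \<open>W\<^sub>\<alpha>\<close>, so the closure is not empty.  If on \<open>B\<close> it were all of \<open>W\<close>, a
  nearby centre \<open>c\<close> of some \<open>W\<^sub>\<alpha>\<close> would put \<open>W\<^sub>\<alpha>\<close> within \<open>r + e\<close> of any given \<open>y\<close>, as \<open>net_not_dense\<close> excludes.
\<close>

lemma normal_imp_complete:
  assumes G: "nested_compact G" "G \<noteq> {}" and n: "random_normal_structure M E G"
  shows "random_complete_normal_structure TYPE('i) M E G"
proof -
  have bG: "as_bounded M E G" by (rule nested_compact_bounded[OF G])
  have cG: "ccl G" by (rule nested_compact_ccl[OF G(1)])
  have main: "let C = eps_lam_topology M E closure_of (\<Union>\<alpha>\<in>\<Lambda>. cheb_centre M E (V \<alpha>) W)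
      in C \<noteq> {} \<and> (\<forall>B\<in>events.
          (AE w\<in>B in M. w \<in> L0_less_event M (L0_class M (\<lambda>_. 0)) (rdiam M E W)) \<and> measure M B > 0 \<longrightarrow>
          (\<exists>y\<in>W. L0_ind M B \<odot> y \<notin> (\<lambda>z. L0_ind M B \<odot> z) ` C))"
    if WG: "W \<subseteq> G" and cW: "ccl W" and ne: "W \<noteq> {}"
      and net: "consistent_net M E W \<Lambda> leq r0 V" and dec: "decreasing_net \<Lambda> leq V"
      and rad: "\<forall>\<alpha>\<in>\<Lambda>. cheb_rad M E (V \<alpha>) W = cheb_rad M E W W"
    for W and \<Lambda> :: "'i set" and leq r0 V
  proof -
    have WE: "W \<subseteq> carrier E" by (rule ccl_sub[OF cW])
    have xE: "x \<in> carrier E" if "x \<in> W" for x using WE that by blast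
    have nW: "nested_compact W" by (rule nested_compact_subset[OF G(1) cW WG])
    obtain b where b: "b \<in> borel_measurable M" "\<And>x. x \<in> G \<Longrightarrow> AE w in M. nrm x w \<le> b w"
      using bG by (auto simp: as_bounded_iff)
    have db: "AE w in M. dst x y w \<le> b w + b w" if "x \<in> W" "y \<in> W" for x y
    proof -
      have "x \<in> G" "y \<in> G" using that WG by auto
      from b(2)[OF this(1)] b(2)[OF this(2)] dst_le_nrm[OF xE xE, OF that] show ?thesis by eventually_elim linarith
    qed
    obtain r where r: "r \<in> borel_measurable M" "AE w in M. 0 \<le> r w" "cheb_rad M E W W = L0_class M (\<lambda>w. ereal (r w))"
      by (rule cheb_rad_real[OF WE ne WE ne _ db]) (use b(1) in auto)
    obtain p where p0: "p \<in> cheb_centre M E W W" using cheb_centre_nonempty[OF nW ne r(1,3)] by blast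
    have p: "p \<in> W" "\<And>y. y \<in> W \<Longrightarrow> AE w in M. dst p y w \<le> r w"
      using p0 cheb_centre_iff[OF WE ne WE r(1,3)] by blast+
    have V: "V \<alpha> \<subseteq> W" "sigma_stable M E (V \<alpha>)" "cheb_rad M E (V \<alpha>) W = L0_class M (\<lambda>w. ereal (r w))" if "\<alpha> \<in> \<Lambda>" for \<alpha>
      using net rad that r(3) by (auto simp: consistent_net_def)
    have VE: "V \<alpha> \<subseteq> carrier E" "V \<alpha> \<noteq> {}" if "\<alpha> \<in> \<Lambda>" for \<alpha> using V(2)[OF that] by (auto simp: sigma_stable_iff)
    have centre: "x \<in> cheb_centre M E (V \<alpha>) W \<longleftrightarrow> x \<in> W \<and> (\<forall>y\<in>V \<alpha>. AE w in M. dst x y w \<le> r w)" if "\<alpha> \<in> \<Lambda>" for x \<alpha>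
      by (rule cheb_centre_iff[OF VE[OF that] WE r(1) V(3)[OF that]])
    have dir: "\<Lambda> \<noteq> {}" "\<And>\<alpha> \<beta>. \<alpha> \<in> \<Lambda> \<Longrightarrow> \<beta> \<in> \<Lambda> \<Longrightarrow> \<exists>\<gamma>\<in>\<Lambda>. V \<gamma> \<subseteq> V \<alpha> \<inter> V \<beta>"
    proof -
      have ds: "directed_set \<Lambda> leq" using net by (simp add: consistent_net_def)
      then show "\<Lambda> \<noteq> {}" by (simp add: directed_set_def)
      fix \<alpha> \<beta> assume ab: "\<alpha> \<in> \<Lambda>" "\<beta> \<in> \<Lambda>"
      then obtain \<gamma> where g: "\<gamma> \<in> \<Lambda>" "(\<alpha>, \<gamma>) \<in> leq" "(\<beta>, \<gamma>) \<in> leq" using ds unfolding directed_set_def by blast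
      then show "\<exists>\<gamma>\<in>\<Lambda>. V \<gamma> \<subseteq> V \<alpha> \<inter> V \<beta>" using dec ab unfolding decreasing_net_def by blast
    qed
    let ?S = "\<Union>\<alpha>\<in>\<Lambda>. cheb_centre M E (V \<alpha>) W"
    let ?C = "eps_lam_topology M E closure_of ?S"
    have SE: "?S \<subseteq> carrier E" using WE by (auto simp: cheb_centre_def)
    obtain \<alpha>0 where \<alpha>0: "\<alpha>0 \<in> \<Lambda>" using dir(1) by blast
    have "p \<in> cheb_centre M E (V \<alpha>0) W" using centre[OF \<alpha>0] p V(1)[OF \<alpha>0] by blast
    then have "p \<in> ?S" using \<alpha>0 by blast
    then have Cne: "?C \<noteq> {}" using closure_subset[OF SE] by blast
    have "\<exists>y\<in>W. L0_ind M B \<odot> y \<notin> (\<lambda>z. L0_ind M B \<odot> z) ` ?C"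
      if Be: "B \<in> events" and Bev: "AE w\<in>B in M. w \<in> L0_less_event M (L0_class M (\<lambda>_. 0)) (rdiam M E W)"
        and pos: "prob B > 0" for B
    proof (rule ccontr)
      assume "\<not> ?thesis"
      then have dense: "\<And>y. y \<in> W \<Longrightarrow> \<exists>z\<in>?C. L0_ind M B \<odot> y = L0_ind M B \<odot> z" by blast
      have pE: "p \<in> carrier E" by (rule xE[OF p(1)])
      have "AE w in M. diam W w \<le> ereal (2 * r w)"
      proof (rule diam_least[OF WE ne])
        show "(\<lambda>w. ereal (2 * r w)) \<in> borel_measurable M" using r(1) by simp
        fix x y assume xy: "x \<in> W" "y \<in> W"
        show "AE w in M. ereal (dst x y w) \<le> ereal (2 * r w)"
          using dst_triangle[OF xE[OF xy(1)] pE xE[OF xy(2)]] dst_sym[OF xE[OF xy(1)] pE] p(2)[OF xy(1)] p(2)[OF xy(2)]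
          by eventually_elim simp
      qed
      moreover note diam_event[OF WE ne]
      ultimately have rB: "AE w\<in>B in M. 0 < r w" using Bev
      proof eventually_elim
        case (elim w)
        show ?case
        proof
          assume "w \<in> B"
          then have "0 < diam W w" using elim(2,3) by blast
          also have "diam W w \<le> ereal (2 * r w)" by (rule elim(1))
          finally show "0 < r w" by (simp add: zero_ereal_def)
        qed
      qed
      have approx: "\<exists>T\<in>V ` \<Lambda>. \<exists>N\<in>events. prob N < e \<and> (\<forall>v\<in>T. AE w in M. w \<in> B \<and> w \<notin> N \<longrightarrow> dst y v w \<le> r w + e)"
        if y: "y \<in> W" and e: "e > 0" for y e
      proof -
        obtain z where z: "z \<in> ?C" "L0_ind M B \<odot> y = L0_ind M B \<odot> z" using dense[OF y] by blast
        have zE: "z \<in> carrier E" and zn: "near z ?S" using z(1) closure_iff_near[OF SE] by auto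
        have yE: "y \<in> carrier E" by (rule xE[OF y])
        have yz: "AE w\<in>B in M. dst y z w = 0" using z(2) ind_smult_eq_iff[OF Be yE zE] by blast
        obtain c where c: "c \<in> ?S" "far c z e < e" using zn e unfolding near_def by blast
        then obtain \<alpha> where \<alpha>: "\<alpha> \<in> \<Lambda>" "c \<in> cheb_centre M E (V \<alpha>) W" by blast
        have cE: "c \<in> carrier E" using c(1) SE by blast
        define N where "N = {w \<in> space M. e \<le> dst c z w}"
        have N: "N \<in> events" "prob N < e" using c(2) cE zE by (auto simp: N_def far_def)
        have "AE w in M. w \<in> B \<and> w \<notin> N \<longrightarrow> dst y v w \<le> r w + e" if v: "v \<in> V \<alpha>" for v
        proof -
          have vE: "v \<in> carrier E" using v VE[OF \<alpha>(1)] by blast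
          have "AE w in M. dst c v w \<le> r w" using centre[OF \<alpha>(1), of c] \<alpha>(2) v by blast
          then show ?thesis using yz dst_local[OF yE zE vE] dst_triangle[OF zE cE vE] dst_sym[OF zE cE] AE_space
            by eventually_elim (auto simp: N_def)
        qed
        then show ?thesis using N \<alpha>(1) by blast
      qed
      show False
      proof (rule net_not_dense[OF n bG cW WG p(1) r(1,2) _ Be pos rB, of "V ` \<Lambda>"])
        show "AE w in M. dst y p w \<le> r w" if "y \<in> W" for y
          using p(2)[OF that] dst_sym[OF xE[OF that] pE] by eventually_elim simp
        show "\<exists>T\<in>V ` \<Lambda>. T \<subseteq> U \<inter> U'" if U: "U \<in> V ` \<Lambda>" "U' \<in> V ` \<Lambda>" for U U'
        proof -
          obtain \<alpha> \<beta> where "\<alpha> \<in> \<Lambda>" "\<beta> \<in> \<Lambda>" "U = V \<alpha>" "U' = V \<beta>" using U by blast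
          then show ?thesis using dir(2)[of \<alpha> \<beta>] by blast
        qed
      qed (use dir(1) V approx in auto)
    qed
    then show ?thesis using Cne unfolding Let_def by blast
  qed
  show ?thesis unfolding random_complete_normal_structure_def
  proof (intro conjI allI impI)
    show "as_bounded M E G" by (rule bG)
    show "eps_lam_closed M E G" "L0_convex M E G" using cG by (auto simp: ccl_def)
  next
    fix W and \<Lambda> :: "'i set" and leq r V
    assume W: "W \<subseteq> G \<and> eps_lam_closed M E W \<and> L0_convex M E W \<and> (\<exists>x\<in>W. \<exists>y\<in>W. x \<noteq> y)"
      and net: "consistent_net M E W \<Lambda> leq r V \<and> decreasing_net \<Lambda> leq V \<and>
        (\<forall>\<alpha>\<in>\<Lambda>. cheb_rad M E (V \<alpha>) W = cheb_rad M E W W)"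
    have "ccl W" "W \<noteq> {}" "W \<subseteq> G" using W by (auto simp: ccl_def)
    then show "let C = eps_lam_topology M E closure_of (\<Union>\<alpha>\<in>\<Lambda>. cheb_centre M E (V \<alpha>) W)
      in C \<noteq> {} \<and> (\<forall>B\<in>events.
          (AE w\<in>B in M. w \<in> L0_less_event M (L0_class M (\<lambda>_. 0)) (rdiam M E W)) \<and> measure M B > 0 \<longrightarrow>
          (\<exists>y\<in>W. L0_ind M B \<odot> y \<notin> (\<lambda>z. L0_ind M B \<odot> z) ` C))"
      using net by (intro main) blast+
  qed
qed

end

theorem theorem1p14:
  fixes M :: "'w measure"
    and E :: "('w, 'k::{real_normed_field, second_countable_topology}, 'e) rn_module"
    and G :: "'e set"
  assumes "rn_module M E"
    and "eps_lam_complete M E"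
    and "L0_convexly_compact M E G"
  shows "random_complete_normal_structure TYPE('i) M E G \<longleftrightarrow> random_normal_structure M E G"
proof -
  interpret rn_module M E by (rule assms(1))
  have G: "nested_compact G" "G \<noteq> {}"
    using convexly_compact_nested_compact[OF assms(3)] assms(3) by (auto simp: L0_convexly_compact_def)
  show ?thesis
    using complete_imp_normal[OF G] normal_imp_complete[OF G] by blast
qed

end
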